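(* Let $\mathcal{X}$ be a domain, let $\mathcal{A},\mathcal{S}\subseteq\mathcal{X}$ be finite (the target space and the sample space), let $f\sim\mathcal{GP}(\mu,k)$ be a Gaussian process on $\mathcal{X}$ with known mean function $\mu$ and kernel $k$, and let the observation noise $\varepsilon_x$ be mutually independent zero-mean Gaussian with known variance $\rho^2(x)>0$. Assume that $\gamma_n$ is sublinear in $n$. Let the points $x_1,x_2,\dots\in\mathcal{S}$ be selected either by VTL or by ITL, and assume that the uncertainty reduction $\psi_{\mathcal{A}}$ associated with the chosen rule is submodular. Then there exists a constant $C$ such that for every $n\ge 1$ and every $x\in\mathcal{A}$, $$\sigma_n^2(x)\;\le\;\eta_{\mathcal{S}}^2(x)+C\,\frac{\gamma_{\mathcal{A},\mathcal{S}}(n)}{\sqrt{n}} .$$ Moreover, there exists a constant $C'$ such that for every $n\ge1$ and every $x\in\mathcal{A}\cap\mathcal{S}$, $$\sigma_n^2(x)\;\le\;C'\,\frac{\gamma_{\mathcal{A},\mathcal{S}}(n)}{n}.$$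
   Context: Notation. For a finite multiset $X$ of points of $\mathcal{X}$, $f_X=(f_x)_{x\in X}$ and $y_X=(y_x)_{x\in X}$ with $y_x=f_x+\varepsilon_x$, the noise being independent of $f$; repeated occurrences of a point in $X$ correspond to observations with independent noise. "$X\subseteq\mathcal{S}$" for sets of observed points allows multisets. $\mathcal{D}_n=\{(x_i,y_i)\}_{i\le n}$ with $y_i=y_{x_i}$. $\mathrm{I}(\cdot;\cdot\mid\cdot)$ is the (conditional) mutual information (natural logarithm). Posterior variance: $\sigma_n^2(x)=\mathrm{Var}(f_x\mid\mathcal{D}_n)$. Irreducible uncertainty: $\eta_{\mathcal{S}}^2(x)=\mathrm{Var}(f_x\mid f_{\mathcal{S}})$. Information capacity: $\gamma_{\mathcal{A},\mathcal{S}}(n)=\max_{X\subseteq\mathcal{S},\,|X|\le n}\mathrm{I}(f_{\mathcal{A}};y_X)$, and $\gamma_n=\max_{X\subseteq\mathcal{X},\,|X|\le n}\mathrm{I}(f_X;y_X)$. Sublinear means $\gamma_n/n\to0$. Decision rules. ITL: $x_n\in\arg\max_{x\in\mathcal{S}}\mathrm{I}(f_{\mathcal{A}};y_x\mid\mathcal{D}_{n-1})$. VTL: $x_n\in\arg\min_{x\in\mathcal{S}}\sum_{x'\in\mathcal{A}}\mathrm{Var}(f_{x'}\mid\mathcal{D}_{n-1},y_x)$. Uncertainty reduction: for ITL, $\psi_{\mathcal{A}}(X)=\mathrm{I}(f_{\mathcal{A}};y_X)$; for VTL, $\psi_{\mathcal{A}}(X)=\mathrm{tr}\,\mathrm{Var}(f_{\mathcal{A}})-\mathrm{tr}\,\mathrm{Var}(f_{\mathcal{A}}\mid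 y_X)$. Submodular means: for all $x\in\mathcal{S}$ and $X'\subseteq X\subseteq\mathcal{S}$, $\psi_{\mathcal{A}}(X'\cup\{x\})-\psi_{\mathcal{A}}(X')\ge\psi_{\mathcal{A}}(X\cup\{x\})-\psi_{\mathcal{A}}(X)$. The constants $C,C'$ may depend on the problem ($\mathcal{A},\mathcal{S},k,\rho$) but not on $n$ or $x$. *)

theory Defs
  imports "HOL-Probability.Probability" "HOL-Library.Multiset"
begin

section \<open>Random vectors, mutual information and conditional variance\<close>

abbreviation borel_vec :: "'i set \<Rightarrow> ('i \<Rightarrow> real) measure" where
  "borel_vec I \<equiv> PiM I (\<lambda>_. borel)"

definition rvec :: "'i set \<Rightarrow> ('i \<Rightarrow> 'w \<Rightarrow> real) \<Rightarrow> 'w \<Rightarrow> 'i \<Rightarrow> real" where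
  "rvec I Z = (\<lambda>\<omega>. \<lambda>i\<in>I. Z i \<omega>)"

definition gen_algebra :: "'w measure \<Rightarrow> 'i set \<Rightarrow> ('i \<Rightarrow> 'w \<Rightarrow> real) \<Rightarrow> 'w measure" where
  "gen_algebra M I Z = vimage_algebra (space M) (rvec I Z) (borel_vec I)"

text \<open>The base \<^term>\<open>exp 1\<close> selects the natural logarithm.\<close>

definition minfo ::
  "'w measure \<Rightarrow> 'i set \<Rightarrow> ('i \<Rightarrow> 'w \<Rightarrow> real) \<Rightarrow> 'j set \<Rightarrow> ('j \<Rightarrow> 'w \<Rightarrow> real) \<Rightarrow> real" where
  "minfo M I Z J W =
     prob_space.mutual_information M (exp 1) (borel_vec I) (borel_vec J) (rvec I Z) (rvec J W)"

definition cond_minfo ::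
  "'w measure \<Rightarrow> 'i set \<Rightarrow> ('i \<Rightarrow> 'w \<Rightarrow> real) \<Rightarrow> ('w \<Rightarrow> real) \<Rightarrow>
   'j set \<Rightarrow> ('j \<Rightarrow> 'w \<Rightarrow> real) \<Rightarrow> real" where
  "cond_minfo M I Z V J W =
     prob_space.conditional_mutual_information M (exp 1)
       (borel_vec I) borel (borel_vec J) (rvec I Z) V (rvec J W)"

definition covariance :: "'w measure \<Rightarrow> ('w \<Rightarrow> real) \<Rightarrow> ('w \<Rightarrow> real) \<Rightarrow> real" where
  "covariance M U V = (\<integral>\<omega>. (U \<omega> - (\<integral>\<omega>'. U \<omega>' \<partial>M)) * (V \<omega> - (\<integral>\<omega>'. V \<omega>' \<partial>M)) \<partial>M)"

text \<open>
  The conditional variance of \<open>V\<close> given the random vector \<open>(W\<^sub>j)\<close>, \<open>j \<in> J\<close>, is a random variable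
  defined up to null sets, so statements about it are made almost everywhere. For jointly
  Gaussian variables it is almost surely constant.
\<close>

definition cond_var ::
  "'w measure \<Rightarrow> ('w \<Rightarrow> real) \<Rightarrow> 'j set \<Rightarrow> ('j \<Rightarrow> 'w \<Rightarrow> real) \<Rightarrow> 'w \<Rightarrow> real" where
  "cond_var M V J W =
     (let F = gen_algebra M J W
      in real_cond_exp M F (\<lambda>\<omega>. (V \<omega> - real_cond_exp M F V \<omega>)\<^sup>2))"

section \<open>Gaussian processes and noisy observations\<close>

text \<open>Point masses count as Gaussian, since a kernel is only positive semidefinite.\<close>

definition gaussian_rv :: "'w measure \<Rightarrow> ('w \<Rightarrow> real) \<Rightarrow> bool" where
  "gaussian_rv M Z \<longleftrightarrow> Z \<in> borel_measurable M \<and>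
     ((\<exists>m. AE \<omega> in M. Z \<omega> = m) \<or>
      (\<exists>m s. s > 0 \<and> distributed M lborel Z (normal_density m s)))"

text \<open>
  Joint Gaussianity of the finite-dimensional marginals is expressed by the Gaussianity of all
  linear combinations.
\<close>

definition gaussian_process ::
  "'w measure \<Rightarrow> 'a set \<Rightarrow> ('a \<Rightarrow> 'w \<Rightarrow> real) \<Rightarrow> ('a \<Rightarrow> real) \<Rightarrow> ('a \<Rightarrow> 'a \<Rightarrow> real) \<Rightarrow> bool" where
  "gaussian_process M D f \<mu> k \<longleftrightarrow>
     (\<forall>F c. finite F \<longrightarrow> F \<subseteq> D \<longrightarrow> gaussian_rv M (\<lambda>\<omega>. \<Sum>x\<in>F. c x * f x \<omega>)) \<and>
     (\<forall>x\<in>D. (\<integral>\<omega>. f x \<omega> \<partial>M) = \<mu> x) \<and>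
     (\<forall>x\<in>D. \<forall>x'\<in>D. covariance M (f x) (f x') = k x x')"

text \<open>
  The noise \<^term>\<open>\<epsilon> (x, j)\<close> is the one entering the observation number \<open>j\<close> at the point \<open>x\<close>; its
  standard deviation is \<^term>\<open>\<rho> x\<close>.
\<close>

definition gp_model ::
  "'w measure \<Rightarrow> 'a set \<Rightarrow> ('a \<Rightarrow> 'w \<Rightarrow> real) \<Rightarrow> ('a \<times> nat \<Rightarrow> 'w \<Rightarrow> real) \<Rightarrow>
   ('a \<Rightarrow> real) \<Rightarrow> ('a \<Rightarrow> 'a \<Rightarrow> real) \<Rightarrow> ('a \<Rightarrow> real) \<Rightarrow> bool" where
  "gp_model M D f \<epsilon> \<mu> k \<rho> \<longleftrightarrow>
     prob_space M \<and>
     gaussian_process M D f \<mu> k \<and>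
     (\<forall>x\<in>D. \<forall>j. distributed M lborel (\<epsilon> (x, j)) (normal_density 0 (\<rho> x))) \<and>
     prob_space.indep_vars M (\<lambda>_. borel) \<epsilon> (D \<times> UNIV) \<and>
     prob_space.indep_set M (sets (gen_algebra M D f)) (sets (gen_algebra M (D \<times> UNIV) \<epsilon>))"

text \<open>
  The occurrences of the points of a multiset, numbered so that repeated occurrences carry
  different noise variables.
\<close>

definition occs :: "'a multiset \<Rightarrow> ('a \<times> nat) set" where
  "occs X = {(x, j). j < count X x}"

definition obs :: "('a \<Rightarrow> 'w \<Rightarrow> real) \<Rightarrow> ('a \<times> nat \<Rightarrow> 'w \<Rightarrow> real) \<Rightarrow> 'a \<times> nat \<Rightarrow> 'w \<Rightarrow> real" where
  "obs f \<epsilon> i \<omega> = f (fst i) \<omega> + \<epsilon> i \<omega>"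

definition multisets_upto :: "'a set \<Rightarrow> nat \<Rightarrow> 'a multiset set" where
  "multisets_upto S n = {X. set_mset X \<subseteq> S \<and> size X \<le> n}"

section \<open>Information capacity\<close>

definition capacity ::
  "'w measure \<Rightarrow> ('a \<Rightarrow> 'w \<Rightarrow> real) \<Rightarrow> ('a \<times> nat \<Rightarrow> 'w \<Rightarrow> real) \<Rightarrow> 'a set \<Rightarrow> 'a set \<Rightarrow> nat \<Rightarrow> real" where
  "capacity M f \<epsilon> A S n = (MAX X\<in>multisets_upto S n. minfo M A f (occs X) (obs f \<epsilon>))"

text \<open>
  The domain may be infinite, so the maximum is read as a supremum in the extended reals.
\<close>

definition full_capacity ::
  "'w measure \<Rightarrow> ('a \<Rightarrow> 'w \<Rightarrow> real) \<Rightarrow> ('a \<times> nat \<Rightarrow> 'w \<Rightarrow> real) \<Rightarrow> 'a set \<Rightarrow> nat \<Rightarrow> ereal" where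
  "full_capacity M f \<epsilon> D n =
     (SUP X\<in>multisets_upto D n. ereal (minfo M (occs X) (\<lambda>i. f (fst i)) (occs X) (obs f \<epsilon>)))"

definition sublinear :: "(nat \<Rightarrow> ereal) \<Rightarrow> bool" where
  "sublinear g \<longleftrightarrow> (\<lambda>n. g n / ereal (real n)) \<longlonglongrightarrow> 0"

section \<open>Decision rules\<close>

text \<open>The points chosen in rounds \<open>1, \<dots>, n\<close>; the value \<^term>\<open>p 0\<close> is not used.\<close>

definition sampled :: "(nat \<Rightarrow> 'a) \<Rightarrow> nat \<Rightarrow> 'a multiset" where
  "sampled p n = image_mset p (mset_set {1..n})"

text \<open>A new observation at \<open>x\<close> after those of \<open>X\<close> is number \<^term>\<open>count X x\<close>, with fresh noise.\<close>

definition itl_rule ::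
  "'w measure \<Rightarrow> ('a \<Rightarrow> 'w \<Rightarrow> real) \<Rightarrow> ('a \<times> nat \<Rightarrow> 'w \<Rightarrow> real) \<Rightarrow> 'a set \<Rightarrow> 'a set \<Rightarrow>
   (nat \<Rightarrow> 'a) \<Rightarrow> bool" where
  "itl_rule M f \<epsilon> A S p \<longleftrightarrow>
     (\<forall>n\<ge>1. let X = sampled p (n - 1) in
        is_arg_max (\<lambda>x. cond_minfo M A f (obs f \<epsilon> (x, count X x)) (occs X) (obs f \<epsilon>))
          (\<lambda>x. x \<in> S) (p n))"

definition vtl_rule ::
  "'w measure \<Rightarrow> ('a \<Rightarrow> 'w \<Rightarrow> real) \<Rightarrow> ('a \<times> nat \<Rightarrow> 'w \<Rightarrow> real) \<Rightarrow> 'a set \<Rightarrow> 'a set \<Rightarrow>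
   (nat \<Rightarrow> 'a) \<Rightarrow> bool" where
  "vtl_rule M f \<epsilon> A S p \<longleftrightarrow>
     (\<forall>n\<ge>1. let X = sampled p (n - 1) in
        AE \<omega> in M. is_arg_min
          (\<lambda>x. \<Sum>x'\<in>A. cond_var M (f x') (occs (add_mset x X)) (obs f \<epsilon>) \<omega>)
          (\<lambda>x. x \<in> S) (p n))"

text \<open>
  The uncertainty reductions are random set functions because conditional variances are random
  variables; the one for mutual information does not depend on \<open>\<omega>\<close>.
\<close>

definition itl_reduction ::
  "'w measure \<Rightarrow> ('a \<Rightarrow> 'w \<Rightarrow> real) \<Rightarrow> ('a \<times> nat \<Rightarrow> 'w \<Rightarrow> real) \<Rightarrow> 'a set \<Rightarrow>
   'a multiset \<Rightarrow> 'w \<Rightarrow> real" where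
  "itl_reduction M f \<epsilon> A X \<omega> = minfo M A f (occs X) (obs f \<epsilon>)"

definition vtl_reduction ::
  "'w measure \<Rightarrow> ('a \<Rightarrow> 'w \<Rightarrow> real) \<Rightarrow> ('a \<times> nat \<Rightarrow> 'w \<Rightarrow> real) \<Rightarrow> 'a set \<Rightarrow>
   'a multiset \<Rightarrow> 'w \<Rightarrow> real" where
  "vtl_reduction M f \<epsilon> A X \<omega> =
     (\<Sum>x\<in>A. covariance M (f x) (f x)) - (\<Sum>x\<in>A. cond_var M (f x) (occs X) (obs f \<epsilon>) \<omega>)"

definition submodular ::
  "'w measure \<Rightarrow> 'a set \<Rightarrow> ('a multiset \<Rightarrow> 'w \<Rightarrow> real) \<Rightarrow> bool" where
  "submodular M S \<psi> \<longleftrightarrow>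
     (\<forall>x\<in>S. \<forall>X' X. X' \<subseteq># X \<longrightarrow> set_mset X \<subseteq> S \<longrightarrow>
        (AE \<omega> in M. \<psi> (add_mset x X') \<omega> - \<psi> X' \<omega> \<ge> \<psi> (add_mset x X) \<omega> - \<psi> X \<omega>))"

section \<open>Posterior variance and irreducible uncertainty\<close>

definition post_var ::
  "'w measure \<Rightarrow> ('a \<Rightarrow> 'w \<Rightarrow> real) \<Rightarrow> ('a \<times> nat \<Rightarrow> 'w \<Rightarrow> real) \<Rightarrow> (nat \<Rightarrow> 'a) \<Rightarrow> nat \<Rightarrow>
   'a \<Rightarrow> 'w \<Rightarrow> real" where
  "post_var M f \<epsilon> p n x = cond_var M (f x) (occs (sampled p n)) (obs f \<epsilon>)"

definition irred_var :: "'w measure \<Rightarrow> ('a \<Rightarrow> 'w \<Rightarrow> real) \<Rightarrow> 'a set \<Rightarrow> 'a \<Rightarrow> 'w \<Rightarrow> real" where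
  "irred_var M f S x = cond_var M (f x) S f"

end

theory Submission
  imports Defs
begin

text \<open>
  For jointly Gaussian variables the residual of the linear projection is independent of the
  conditioning variables, so conditional variances are squared distances to linear spans. The
  information gained by an observation at \<open>z\<close> is half the logarithm of the quotient of its
  conditional variances without and with \<open>f\<^sub>A\<close>, and it dominates, up to a constant, the reduction of
  \<open>Var f\<^sub>a\<close> for every \<open>a \<in> A\<close>.

  Observing every point of \<open>S\<close> \<open>m\<close> times brings the variance within \<open>O(1 / m)\<close> of the irreducible
  one, and by submodularity this batch gains at most \<open>m * card S\<close> times the best single gain. For ITL
  the best single gain after \<open>n\<close> greedy rounds is at most \<open>capacity n / n\<close>, and \<open>m \<approx> sqrt n\<close>
  balances the two errors; at a point of \<open>A \<inter> S\<close> the gain controls the variance itself.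
  For VTL this argument gives only \<open>n\<^sup>-\<^sup>1\<^sup>/\<^sup>2\<close> at points of \<open>A \<inter> S\<close>; instead, optimising \<open>m\<close>
  shows that the excess \<open>e n\<close> of the total variance satisfies \<open>e n - e (n + 1) \<ge> c * (e n)\<^sup>2\<close>,
  hence \<open>e n = O(1 / n)\<close>. The capacity is bounded below by a positive constant unless \<open>f\<^sub>A\<close> and
  \<open>f\<^sub>S\<close> are uncorrelated, in which case nothing has to be shown.
\<close>

section \<open>Characteristic functions and independence\<close>

text \<open>The kernel is only positive semidefinite, so finitely many values of \<open>f\<close>
  may have no joint density and their covariance matrix may be singular. This excludes formulas with
  inverse matrices. Conditional variances are instead infima over linear spans, and mutual
  information is computed from a density relative to the product of the marginals, extended by one
  observation at a time: fresh noise keeps the conditional law of each new observation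
  nondegenerate. As Gaussianity is given through linear combinations only, independence of residuals
  is derived from characteristic functions.

  The constants have to be fixed before the probability space, the process and the selected points.
  Hence they are built from \<open>k\<close>, \<open>\<rho>\<close>, \<open>A\<close> and
  \<open>S\<close> alone, with predictor coefficients that solve normal equations in
  \<open>k\<close>. Error terms of order 1 / sqrt n or 1 / n that carry no factor of information are
  converted into multiples of the capacity by dividing by its positive lower bound, which depends on
  \<open>k\<close> and \<open>\<rho>\<close> only.\<close>

lemma (in finite_measure) integrable_weight_iexp:
  assumes "G \<in> borel_measurable M" "T \<in> borel_measurable M" "\<And>x. \<bar>G x\<bar> \<le> (b::real)"
  shows "integrable M (\<lambda>x. complex_of_real (G x) * iexp (T x))"
  using assms by (intro integrable_const_bound[where B = b]) (auto simp: norm_mult)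

text \<open>By \<open>eq\<close> at frequency 0 the two weights have the same total mass
  \<open>K\<close>. If \<open>K = 0\<close>, both vanish almost everywhere. Otherwise, after
  division by \<open>K\<close>, the weighted laws of \<open>U\<close> are probability measures with
  equal characteristic functions, and Levy's uniqueness theorem applies.\<close>

lemma (in prob_space) weighted_char_unique:
  fixes U G G' :: "'a \<Rightarrow> real"
  assumes [measurable]: "U \<in> borel_measurable M" "G \<in> borel_measurable M" "G' \<in> borel_measurable M"
    and G: "\<And>x. 0 \<le> G x" "\<And>x. G x \<le> b" and G': "\<And>x. 0 \<le> G' x" "\<And>x. G' x \<le> b"
    and eq: "\<And>t. (\<integral>x. complex_of_real (G x) * iexp (t * U x) \<partial>M)
                = (\<integral>x. complex_of_real (G' x) * iexp (t * U x) \<partial>M)"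
    and [measurable]: "C \<in> sets borel"
  shows "(\<integral>x. G x * indicator C (U x) \<partial>M) = (\<integral>x. G' x * indicator C (U x) \<partial>M)"
proof -
  have iG: "integrable M G" "integrable M G'"
    using G G' by (auto intro!: integrable_const_bound[where B = b])
  have ind: "integrable M (\<lambda>x. H x * indicator C (U x))"
    if "H \<in> borel_measurable M" "\<And>x. 0 \<le> H x" "\<And>x. H x \<le> b" for H :: "'a \<Rightarrow> real"
    using that(1,2) order_trans[OF that(2) that(3)]
    by (intro integrable_const_bound[where B = b]) (auto simp: indicator_def that(3))
  define K where "K = (\<integral>x. G x \<partial>M)"
  have K': "(\<integral>x. G' x \<partial>M) = K"
    using eq[of 0] by (simp add: K_def)
  show ?thesis
  proof (cases "K = 0")
    case True
    have "(\<integral>x. H x * indicator C (U x) \<partial>M) = 0"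
      if "integrable M H" "(\<integral>x. H x \<partial>M) = 0" "\<And>x. 0 \<le> H x" for H :: "'a \<Rightarrow> real"
    proof -
      have "AE x in M. H x = 0"
        using that by (subst integral_nonneg_eq_0_iff_AE[symmetric]) auto
      then show ?thesis
        by (intro integral_eq_zero_AE) auto
    qed
    with True K' iG G G' show ?thesis by (simp add: K_def)
  next
    case False
    then have "K > 0"
      using G by (simp add: K_def order_less_le)
    define N where "N H = distr (density M (\<lambda>x. H x / K)) borel U" for H :: "'a \<Rightarrow> real"
    have N: "real_distribution (N H) \<and>
        char (N H) t = (\<integral>x. complex_of_real (H x) * iexp (t * U x) \<partial>M) / K \<and>
        measure (N H) C = (\<integral>x. H x * indicator C (U x) \<partial>M) / K"
      if [measurable]: "H \<in> borel_measurable M" and H: "\<And>x. 0 \<le> H x" "\<And>x. H x \<le> b" "(\<integral>x. H x \<partial>M) = K"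
      for H t
    proof (intro conjI)
      have "integrable M H"
        using H by (auto intro!: integrable_const_bound[where B = b])
      then have iH: "integrable M (\<lambda>x. H x / K)" by simp
      have "prob_space (density M (\<lambda>x. H x / K))"
        using H \<open>K > 0\<close> by (intro prob_spaceI)
          (simp add: emeasure_density nn_integral_eq_integral[OF iH] cong: nn_integral_cong_simp)
      then interpret P: prob_space "density M (\<lambda>x. H x / K)" .
      show "real_distribution (N H)"
        unfolding N_def by (intro P.real_distribution_distr) simp
      show "char (N H) t = (\<integral>x. complex_of_real (H x) * iexp (t * U x) \<partial>M) / K"
        unfolding N_def char_def using H \<open>K > 0\<close>
        by (simp add: integral_distr integral_density scaleR_conv_of_real)
      have "measure (N H) C = (\<integral>x. indicator C (U x) \<partial>density M (\<lambda>x. H x / K))"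
      proof -
        have "(\<integral>x. indicator C (U x) \<partial>density M (\<lambda>x. H x / K))
            = (\<integral>x. indicator (U -` C \<inter> space M) x \<partial>density M (\<lambda>x. H x / K) :: real)"
          by (intro Bochner_Integration.integral_cong) (auto simp: indicator_def)
        then show ?thesis by (simp add: N_def measure_distr)
      qed
      also have "\<dots> = (\<integral>x. H x / K * indicator C (U x) \<partial>M)"
        using H \<open>K > 0\<close> by (subst integral_density) auto
      finally show "measure (N H) C = (\<integral>x. H x * indicator C (U x) \<partial>M) / K"
        by simp
    qed
    have "N G = N G'"
      using N[of G] N[of G'] G G' K' eq by (intro Levy_uniqueness ext) (auto simp: K_def)
    then show ?thesis
      using N[of G] N[of G'] G G' K' \<open>K > 0\<close> by (simp add: K_def)
  qed
qed

text \<open>Expands the nonnegative weights \<open>1 + cos T\<close> and \<open>1 + sin T\<close>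
  into exponentials, so that hypotheses about exponentials apply to them.\<close>

lemma trig_iexp:
  assumes "h = cos \<or> h = (sin :: real \<Rightarrow> real)"
  shows "\<exists>p q. \<forall>y. complex_of_real (h y) = p * iexp y + q * iexp (- y)"
proof -
  have "complex_of_real (cos y) = 1/2 * iexp y + 1/2 * iexp (- y)"
    "complex_of_real (sin y) = - \<i>/2 * iexp y + \<i>/2 * iexp (- y)" for y
    by (simp_all add: complex_eq_iff Re_exp Im_exp)
  with assms show ?thesis by blast
qed

lemma iexp_add: "iexp (a + b) = iexp a * iexp b"
  by (simp add: exp_add[symmetric] algebra_simps)

text \<open>
  The exponentials \<open>iexp (c j * W j x)\<close> are replaced by indicators one coordinate at a time. The
  remaining factor \<open>iexp T\<close> is not a nonnegative weight, so it is recovered from the weights \<open>1\<close>,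
  \<open>1 + cos T\<close> and \<open>1 + sin T\<close>.
\<close>

lemma (in prob_space) weighted_char_unique_vec:
  fixes W :: "'i \<Rightarrow> 'a \<Rightarrow> real"
  assumes "finite J" and "\<And>j. j \<in> J \<Longrightarrow> W j \<in> borel_measurable M"
    and "G \<in> borel_measurable M" "G' \<in> borel_measurable M"
    and "\<And>x. 0 \<le> G x" "\<And>x. G x \<le> b" and "\<And>x. 0 \<le> G' x" "\<And>x. G' x \<le> b"
    and "\<And>c. (\<integral>x. complex_of_real (G x) * iexp (\<Sum>j\<in>J. c j * W j x) \<partial>M)
           = (\<integral>x. complex_of_real (G' x) * iexp (\<Sum>j\<in>J. c j * W j x) \<partial>M)"
    and "\<And>j. j \<in> J \<Longrightarrow> B j \<in> sets borel"
  shows "(\<integral>x. G x * (\<Prod>j\<in>J. indicator (B j) (W j x)) \<partial>M)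
       = (\<integral>x. G' x * (\<Prod>j\<in>J. indicator (B j) (W j x)) \<partial>M)"
  using assms
proof (induction J arbitrary: G G' rule: finite_induct)
  case empty
  show ?case using empty.prems(8)[of "\<lambda>_. 0"] by simp
next
  case (insert j J)
  note [measurable] = insert.prems(2,3)
  have Wj [measurable]: "W j \<in> borel_measurable M" and WJ [measurable]: "\<And>i. i \<in> J \<Longrightarrow> W i \<in> borel_measurable M"
    and Bj [measurable]: "B j \<in> sets borel"
    using insert.prems by auto
  note nn = insert.prems(4-7)
  have b: "b \<ge> 0" using nn(1,2) order_trans by blast
  define I where "I x = (indicator (B j) (W j x) :: real)" for x
  have [measurable]: "I \<in> borel_measurable M" unfolding I_def by measurable
  have I01: "0 \<le> I x" "I x \<le> 1" for x by (auto simp: I_def indicator_def)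
  \<comment> \<open>With the indicator of coordinate \<open>j\<close> absorbed into the weights, the
    hypothesis on characteristic functions holds again for the remaining coordinates, which is what
    the induction hypothesis needs.\<close>
  have key: "(\<integral>x. complex_of_real (G x * I x) * iexp (\<Sum>i\<in>J. c i * W i x) \<partial>M)
           = (\<integral>x. complex_of_real (G' x * I x) * iexp (\<Sum>i\<in>J. c i * W i x) \<partial>M)" for c
  proof -
    define T where "T x = (\<Sum>i\<in>J. c i * W i x)" for x
    have [measurable]: "T \<in> borel_measurable M" unfolding T_def by measurable
    have int: "integrable M (\<lambda>x. complex_of_real (H x) * iexp (u * W j x + a * T x))"
      if "H = G \<or> H = G'" for u a H
      using that nn by (intro integrable_weight_iexp[where b = b]) auto
    have sum_eq: "(\<integral>x. complex_of_real (G x) * iexp (u * W j x + a * T x) \<partial>M)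
       = (\<integral>x. complex_of_real (G' x) * iexp (u * W j x + a * T x) \<partial>M)" for u a
    proof -
      have "(\<Sum>i\<in>insert j J. (if i = j then u else a * c i) * W i x) = u * W j x + a * T x" for x
        using insert.hyps by (auto simp: T_def sum_distrib_left mult.assoc intro!: sum.cong)
      then show ?thesis
        using insert.prems(8)[of "\<lambda>i. if i = j then u else a * c i"] by (simp only:)
    qed
    have trig: "(\<integral>x. G x * (1 + h (T x)) * I x \<partial>M) = (\<integral>x. G' x * (1 + h (T x)) * I x \<partial>M)"
      if h: "h = cos \<or> h = (sin :: real \<Rightarrow> real)" for h
      unfolding I_def
    proof (rule weighted_char_unique[where b = "b * 2"])
      have [measurable]: "h \<in> borel_measurable borel" using h by auto
      have h1: "-1 \<le> h y" "h y \<le> 1" for y using h by auto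
      then have hb: "0 \<le> 1 + h y" "1 + h y \<le> 2" for y
        by (metis add.commute add.left_inverse add_left_mono) (use h1[of y] in linarith)
      show "(\<lambda>x. G x * (1 + h (T x))) \<in> borel_measurable M"
        "(\<lambda>x. G' x * (1 + h (T x))) \<in> borel_measurable M" by measurable
      show "0 \<le> G x * (1 + h (T x))" "0 \<le> G' x * (1 + h (T x))"
        "G x * (1 + h (T x)) \<le> b * 2" "G' x * (1 + h (T x)) \<le> b * 2" for x
        using nn hb b by (auto intro!: mult_mono mult_nonneg_nonneg)
      fix t
      obtain p q :: complex where pq: "\<And>y. complex_of_real (h y) = p * iexp y + q * iexp (- y)"
          using trig_iexp[OF h] by metis
      have split: "complex_of_real (H x * (1 + h (T x))) * iexp (t * W j x) =
          complex_of_real (H x) * iexp (t * W j x + 0 * T x)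
          + p * (complex_of_real (H x) * iexp (t * W j x + 1 * T x))
          + q * (complex_of_real (H x) * iexp (t * W j x + (-1) * T x))" for H x
        unfolding iexp_add using pq[of "T x"] by (simp add: algebra_simps)
      show "(\<integral>x. complex_of_real (G x * (1 + h (T x))) * iexp (t * W j x) \<partial>M)
          = (\<integral>x. complex_of_real (G' x * (1 + h (T x))) * iexp (t * W j x) \<partial>M)"
      proof -
        have "(\<integral>x. complex_of_real (H x * (1 + h (T x))) * iexp (t * W j x) \<partial>M) =
            (\<integral>x. complex_of_real (H x) * iexp (t * W j x + 0 * T x) \<partial>M)
            + p * (\<integral>x. complex_of_real (H x) * iexp (t * W j x + 1 * T x) \<partial>M)
            + q * (\<integral>x. complex_of_real (H x) * iexp (t * W j x + (-1) * T x) \<partial>M)"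
          if "H = G \<or> H = G'" for H
          unfolding split using int[OF that]
          by (simp only: Bochner_Integration.integral_add integrable_mult_right integral_mult_right_zero
              Bochner_Integration.integrable_add)
        then show ?thesis by (simp only: sum_eq refl simp_thms)
      qed
    qed simp_all
    have one: "(\<integral>x. G x * I x \<partial>M) = (\<integral>x. G' x * I x \<partial>M)"
      unfolding I_def using nn sum_eq[of _ 0] by (intro weighted_char_unique[where b = b]) auto
    have intr: "integrable M (\<lambda>x. H x * I x * h (T x))" "integrable M (\<lambda>x. H x * I x)"
      if "H = G \<or> H = G'" "h = cos \<or> h = sin" for H h
    proof -
      have [measurable]: "h \<in> borel_measurable borel" "H \<in> borel_measurable M" using that by auto
      have HI: "\<bar>H x * I x\<bar> \<le> b * 1" for x
        unfolding abs_mult using that(1) nn[of x] I01[of x] b by (intro mult_mono) auto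
      have h1: "\<bar>h y\<bar> \<le> 1" for y using that(2) by auto
      have "\<bar>H x * I x * h (T x)\<bar> \<le> (b * 1) * 1" for x
        unfolding abs_mult[of "H x * I x"] using HI[of x] h1 b by (intro mult_mono) auto
      with HI show "integrable M (\<lambda>x. H x * I x * h (T x))" "integrable M (\<lambda>x. H x * I x)"
        by (auto intro!: integrable_const_bound[where B = b])
    qed
    have trig': "(\<integral>x. G x * I x * h (T x) \<partial>M) = (\<integral>x. G' x * I x * h (T x) \<partial>M)"
      if h: "h = cos \<or> h = sin" for h
      using trig[OF h] one intr h by (simp add: algebra_simps)
    have "(\<integral>x. complex_of_real (H x * I x) * iexp (T x) \<partial>M)
        = complex_of_real (\<integral>x. H x * I x * cos (T x) \<partial>M) + \<i> * complex_of_real (\<integral>x. H x * I x * sin (T x) \<partial>M)"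
      if "H = G \<or> H = G'" for H
    proof -
      have "complex_of_real (H x * I x) * iexp (T x) = complex_of_real (H x * I x * cos (T x))
         + \<i> * complex_of_real (H x * I x * sin (T x))" for x
        by (simp add: cis_conv_exp[symmetric] complex_eq_iff)
      then show ?thesis
        using intr[OF that] by (simp del: of_real_mult)
    qed
    then show ?thesis
      unfolding T_def[symmetric] by (simp add: trig')
  qed
  have "(\<integral>x. G x * I x * (\<Prod>i\<in>J. indicator (B i) (W i x)) \<partial>M)
      = (\<integral>x. G' x * I x * (\<Prod>i\<in>J. indicator (B i) (W i x)) \<partial>M)"
  proof (rule insert.IH)
    show "G x * I x \<le> b" "G' x * I x \<le> b" for x
      using mult_mono[OF nn(2)[of x] I01(2)[of x]] mult_mono[OF nn(4)[of x] I01(2)[of x]] nn b I01[of x]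
      by auto
  qed (use key insert.prems I01 in auto)
  then show ?case
    using insert.hyps by (simp add: I_def mult.assoc)
qed

section \<open>Laws and independence of random vectors\<close>

lemma rvec_measurable [measurable (raw)]:
  "(\<And>i. i \<in> I \<Longrightarrow> Z i \<in> borel_measurable M) \<Longrightarrow> rvec I Z \<in> measurable M (borel_vec I)"
  unfolding rvec_def by (rule measurable_restrict)

text \<open>Boxes generate the product algebra and are stable under intersection, and the measures
  are finite. On a box the claim is an equality of integrals of products of indicators.\<close>

lemma (in prob_space) weighted_distr_eqI:
  fixes W :: "'i \<Rightarrow> 'a \<Rightarrow> real"
  assumes "finite J" and [measurable]: "\<And>j. j \<in> J \<Longrightarrow> W j \<in> borel_measurable M"
    and [measurable]: "G \<in> borel_measurable M" "G' \<in> borel_measurable M"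
    and G: "\<And>x. 0 \<le> G x" "\<And>x. G x \<le> b" and G': "\<And>x. 0 \<le> G' x" "\<And>x. G' x \<le> b"
    and eq: "\<And>c. (\<integral>x. complex_of_real (G x) * iexp (\<Sum>j\<in>J. c j * W j x) \<partial>M)
           = (\<integral>x. complex_of_real (G' x) * iexp (\<Sum>j\<in>J. c j * W j x) \<partial>M)"
  shows "distr (density M G) (borel_vec J) (rvec J W) = distr (density M G') (borel_vec J) (rvec J W)"
proof (rule measure_eqI_PiM_finite[OF \<open>finite J\<close>, where M = "\<lambda>_. borel" and A = "\<lambda>_. Pi\<^sub>E J (\<lambda>_. UNIV)"])
  have W: "rvec J W \<in> measurable M (borel_vec J)" by measurable
  have em: "emeasure (distr (density M H) (borel_vec J) (rvec J W)) (Pi\<^sub>E J A)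
      = ennreal (\<integral>x. H x * (\<Prod>j\<in>J. indicator (A j) (W j x)) \<partial>M)"
    if "H = G \<or> H = G'" and A: "\<And>i. i \<in> J \<Longrightarrow> A i \<in> sets borel" for H and A :: "'i \<Rightarrow> real set"
  proof -
    have [measurable]: "H \<in> borel_measurable M" and H: "\<And>x. 0 \<le> H x" "\<And>x. H x \<le> b" 
      using that G G' by auto
    note [measurable] = A
    have [measurable]: "Pi\<^sub>E J A \<in> sets (borel_vec J)" "rvec J W -` Pi\<^sub>E J A \<inter> space M \<in> sets M"
      using A \<open>finite J\<close> W by (auto intro!: sets_PiM_I_finite measurable_sets)
    have eqp: "indicator (rvec J W -` Pi\<^sub>E J A \<inter> space M) x = (\<Prod>j\<in>J. indicator (A j) (W j x) :: real)"
      if "x \<in> space M" for x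
      using that \<open>finite J\<close>
      by (auto simp: indicator_def rvec_def PiE_iff prod_zero_iff)
    have "emeasure (distr (density M H) (borel_vec J) (rvec J W)) (Pi\<^sub>E J A)
      = (\<integral>\<^sup>+x. ennreal (H x) * indicator (rvec J W -` Pi\<^sub>E J A \<inter> space M) x \<partial>M)"
      by (subst emeasure_distr) (auto simp: emeasure_density)
    also have "\<dots> = (\<integral>\<^sup>+x. ennreal (H x * (\<Prod>j\<in>J. indicator (A j) (W j x))) \<partial>M)"
      using H eqp[symmetric] by (intro nn_integral_cong) (auto simp: ennreal_mult ennreal_indicator)
    also have "\<dots> = ennreal (\<integral>x. H x * (\<Prod>j\<in>J. indicator (A j) (W j x)) \<partial>M)"
    proof (rule nn_integral_eq_integral)
      have "0 \<le> (\<Prod>j\<in>J. indicator (A j) (W j x) :: real)" "(\<Prod>j\<in>J. indicator (A j) (W j x) :: real) \<le> 1" for x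
        by (auto intro!: prod_nonneg prod_le_1 simp: indicator_def)
      then have "\<bar>H x * (\<Prod>j\<in>J. indicator (A j) (W j x))\<bar> \<le> b * 1" for x
        unfolding abs_mult using H order_trans[OF H(1) H(2)] by (intro mult_mono) auto
      then show "integrable M (\<lambda>x. H x * (\<Prod>j\<in>J. indicator (A j) (W j x)))"
        by (auto intro!: integrable_const_bound[where B = b])
    qed (use H in \<open>auto intro!: AE_I2 mult_nonneg_nonneg prod_nonneg\<close>)
    finally show ?thesis .
  qed
  show "emeasure (distr (density M G) (borel_vec J) (rvec J W)) (Pi\<^sub>E J A)
      = emeasure (distr (density M G') (borel_vec J) (rvec J W)) (Pi\<^sub>E J A)"
    if "\<And>i. i \<in> J \<Longrightarrow> A i \<in> sets borel" for A
    using weighted_char_unique_vec[OF \<open>finite J\<close> _ _ _ G G' eq, of A] em that by auto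
  show "emeasure (distr (density M G) (borel_vec J) (rvec J W)) (Pi\<^sub>E J (\<lambda>_. UNIV)) \<noteq> \<infinity>"
    using em[of G "\<lambda>_. UNIV"] by auto
qed (auto simp: space_PiM intro!: prod_algebraI_finite \<open>finite J\<close>)

text \<open>The library's notion for two random variables requires them to have values of the same type.\<close>

definition (in prob_space) indep_elements ::
  "'b measure \<Rightarrow> ('a \<Rightarrow> 'b) \<Rightarrow> 'c measure \<Rightarrow> ('a \<Rightarrow> 'c) \<Rightarrow> bool" where
  "indep_elements S X T Y \<longleftrightarrow> X \<in> measurable M S \<and> Y \<in> measurable M T \<and>
     (\<forall>A\<in>sets S. \<forall>B\<in>sets T.
       prob (X -` A \<inter> Y -` B \<inter> space M) = prob (X -` A \<inter> space M) * prob (Y -` B \<inter> space M))"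

lemma (in prob_space) indep_elements_compose:
  assumes "indep_elements S X T Y" and h: "h \<in> measurable S S'" and g: "g \<in> measurable T T'"
  shows "indep_elements S' (\<lambda>x. h (X x)) T' (\<lambda>x. g (Y x))"
  unfolding indep_elements_def
proof (intro conjI ballI)
  have X: "X \<in> measurable M S" and Y: "Y \<in> measurable M T"
    using assms by (auto simp: indep_elements_def)
  show "(\<lambda>x. h (X x)) \<in> measurable M S'" using X h by (rule measurable_compose)
  show "(\<lambda>x. g (Y x)) \<in> measurable M T'" using Y g by (rule measurable_compose)
  fix A B assume A: "A \<in> sets S'" and B: "B \<in> sets T'"
  define A' B' where "A' = h -` A \<inter> space S" and "B' = g -` B \<inter> space T"
  have "prob (X -` A' \<inter> Y -` B' \<inter> space M) = prob (X -` A' \<inter> space M) * prob (Y -` B' \<inter> space M)"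
    using assms(1) measurable_sets[OF h A] measurable_sets[OF g B]
    unfolding indep_elements_def A'_def B'_def by blast
  moreover have "(\<lambda>x. h (X x)) -` A \<inter> (\<lambda>x. g (Y x)) -` B \<inter> space M = X -` A' \<inter> Y -` B' \<inter> space M"
    "(\<lambda>x. h (X x)) -` A \<inter> space M = X -` A' \<inter> space M"
    "(\<lambda>x. g (Y x)) -` B \<inter> space M = Y -` B' \<inter> space M"
    using measurable_space[OF X] measurable_space[OF Y] by (auto simp: A'_def B'_def)
  ultimately show "prob ((\<lambda>x. h (X x)) -` A \<inter> (\<lambda>x. g (Y x)) -` B \<inter> space M)
      = prob ((\<lambda>x. h (X x)) -` A \<inter> space M) * prob ((\<lambda>x. g (Y x)) -` B \<inter> space M)"
    by simp
qed

lemma (in prob_space) indep_elements_imp_indep_var: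
  assumes "indep_elements S X T Y"
  shows "indep_var S X T Y"
proof -
  have X: "X \<in> measurable M S" and Y: "Y \<in> measurable M T"
    using assms by (auto simp: indep_elements_def)
  have set: "indep_set {X -` A \<inter> space M |A. A \<in> sets S} {Y -` B \<inter> space M |B. B \<in> sets T}"
  proof (rule indep_setI)
    fix a b assume "a \<in> {X -` A \<inter> space M |A. A \<in> sets S}" "b \<in> {Y -` B \<inter> space M |B. B \<in> sets T}"
    then obtain A B where AB: "A \<in> sets S" "B \<in> sets T" and ab: "a = X -` A \<inter> space M" "b = Y -` B \<inter> space M"
      by auto
    have "a \<inter> b = X -` A \<inter> Y -` B \<inter> space M" using ab by auto
    then show "prob (a \<inter> b) = prob a * prob b"
      using assms AB ab unfolding indep_elements_def by simp
  qed (use X Y in \<open>auto dest: measurable_sets\<close>)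
  have "indep_sets (\<lambda>i. {case_bool X Y i -` A \<inter> space M |A. A \<in> sets (case_bool S T i)}) UNIV"
    using set unfolding indep_set_def
    by (rule indep_sets_cong[THEN iffD1, rotated -1]) (auto split: bool.split)
  then show ?thesis
    using X Y unfolding indep_var_def indep_vars_def2 by (auto split: bool.split)
qed

lemma (in prob_space) indep_elements_distr:
  assumes "indep_elements S X T Y"
  shows "distr M (S \<Otimes>\<^sub>M T) (\<lambda>x. (X x, Y x)) = distr M S X \<Otimes>\<^sub>M distr M T Y"
proof -
  have X: "X \<in> measurable M S" and Y: "Y \<in> measurable M T"
    using assms by (auto simp: indep_elements_def)
  interpret X: prob_space "distr M S X" by (rule prob_space_distr[OF X])
  interpret Y: prob_space "distr M T Y" by (rule prob_space_distr[OF Y])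
  have XY: "(\<lambda>x. (X x, Y x)) \<in> measurable M (S \<Otimes>\<^sub>M T)" using X Y by (rule measurable_Pair)
  show ?thesis
  proof (rule pair_measure_eqI[symmetric])
    show "sigma_finite_measure (distr M S X)" "sigma_finite_measure (distr M T Y)"
      by unfold_locales
    fix A B assume "A \<in> sets (distr M S X)" "B \<in> sets (distr M T Y)"
    then have AB: "A \<in> sets S" "B \<in> sets T" by auto
    have "emeasure (distr M (S \<Otimes>\<^sub>M T) (\<lambda>x. (X x, Y x))) (A \<times> B) = emeasure M (X -` A \<inter> Y -` B \<inter> space M)"
      using XY AB by (subst emeasure_distr) (auto intro!: arg_cong[where f = "emeasure M"])
    then show "emeasure (distr M S X) A * emeasure (distr M T Y) B
        = emeasure (distr M (S \<Otimes>\<^sub>M T) (\<lambda>x. (X x, Y x))) (A \<times> B)"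
      using assms AB X Y unfolding indep_elements_def
      by (simp add: emeasure_distr emeasure_eq_measure ennreal_mult[symmetric])
  qed simp
qed

text \<open>Independence says that weighting the law of \<open>W\<close> by the indicator of the
  event that \<open>Z\<close> lies in \<open>A\<close> has the same effect as weighting it by the
  probability of that event. The two weighted laws are compared through their characteristic
  functions.\<close>

lemma (in prob_space) indep_elements_rvecI:
  fixes W :: "'i \<Rightarrow> 'a \<Rightarrow> real"
  assumes "finite J" and [measurable]: "\<And>j. j \<in> J \<Longrightarrow> W j \<in> borel_measurable M"
    and [measurable]: "Z \<in> borel_measurable M"
    and eq: "\<And>u c. (\<integral>x. iexp (u * Z x + (\<Sum>j\<in>J. c j * W j x)) \<partial>M)
           = (\<integral>x. iexp (u * Z x) \<partial>M) * (\<integral>x. iexp (\<Sum>j\<in>J. c j * W j x) \<partial>M)"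
  shows "indep_elements borel Z (borel_vec J) (rvec J W)"
  unfolding indep_elements_def
proof (intro conjI ballI)
  have W: "rvec J W \<in> measurable M (borel_vec J)" by measurable
  then show "rvec J W \<in> measurable M (borel_vec J)" .
  fix A C assume [measurable]: "A \<in> sets (borel::real measure)" and C [measurable]: "C \<in> sets (borel_vec J)"
  define I where "I x = (indicator A (Z x) :: real)" for x
  have [measurable]: "I \<in> borel_measurable M" unfolding I_def by measurable
  have I01: "0 \<le> I x" "I x \<le> 1" for x by (auto simp: I_def indicator_def)
  have key: "(\<integral>x. complex_of_real (I x) * iexp (\<Sum>j\<in>J. c j * W j x) \<partial>M)
      = (\<integral>x. complex_of_real (expectation I) * iexp (\<Sum>j\<in>J. c j * W j x) \<partial>M)" for c
  proof -
    define T where "T x = (\<Sum>i\<in>J. c i * W i x)" for x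
    have [measurable]: "T \<in> borel_measurable M" unfolding T_def by measurable
    have eqT: "(\<integral>x. iexp (u * Z x + a * T x) \<partial>M) = (\<integral>x. iexp (u * Z x) \<partial>M) * (\<integral>x. iexp (a * T x) \<partial>M)" for u a
      using eq[of u "\<lambda>j. a * c j"] by (simp add: T_def sum_distrib_left mult.assoc)
    have int: "integrable M (\<lambda>x. iexp (u * Z x + a * T x))" "integrable M (\<lambda>x. iexp (a * T x))" for u a
      using integrable_weight_iexp[of "\<lambda>_. 1" "\<lambda>x. u * Z x + a * T x" 1]
        integrable_weight_iexp[of "\<lambda>_. 1" "\<lambda>x. a * T x" 1] by auto
    have intr: "integrable M (\<lambda>x. h (T x))" "integrable M (\<lambda>x. I x * h (T x))" "integrable M I"
      if "h = cos \<or> h = (sin::real \<Rightarrow> real)" for h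
    proof -
      have [measurable]: "h \<in> borel_measurable borel" using that by auto
      have "\<bar>h y\<bar> \<le> 1" for y using that by auto
      moreover have "\<bar>I x * h (T x)\<bar> \<le> 1 * 1" for x
        unfolding abs_mult using that I01[of x] by (intro mult_mono) auto
      ultimately show "integrable M (\<lambda>x. h (T x))" "integrable M (\<lambda>x. I x * h (T x))" "integrable M I"
        using I01 by (auto intro!: integrable_const_bound[where B = 1])
    qed
    have trig: "(\<integral>x. I x * h (T x) \<partial>M) = expectation I * (\<integral>x. h (T x) \<partial>M)"
      if h: "h = cos \<or> h = (sin :: real \<Rightarrow> real)" for h
    proof -
      have [measurable]: "h \<in> borel_measurable borel" using h by auto
      have h1: "-1 \<le> h y" "h y \<le> 1" for y using h by auto
      then have hb: "0 \<le> 1 + h y" "1 + h y \<le> 2" for y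
        by (metis add.commute add.left_inverse add_left_mono) (use h1[of y] in linarith)
      \<comment> \<open>Here the roles are exchanged: \<open>1 + h (T x)\<close> is a weight on the
        law of \<open>Z\<close>, and the factorisation \<open>eq\<close> shows that it acts like the
        constant weight \<open>e\<close>.\<close>
      define e where "e = expectation (\<lambda>x. 1 + h (T x))"
      have "0 \<le> e"
        unfolding e_def using hb by (intro Bochner_Integration.integral_nonneg)
      moreover have "e \<le> 2"
        unfolding e_def using hb intr[OF h] by (intro integral_le_const) auto
      ultimately have e: "0 \<le> e" "e \<le> 2" by auto
      have "(\<integral>x. (1 + h (T x)) * indicator A (Z x) \<partial>M) = (\<integral>x. e * indicator A (Z x) \<partial>M)"
      proof (rule weighted_char_unique[where b = 2])
        fix t
        obtain p q :: complex where pq: "\<And>y. complex_of_real (h y) = p * iexp y + q * iexp (- y)"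
          using trig_iexp[OF h] by metis
        have split: "complex_of_real (1 + h (T x)) * iexp (t * Z x) = iexp (t * Z x + 0 * T x)
            + p * iexp (t * Z x + 1 * T x) + q * iexp (t * Z x + (-1) * T x)" for t x
          unfolding iexp_add using pq[of "T x"] by (simp add: algebra_simps)
        have "complex_of_real e = (\<integral>x. complex_of_real (1 + h (T x)) * iexp (0 * Z x) \<partial>M)"
          unfolding e_def by (simp del: of_real_add)
        also have "\<dots> = 1 + p * (\<integral>x. iexp (1 * T x) \<partial>M) + q * (\<integral>x. iexp ((-1) * T x) \<partial>M)"
          unfolding split using int[of 0]
          by (simp only: Bochner_Integration.integral_add integrable_mult_right integral_mult_right_zero
            Bochner_Integration.integrable_add eqT) (simp add: prob_space)
        finally have e_eq: "complex_of_real e = \<dots>" .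
        have "(\<integral>x. complex_of_real (1 + h (T x)) * iexp (t * Z x) \<partial>M) = complex_of_real e * (\<integral>x. iexp (t * Z x) \<partial>M)"
          unfolding split e_eq using int by (simp only: Bochner_Integration.integral_add integrable_mult_right integral_mult_right_zero
            eqT Bochner_Integration.integrable_add) (simp add: algebra_simps prob_space)
        then show "(\<integral>x. complex_of_real (1 + h (T x)) * iexp (t * Z x) \<partial>M)
            = (\<integral>x. complex_of_real e * iexp (t * Z x) \<partial>M)" by simp
      qed (use hb e in auto)
      then have "(\<integral>x. I x + I x * h (T x) \<partial>M) = e * expectation I"
        by (simp add: I_def[abs_def] algebra_simps)
      then show ?thesis
        using intr[OF h] by (simp add: e_def prob_space algebra_simps)
    qed
    have cis: "iexp (T x) = complex_of_real (cos (T x)) + \<i> * complex_of_real (sin (T x))" for x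
      by (simp add: cis_conv_exp[symmetric] complex_eq_iff)
    have "(\<integral>x. complex_of_real (I x) * iexp (T x) \<partial>M) =
       (\<integral>x. complex_of_real (I x * cos (T x)) + \<i> * complex_of_real (I x * sin (T x)) \<partial>M)"
      by (simp add: cis algebra_simps)
    also have "\<dots> = complex_of_real (expectation I) * (\<integral>x. iexp (T x) \<partial>M)"
      unfolding cis using intr trig by (simp add: algebra_simps del: of_real_mult) (simp add: algebra_simps)
    finally show ?thesis unfolding T_def[symmetric] by simp
  qed
  have EI: "0 \<le> expectation I" "expectation I \<le> 1"
    using I01 by (auto intro!: integral_le_const integrable_const_bound[where B = 1])
  have eqd: "distr (density M I) (borel_vec J) (rvec J W) = distr (density M (\<lambda>_. expectation I)) (borel_vec J) (rvec J W)"
    using I01 EI key by (intro weighted_distr_eqI[OF \<open>finite J\<close>, where b = 1]) auto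
  define E where "E = rvec J W -` C \<inter> space M"
  have [measurable]: "E \<in> sets M" unfolding E_def using W C by (rule measurable_sets)
  have "emeasure (density M I) E = emeasure (density M (\<lambda>_. expectation I)) E"
    using arg_cong[OF eqd, of "\<lambda>N. emeasure N C"] by (simp add: emeasure_distr E_def)
  moreover have "emeasure (density M I) E = emeasure M (Z -` A \<inter> space M \<inter> E)"
  proof -
    have "emeasure (density M I) E = (\<integral>\<^sup>+x. ennreal (I x) * indicator E x \<partial>M)"
      by (rule emeasure_density) measurable
    also have "\<dots> = (\<integral>\<^sup>+x. indicator (Z -` A \<inter> space M \<inter> E) x \<partial>M)"
      by (intro nn_integral_cong) (auto simp: I_def indicator_def)
    finally show ?thesis by simp
  qed
  moreover have "expectation I = prob (Z -` A \<inter> space M)"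
  proof -
    have "expectation I = (\<integral>x. indicator (Z -` A \<inter> space M) x \<partial>M)"
      by (intro Bochner_Integration.integral_cong) (auto simp: I_def indicator_def)
    then show ?thesis by simp
  qed
  ultimately have "prob (Z -` A \<inter> space M \<inter> E) = prob (Z -` A \<inter> space M) * prob E"
    by (simp add: emeasure_density nn_integral_cmult emeasure_eq_measure flip: ennreal_mult)
  moreover have "Z -` A \<inter> space M \<inter> E = Z -` A \<inter> rvec J W -` C \<inter> space M"
    by (auto simp: E_def)
  ultimately show "prob (Z -` A \<inter> rvec J W -` C \<inter> space M) = prob (Z -` A \<inter> space M) * prob (rvec J W -` C \<inter> space M)"
    by (simp add: E_def)
qed simp

lemma (in prob_space) char_imp_normal:
  assumes [measurable]: "Z \<in> borel_measurable M" and "s > 0"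
    and eq: "\<And>t. (\<integral>x. iexp (t * Z x) \<partial>M) = iexp (t * m) * exp (- of_real (t\<^sup>2 * s\<^sup>2 / 2))"
  shows "distributed M lborel Z (normal_density m s)"
proof -
  define U where "U x = (Z x - m) / s" for x
  have [measurable]: "U \<in> borel_measurable M" unfolding U_def by measurable
  have "distr M borel U = std_normal_distribution"
  proof (rule Levy_uniqueness)
    show "real_distribution (distr M borel U)" by (rule real_distribution_distr) simp
    show "real_distribution std_normal_distribution" by (rule real_dist_normal_dist)
    show "char (distr M borel U) = char std_normal_distribution"
    proof
      fix t
      have "iexp (t * U x) = iexp (- (t / s) * m) * iexp ((t / s) * Z x)" for x
        by (simp add: U_def exp_add[symmetric] diff_divide_distrib right_diff_distrib mult.commute mult.left_commute)
      then have "char (distr M borel U) t = iexp (- (t / s) * m) * (\<integral>x. iexp ((t / s) * Z x) \<partial>M)"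
        by (simp add: char_def integral_distr)
      also have "\<dots> = exp (- of_real (t\<^sup>2 / 2))"
        unfolding eq using \<open>s > 0\<close> by (simp add: exp_add[symmetric] power_divide)
      finally show "char (distr M borel U) t = char std_normal_distribution t"
        by (simp add: char_std_normal_distribution of_real_exp)
    qed
  qed
  then have "distributed M lborel U std_normal_density"
    unfolding distributed_def by (auto cong: distr_cong)
  then show ?thesis
    unfolding U_def by (subst normal_standard_normal_convert[OF \<open>s > 0\<close>])
qed

section \<open>Mutual information with a density\<close>

context prob_space
begin

text \<open>The number alone could not be updated when an observation is added, so the predicate
  carries a density relative to the product of the marginals. Strict positivity makes
  \<open>ln r\<close> meaningful everywhere, and integrability of the logarithm ensures that
  \<open>i\<close> is not the default value of an undefined integral.\<close>

definition has_information ::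
  "'b measure \<Rightarrow> ('a \<Rightarrow> 'b) \<Rightarrow> 'c measure \<Rightarrow> ('a \<Rightarrow> 'c) \<Rightarrow> real \<Rightarrow> bool" where
  "has_information MF F MT T i \<longleftrightarrow> F \<in> measurable M MF \<and> T \<in> measurable M MT \<and>
     (\<exists>r. r \<in> borel_measurable (MF \<Otimes>\<^sub>M MT) \<and> (\<forall>z. 0 < r z) \<and>
        distr M (MF \<Otimes>\<^sub>M MT) (\<lambda>x. (F x, T x)) = density (distr M MF F \<Otimes>\<^sub>M distr M MT T) r \<and>
        has_bochner_integral M (\<lambda>x. ln (r (F x, T x))) i)"

lemma has_information_imp_mutual_information:
  assumes "has_information MF F MT T i"
  shows "mutual_information (exp 1) MF MT F T = i"
proof -
  from assms obtain r where [measurable]: "F \<in> measurable M MF" "T \<in> measurable M MT"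
      "r \<in> borel_measurable (MF \<Otimes>\<^sub>M MT)"
    and r: "\<And>z. 0 < r z"
    and d: "distr M (MF \<Otimes>\<^sub>M MT) (\<lambda>x. (F x, T x)) = density (distr M MF F \<Otimes>\<^sub>M distr M MT T) r"
    and i: "has_bochner_integral M (\<lambda>x. ln (r (F x, T x))) i"
    unfolding has_information_def by blast
  let ?P = "distr M MF F \<Otimes>\<^sub>M distr M MT T"
  interpret F: prob_space "distr M MF F" by (rule prob_space_distr) simp
  interpret T: prob_space "distr M MT T" by (rule prob_space_distr) simp
  interpret FT: pair_prob_space "distr M MF F" "distr M MT T" ..
  have "AE z in ?P. ennreal (r z) = RN_deriv ?P (density ?P r) z"
    by (rule FT.P.RN_deriv_unique) simp_all
  then have "AE z in density ?P r. entropy_density (exp 1) ?P (density ?P r) z = ln (r z)"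
    using r by (subst AE_density) (auto simp: entropy_density_def log_def enn2real_ennreal less_imp_le
        elim!: eventually_mono dest!: sym[of "ennreal _"])
  then have "mutual_information (exp 1) MF MT F T = (\<integral>z. ln (r z) \<partial>density ?P r)"
    unfolding mutual_information_def d KL_divergence_def
    by (intro integral_cong_AE) simp_all
  also have "\<dots> = (\<integral>x. ln (r (F x, T x)) \<partial>M)"
    unfolding d[symmetric] by (subst integral_distr) auto
  also have "\<dots> = i" using i by (rule has_bochner_integral_integral_eq)
  finally show ?thesis .
qed

lemma has_information_trivial:
  assumes [measurable]: "F \<in> measurable M MF" "t \<in> space MT"
  shows "has_information MF F MT (\<lambda>_. t) 0"
proof -
  interpret F: prob_space "distr M MF F" by (rule prob_space_distr) simp
  interpret T: prob_space "distr M MT (\<lambda>_. t)" by (rule prob_space_distr) simp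
  have "distr M (MF \<Otimes>\<^sub>M MT) (\<lambda>x. (F x, t)) = distr M MF F \<Otimes>\<^sub>M distr M MT (\<lambda>_. t)"
    by (intro indep_elements_distr) (auto simp: indep_elements_def prob_space vimage_def Int_def)
  then show ?thesis
    unfolding has_information_def
    by (intro conjI exI[of _ "\<lambda>_. 1"])
      (auto simp: density_1 one_ennreal_def[symmetric] has_bochner_integral_zero)
qed

text \<open>Recoding by an injective map loses no information. A measurable left inverse
  \<open>h\<close> is enough, because the density is needed only on the image of \<open>g\<close>.
  This later turns a pair into a longer vector.\<close>

lemma has_information_iso:
  assumes "has_information MF F MT T i"
    and [measurable]: "g \<in> measurable MT MT'" "h \<in> measurable MT' MT"
    and hg: "\<And>t. t \<in> space MT \<Longrightarrow> h (g t) = t"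
  shows "has_information MF F MT' (\<lambda>x. g (T x)) i"
proof -
  from assms(1) obtain r where [measurable]: "F \<in> measurable M MF" "T \<in> measurable M MT"
      "r \<in> borel_measurable (MF \<Otimes>\<^sub>M MT)"
    and r: "\<And>z. 0 < r z"
    and d: "distr M (MF \<Otimes>\<^sub>M MT) (\<lambda>x. (F x, T x)) = density (distr M MF F \<Otimes>\<^sub>M distr M MT T) r"
    and i: "has_bochner_integral M (\<lambda>x. ln (r (F x, T x))) i"
    unfolding has_information_def by blast
  let ?P = "distr M MF F \<Otimes>\<^sub>M distr M MT T"
  let ?g = "\<lambda>(f, t). (f, g t)"
  define r' where "r' = (\<lambda>(f, t). r (f, h t))"
  have [measurable]: "r' \<in> borel_measurable (MF \<Otimes>\<^sub>M MT')" unfolding r'_def by measurable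
  interpret gT: prob_space "distr M MT' (\<lambda>x. g (T x))" by (rule prob_space_distr) simp
  have P: "distr M MF F \<Otimes>\<^sub>M distr M MT' (\<lambda>x. g (T x)) = distr ?P (MF \<Otimes>\<^sub>M MT') ?g"
  proof -
    have eq: "distr M MF F = distr (distr M MF F) MF (\<lambda>x. x)"
      "distr M MT' (\<lambda>x. g (T x)) = distr (distr M MT T) MT' g"
      by (simp_all add: distr_distr comp_def)
    have "sigma_finite_measure (distr (distr M MT T) MT' g)"
      unfolding eq(2)[symmetric] by unfold_locales
    then show ?thesis
      by (subst eq(1), subst eq(2), subst pair_measure_distr)
        (auto intro!: distr_cong sets_pair_measure_cong)
  qed
  have "density (distr ?P (MF \<Otimes>\<^sub>M MT') ?g) r' = distr (density ?P (\<lambda>z. r' (?g z))) (MF \<Otimes>\<^sub>M MT') ?g"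
    by (subst density_distr) (auto simp: comp_def)
  also have "density ?P (\<lambda>z. r' (?g z)) = density ?P r"
    by (intro density_cong AE_I2) (auto simp: r'_def space_pair_measure hg)
  also have "distr (density ?P r) (MF \<Otimes>\<^sub>M MT') ?g = distr M (MF \<Otimes>\<^sub>M MT') (\<lambda>x. (F x, g (T x)))"
    unfolding d[symmetric] by (simp add: distr_distr comp_def)
  finally have "distr M (MF \<Otimes>\<^sub>M MT') (\<lambda>x. (F x, g (T x)))
      = density (distr M MF F \<Otimes>\<^sub>M distr M MT' (\<lambda>x. g (T x))) r'"
    unfolding P by simp
  moreover have "has_bochner_integral M (\<lambda>x. ln (r' (F x, g (T x)))) i"
    using i hg[OF measurable_space[OF \<open>T \<in> measurable M MT\<close>]]
    by (subst has_bochner_integral_cong[OF refl _ refl]) (auto simp: r'_def)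
  ultimately show ?thesis
    unfolding has_information_def using r by (intro conjI exI[of _ r']) (auto simp: r'_def)
qed

text \<open>Independence and Fubini: given \<open>T\<close>, the variable \<open>L T + Z\<close> is
  normal with mean \<open>L T\<close>. Stated as an integral identity, this avoids choosing versions
  of conditional laws.\<close>

lemma nn_integral_normal_shift:
  fixes \<phi> :: "real \<times> 'b \<Rightarrow> ennreal"
  assumes Z: "distributed M lborel Z (normal_density 0 s)" and "indep_elements borel Z MT T"
    and [measurable]: "L \<in> borel_measurable MT" "\<phi> \<in> borel_measurable (borel \<Otimes>\<^sub>M MT)"
  shows "(\<integral>\<^sup>+x. \<phi> (L (T x) + Z x, T x) \<partial>M) =
    (\<integral>\<^sup>+x. (\<integral>\<^sup>+v. ennreal (normal_density (L (T x)) s v) * \<phi> (v, T x) \<partial>lborel) \<partial>M)"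
proof -
  have [measurable]: "Z \<in> borel_measurable M" "T \<in> measurable M MT"
    using assms(2) by (auto simp: indep_elements_def)
  have dZ: "distr M borel Z = density lborel (normal_density 0 s)"
    using Z unfolding distributed_def by (metis distr_cong sets_lborel)
  interpret Z: prob_space "distr M borel Z" by (rule prob_space_distr) simp
  interpret T: prob_space "distr M MT T" by (rule prob_space_distr) simp
  interpret ZT: pair_sigma_finite "distr M borel Z" "distr M MT T" ..
  have "(\<integral>\<^sup>+x. \<phi> (L (T x) + Z x, T x) \<partial>M) =
      (\<integral>\<^sup>+(z, t). \<phi> (L t + z, t) \<partial>distr M (borel \<Otimes>\<^sub>M MT) (\<lambda>x. (Z x, T x)))"
    by (subst nn_integral_distr) auto
  also have "\<dots> = (\<integral>\<^sup>+(z, t). \<phi> (L t + z, t) \<partial>(distr M borel Z \<Otimes>\<^sub>M distr M MT T))"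
    by (subst indep_elements_distr[OF assms(2)]) simp
  also have "\<dots> = (\<integral>\<^sup>+t. (\<integral>\<^sup>+z. \<phi> (L t + z, t) \<partial>distr M borel Z) \<partial>distr M MT T)"
    by (subst ZT.nn_integral_snd[symmetric]) auto
  also have "\<dots> = (\<integral>\<^sup>+x. (\<integral>\<^sup>+z. \<phi> (L (T x) + z, T x) \<partial>distr M borel Z) \<partial>M)"
    by (subst nn_integral_distr) auto
  also have "\<dots> = (\<integral>\<^sup>+x. (\<integral>\<^sup>+v. ennreal (normal_density (L (T x)) s v) * \<phi> (v, T x) \<partial>lborel) \<partial>M)"
  proof (rule nn_integral_cong)
    fix x assume "x \<in> space M"
    then have Tx [measurable]: "T x \<in> space MT" by (rule measurable_space[rotated]) simp
    have "(\<integral>\<^sup>+v. ennreal (normal_density (L (T x)) s v) * \<phi> (v, T x) \<partial>lborel)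
        = (\<integral>\<^sup>+z. normal_density (L (T x)) s (L (T x) + 1 * z) * \<phi> (L (T x) + 1 * z, T x) \<partial>lborel)"
      by (subst nn_integral_real_affine[where c = 1 and t = "L (T x)"]) auto
    also have "\<dots> = (\<integral>\<^sup>+z. \<phi> (L (T x) + z, T x) \<partial>distr M borel Z)"
      unfolding dZ by (subst nn_integral_density) (auto simp: normal_density_def)
    finally show "(\<integral>\<^sup>+z. \<phi> (L (T x) + z, T x) \<partial>distr M borel Z) =
       (\<integral>\<^sup>+v. ennreal (normal_density (L (T x)) s v) * \<phi> (v, T x) \<partial>lborel)" by simp
  qed
  finally show ?thesis .
qed

text \<open>
  Chain rule for one additional real observation \<open>V\<close>: the density of the new pair is the old one
  times the quotient of the Gaussian conditional densities of \<open>V\<close> given \<open>(F, T)\<close> and given \<open>T\<close>.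
\<close>

lemma has_information_chain:
  assumes "has_information MF F MT T i"
    and Z: "distributed M lborel Z (normal_density 0 s)" "indep_elements borel Z MT T"
      "has_bochner_integral M (\<lambda>x. (Z x)\<^sup>2) (s\<^sup>2)" "s > 0"
    and Z': "distributed M lborel Z' (normal_density 0 s')"
      "indep_elements borel Z' (MF \<Otimes>\<^sub>M MT) (\<lambda>x. (F x, T x))"
      "has_bochner_integral M (\<lambda>x. (Z' x)\<^sup>2) (s'\<^sup>2)" "s' > 0"
    and L [measurable]: "L \<in> borel_measurable MT" "L' \<in> borel_measurable (MF \<Otimes>\<^sub>M MT)"
    and V: "\<And>x. x \<in> space M \<Longrightarrow> V x = L (T x) + Z x" "\<And>x. x \<in> space M \<Longrightarrow> V x = L' (F x, T x) + Z' x"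
  shows "has_information MF F (borel \<Otimes>\<^sub>M MT) (\<lambda>x. (V x, T x)) (i + ln (s / s'))"
proof -
  from assms(1) obtain r where [measurable]: "F \<in> measurable M MF" "T \<in> measurable M MT"
      "r \<in> borel_measurable (MF \<Otimes>\<^sub>M MT)"
    and r: "\<And>z. 0 < r z"
    and d: "distr M (MF \<Otimes>\<^sub>M MT) (\<lambda>x. (F x, T x)) = density (distr M MF F \<Otimes>\<^sub>M distr M MT T) r"
    and i: "has_bochner_integral M (\<lambda>x. ln (r (F x, T x))) i"
    unfolding has_information_def by blast
  have [measurable]: "Z \<in> borel_measurable M" "Z' \<in> borel_measurable M"
    using Z(2) Z'(2) by (auto simp: indep_elements_def)
  have [measurable]: "V \<in> borel_measurable M"
    by (subst measurable_cong[OF V(1)]) auto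
  define q where "q f v t = normal_density (L' (f, t)) s' v / normal_density (L t) s v" for f v t
  define r' where "r' = (\<lambda>(f, v, t). r (f, t) * q f v t)"
  have q: "q f v t > 0" for f v t
    using Z(4) Z'(4) by (simp add: q_def normal_density_pos)
  have r'm [measurable]: "r' \<in> borel_measurable (MF \<Otimes>\<^sub>M (borel \<Otimes>\<^sub>M MT))"
    unfolding r'_def q_def normal_density_def by measurable
  interpret F: prob_space "distr M MF F" by (rule prob_space_distr) simp
  interpret T: prob_space "distr M MT T" by (rule prob_space_distr) simp
  interpret VT: prob_space "distr M (borel \<Otimes>\<^sub>M MT) (\<lambda>x. (V x, T x))" by (rule prob_space_distr) simp
  have "distr M (MF \<Otimes>\<^sub>M (borel \<Otimes>\<^sub>M MT)) (\<lambda>x. (F x, V x, T x))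
      = density (distr M MF F \<Otimes>\<^sub>M distr M (borel \<Otimes>\<^sub>M MT) (\<lambda>x. (V x, T x))) r'" (is "?l = ?r")
  proof (rule measure_eqI)
    fix C assume "C \<in> sets ?l"
    then have [measurable]: "C \<in> sets (MF \<Otimes>\<^sub>M (borel \<Otimes>\<^sub>M MT))" by simp
    define \<Psi> where "\<Psi> = (\<lambda>(f, t). \<integral>\<^sup>+v. ennreal (normal_density (L' (f, t)) s' v) * indicator C (f, v, t) \<partial>lborel)"
    have [measurable]: "\<Psi> \<in> borel_measurable (MF \<Otimes>\<^sub>M MT)"
      unfolding \<Psi>_def normal_density_def by measurable
    have "emeasure ?l C = (\<integral>\<^sup>+x. indicator C (F x, V x, T x) \<partial>M)"
      by (simp flip: nn_integral_indicator add: nn_integral_distr)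
    also have "\<dots> = (\<integral>\<^sup>+x. (\<lambda>(v, f, t). indicator C (f, v, t)) (L' (F x, T x) + Z' x, F x, T x) \<partial>M)"
      using V(2) by (intro nn_integral_cong) simp
    also have "\<dots> = (\<integral>\<^sup>+x. (\<integral>\<^sup>+v. ennreal (normal_density (L' (F x, T x)) s' v) *
        (\<lambda>(v, f, t). indicator C (f, v, t)) (v, F x, T x) \<partial>lborel) \<partial>M)"
      by (rule nn_integral_normal_shift[OF Z'(1,2), where \<phi> = "\<lambda>(v, f, t). indicator C (f, v, t)"]) auto
    also have "\<dots> = (\<integral>\<^sup>+x. \<Psi> (F x, T x) \<partial>M)"
      by (simp add: \<Psi>_def)
    also have "\<dots> = (\<integral>\<^sup>+z. \<Psi> z \<partial>distr M (MF \<Otimes>\<^sub>M MT) (\<lambda>x. (F x, T x)))"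
      by (subst nn_integral_distr) auto
    also have "\<dots> = (\<integral>\<^sup>+z. r z * \<Psi> z \<partial>(distr M MF F \<Otimes>\<^sub>M distr M MT T))"
      unfolding d by (subst nn_integral_density) auto
    also have "\<dots> = (\<integral>\<^sup>+f. (\<integral>\<^sup>+x. ennreal (r (f, T x)) * \<Psi> (f, T x) \<partial>M) \<partial>distr M MF F)"
      by (subst T.nn_integral_fst[symmetric]) (auto simp: nn_integral_distr intro!: nn_integral_cong)
    also have "\<dots> = (\<integral>\<^sup>+f. (\<integral>\<^sup>+x. ennreal (r' (f, V x, T x)) * indicator C (f, V x, T x) \<partial>M) \<partial>distr M MF F)"
    proof (rule nn_integral_cong)
      \<comment> \<open>With \<open>f\<close> fixed, \<open>V\<close> is disintegrated a second
        time, now through its residual given \<open>T\<close> alone. The normal density that appears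
        cancels the denominator of \<open>q\<close>.\<close>
      fix f assume "f \<in> space (distr M MF F)"
      then have [measurable]: "f \<in> space MF" by simp
      have "(\<integral>\<^sup>+x. ennreal (r' (f, V x, T x)) * indicator C (f, V x, T x) \<partial>M) =
          (\<integral>\<^sup>+x. (\<lambda>(v, t). ennreal (r' (f, v, t)) * indicator C (f, v, t)) (L (T x) + Z x, T x) \<partial>M)"
        using V(1) by (intro nn_integral_cong) simp
      also have "\<dots> = (\<integral>\<^sup>+x. (\<integral>\<^sup>+v. ennreal (normal_density (L (T x)) s v) *
          (\<lambda>(v, t). ennreal (r' (f, v, t)) * indicator C (f, v, t)) (v, T x) \<partial>lborel) \<partial>M)"
        by (rule nn_integral_normal_shift[OF Z(1,2), where \<phi> = "\<lambda>(v, t). ennreal (r' (f, v, t)) * indicator C (f, v, t)"]) auto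
      also have "\<dots> = (\<integral>\<^sup>+x. ennreal (r (f, T x)) * \<Psi> (f, T x) \<partial>M)"
      proof (rule nn_integral_cong)
        fix x assume "x \<in> space M"
        then have Tx [measurable]: "T x \<in> space MT" by (rule measurable_space[rotated]) simp
        have "ennreal (normal_density (L (T x)) s v) * ennreal (r' (f, v, T x))
            = r (f, T x) * normal_density (L' (f, T x)) s' v" for v
          using normal_density_pos[OF Z(4), of "L (T x)" v] r[of "(f, T x)"]
          by (simp add: r'_def q_def ennreal_mult[symmetric])
        then have "(\<integral>\<^sup>+v. ennreal (normal_density (L (T x)) s v) *
            (\<lambda>(v, t). ennreal (r' (f, v, t)) * indicator C (f, v, t)) (v, T x) \<partial>lborel)
          = (\<integral>\<^sup>+v. ennreal (r (f, T x)) * (ennreal (normal_density (L' (f, T x)) s' v) * indicator C (f, v, T x)) \<partial>lborel)"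
          using r[of "(f, T x)"] by (simp add: mult.assoc[symmetric] ennreal_mult)
        also have "\<dots> = r (f, T x) * \<Psi> (f, T x)"
          unfolding \<Psi>_def by (simp add: nn_integral_cmult)
        finally show "(\<integral>\<^sup>+v. ennreal (normal_density (L (T x)) s v) *
            (\<lambda>(v, t). ennreal (r' (f, v, t)) * indicator C (f, v, t)) (v, T x) \<partial>lborel) = r (f, T x) * \<Psi> (f, T x)" .
      qed
      finally show "(\<integral>\<^sup>+x. ennreal (r (f, T x)) * \<Psi> (f, T x) \<partial>M) =
        (\<integral>\<^sup>+x. ennreal (r' (f, V x, T x)) * indicator C (f, V x, T x) \<partial>M)" by simp
    qed
    also have "\<dots> = (\<integral>\<^sup>+z. ennreal (r' z) * indicator C z \<partial>(distr M MF F \<Otimes>\<^sub>M distr M (borel \<Otimes>\<^sub>M MT) (\<lambda>x. (V x, T x))))"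
      by (subst VT.nn_integral_fst[symmetric]) (auto simp: nn_integral_distr intro!: nn_integral_cong)
    also have "\<dots> = emeasure ?r C"
      by (subst emeasure_density) auto
    finally show "emeasure ?l C = emeasure ?r C" .
  qed simp
  moreover have "has_bochner_integral M (\<lambda>x. ln (r' (F x, V x, T x))) (i + ln (s / s'))"
  proof -
    have "ln (r' (F x, V x, T x)) = ln (r (F x, T x)) + ((ln s - ln s') + ((Z x)\<^sup>2 / (2 * s\<^sup>2) - (Z' x)\<^sup>2 / (2 * s'\<^sup>2)))"
      if x: "x \<in> space M" for x
    proof -
      have ln_nd: "ln (normal_density m c v) = - (ln (2 * pi) / 2 + ln c) - (v - m)\<^sup>2 / (2 * c\<^sup>2)"
        if "c > 0" for m c v :: real
        using that by (simp add: normal_density_def ln_mult ln_div ln_sqrt ln_realpow real_sqrt_mult add_divide_distrib)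
      have VZ: "V x - L (T x) = Z x" "V x - L' (F x, T x) = Z' x"
        using V(1)[OF x] V(2)[OF x] by simp_all
      have "ln (q (F x) (V x) (T x)) = ln (normal_density (L' (F x, T x)) s' (V x)) - ln (normal_density (L (T x)) s (V x))"
        unfolding q_def using normal_density_pos[OF Z(4)] normal_density_pos[OF Z'(4)]
        by (simp add: ln_div less_imp_neq[symmetric])
      also have "\<dots> = (ln s - ln s') + ((Z x)\<^sup>2 / (2 * s\<^sup>2) - (Z' x)\<^sup>2 / (2 * s'\<^sup>2))"
        unfolding ln_nd[OF Z(4)] ln_nd[OF Z'(4)] VZ by simp
      finally show ?thesis
        using r[of "(F x, T x)"] q[of "F x" "V x" "T x"] by (simp add: r'_def ln_mult)
    qed
    \<comment> \<open>Each normalised square has mean 1/2, so the quadratic terms cancel and only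
      \<open>ln s - ln s'\<close> is added.\<close>
    moreover have "has_bochner_integral M (\<lambda>x. ln (r (F x, T x)) + ((ln s - ln s') + ((Z x)\<^sup>2 / (2 * s\<^sup>2) - (Z' x)\<^sup>2 / (2 * s'\<^sup>2))))
        (i + ((ln s - ln s') + (s\<^sup>2 / (2 * s\<^sup>2) - s'\<^sup>2 / (2 * s'\<^sup>2))))"
      using Z(3) Z'(3) i
      by (intro has_bochner_integral_add has_bochner_integral_diff has_bochner_integral_divide_zero)
        (auto simp: has_bochner_integral_iff prob_space)
    ultimately show ?thesis
      using Z(4) Z'(4) by (subst has_bochner_integral_cong[OF refl _ refl]) (auto simp: ln_div)
  qed
  moreover have "0 < r' z" for z
    using r q by (simp add: r'_def split_beta')
  ultimately show ?thesis
    unfolding has_information_def using r'm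
    by (intro conjI exI[of _ r']) auto
qed

end

section \<open>Gaussian spaces and conditional variances\<close>

lemma covariance_commute: "covariance M U V = covariance M V U"
  by (simp add: covariance_def mult.commute)

lemma sets_gen_algebra:
  assumes "rvec J W \<in> measurable M (borel_vec J)"
  shows "sets (gen_algebra M J W) = {rvec J W -` A \<inter> space M | A. A \<in> sets (borel_vec J)}"
  unfolding gen_algebra_def using measurable_space[OF assms] by (intro sets_vimage_algebra2) blast

lemma subalgebra_gen_algebra:
  assumes "rvec J W \<in> measurable M (borel_vec J)"
  shows "subalgebra M (gen_algebra M J W)"
  unfolding subalgebra_def sets_gen_algebra[OF assms]
  using measurable_sets[OF assms] by (auto simp: gen_algebra_def)

lemma measurable_gen_algebra_component:
  assumes W: "rvec J W \<in> measurable M (borel_vec J)" and j: "j \<in> J"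
  shows "W j \<in> borel_measurable (gen_algebra M J W)"
proof -
  have "rvec J W \<in> measurable (gen_algebra M J W) (borel_vec J)"
    unfolding gen_algebra_def using measurable_space[OF W] by (intro measurable_vimage_algebra1) blast
  from measurable_compose[OF this measurable_component_singleton[OF j]]
  show ?thesis using j by (simp add: rvec_def)
qed

text \<open>The characteristic function is prescribed at frequency 1 only; closure under scaling
  supplies all other frequencies. Variance 0 is allowed, so degenerate variables belong to the
  space.\<close>

locale gaussian_space = prob_space M for M :: "'w measure" +
  fixes H :: "('w \<Rightarrow> real) set"
  assumes H_measurable: "U \<in> H \<Longrightarrow> U \<in> borel_measurable M"
    and H_square: "U \<in> H \<Longrightarrow> integrable M (\<lambda>\<omega>. (U \<omega>)\<^sup>2)"
    and H_const: "(\<lambda>_. c) \<in> H"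
    and H_add: "U \<in> H \<Longrightarrow> V \<in> H \<Longrightarrow> (\<lambda>\<omega>. U \<omega> + V \<omega>) \<in> H"
    and H_scale: "U \<in> H \<Longrightarrow> (\<lambda>\<omega>. c * U \<omega>) \<in> H"
    and H_char: "U \<in> H \<Longrightarrow> (\<integral>\<omega>. iexp (U \<omega>) \<partial>M)
      = iexp (expectation U) * exp (- of_real (covariance M U U / 2))"
begin

abbreviation "cov \<equiv> covariance M"

lemma H_diff: "U \<in> H \<Longrightarrow> V \<in> H \<Longrightarrow> (\<lambda>\<omega>. U \<omega> - V \<omega>) \<in> H"
  using H_add[OF _ H_scale[of V "-1"], of U] by simp

lemma H_sum: "(\<And>j. j \<in> J \<Longrightarrow> W j \<in> H) \<Longrightarrow> (\<lambda>\<omega>. \<Sum>j\<in>J. W j \<omega>) \<in> H"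
  using H_const[of 0] by (induction J rule: infinite_finite_induct) (auto intro: H_add)

lemma H_integrable: "U \<in> H \<Longrightarrow> integrable M U"
  using square_integrable_imp_integrable[OF H_measurable H_square] .

lemma H_prod_integrable:
  assumes "U \<in> H" "V \<in> H"
  shows "integrable M (\<lambda>\<omega>. U \<omega> * V \<omega>)"
proof -
  have "integrable M (\<lambda>\<omega>. ((U \<omega> + V \<omega>)\<^sup>2 - (U \<omega>)\<^sup>2 - (V \<omega>)\<^sup>2) / 2)"
    using H_square[OF H_add[OF assms]] H_square[OF assms(1)] H_square[OF assms(2)] by auto
  then show ?thesis by (simp add: power2_sum)
qed

lemma cov_alt:
  assumes "U \<in> H" "V \<in> H"
  shows "cov U V = expectation (\<lambda>\<omega>. U \<omega> * V \<omega>) - expectation U * expectation V"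
  using H_integrable assms H_prod_integrable[OF assms]
  by (simp add: covariance_def algebra_simps prob_space)

lemma cov_add:
  assumes "U \<in> H" "V \<in> H" "W \<in> H"
  shows "cov (\<lambda>\<omega>. U \<omega> + V \<omega>) W = cov U W + cov V W"
  using assms H_integrable H_prod_integrable by (simp add: cov_alt H_add algebra_simps)

lemma cov_scale:
  assumes "U \<in> H" "W \<in> H"
  shows "cov (\<lambda>\<omega>. c * U \<omega>) W = c * cov U W"
  using assms by (simp add: cov_alt H_scale algebra_simps)

lemma cov_diff:
  assumes "U \<in> H" "V \<in> H" "W \<in> H"
  shows "cov (\<lambda>\<omega>. U \<omega> - V \<omega>) W = cov U W - cov V W"
  using assms H_integrable H_prod_integrable by (simp add: cov_alt H_diff algebra_simps)

lemma cov_const: "W \<in> H \<Longrightarrow> cov (\<lambda>_. c) W = 0"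
  by (simp add: cov_alt H_const prob_space)

lemma cov_sum:
  assumes "\<And>j. j \<in> J \<Longrightarrow> W j \<in> H" "V \<in> H"
  shows "cov (\<lambda>\<omega>. \<Sum>j\<in>J. W j \<omega>) V = (\<Sum>j\<in>J. cov (W j) V)"
  using assms
  by (induction J rule: infinite_finite_induct) (auto simp: cov_add H_sum cov_const)

lemma cov_self_nonneg: "0 \<le> cov U U"
  by (simp add: covariance_def)

lemma cov_quadratic:
  assumes "U \<in> H" "V \<in> H"
  shows "cov (\<lambda>\<omega>. U \<omega> - c * V \<omega>) (\<lambda>\<omega>. U \<omega> - c * V \<omega>) = cov U U - 2 * c * cov U V + c\<^sup>2 * cov V V"
proof -
  have cV: "(\<lambda>\<omega>. c * V \<omega>) \<in> H" using assms by (intro H_scale)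
  have d: "(\<lambda>\<omega>. U \<omega> - c * V \<omega>) \<in> H" using assms cV by (intro H_diff)
  have 1: "cov (\<lambda>\<omega>. U \<omega> - c * V \<omega>) W = cov U W - c * cov V W" if "W \<in> H" for W
    using assms that cV by (simp add: cov_diff cov_scale)
  have 2: "cov W (\<lambda>\<omega>. U \<omega> - c * V \<omega>) = cov U W - c * cov V W" if "W \<in> H" for W
    using 1[OF that] by (simp add: covariance_commute)
  show ?thesis
    using assms d by (simp add: 1 2 covariance_commute[of M V U] power2_eq_square algebra_simps)
qed

lemma cov_zero_if_null:
  assumes "U \<in> H" "V \<in> H" "cov V V = 0"
  shows "cov U V = 0"
proof (rule ccontr)
  assume c: "cov U V \<noteq> 0"
  \<comment> \<open>Since \<open>V\<close> has variance 0, the variance of \<open>U - t * V\<close>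
    is affine in \<open>t\<close>. This \<open>t\<close> would make it -1.\<close>
  define t where "t = (cov U U + 1) / (2 * cov U V)"
  have "cov U U - 2 * t * cov U V + t\<^sup>2 * cov V V \<ge> 0"
    using cov_self_nonneg cov_quadratic[OF assms(1,2), of t] by metis
  then show False using c assms(3) by (simp add: t_def)
qed

section \<open>Linear spans, residuals and squared distances\<close>

definition lspan :: "('w \<Rightarrow> real) set \<Rightarrow> ('w \<Rightarrow> real) set" where
  "lspan W = {\<lambda>\<omega>. \<Sum>w\<in>W. b w * w \<omega> | b. True}"

lemma lspan_in_H: "W \<subseteq> H \<Longrightarrow> L \<in> lspan W \<Longrightarrow> L \<in> H"
  unfolding lspan_def by (auto intro!: H_sum H_scale)

lemma lspan_zero: "(\<lambda>_. 0) \<in> lspan W"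
  unfolding lspan_def by (auto intro!: exI[of _ "\<lambda>_. 0"])

lemma lspan_base: "finite W \<Longrightarrow> w \<in> W \<Longrightarrow> w \<in> lspan W"
  unfolding lspan_def
  by (auto intro!: exI[of _ "\<lambda>v. if v = w then 1 else 0"] simp: if_distrib[of "\<lambda>x. x * _"] cong: if_cong)

lemma lspan_add:
  assumes "L \<in> lspan W" "L' \<in> lspan W"
  shows "(\<lambda>\<omega>. L \<omega> + L' \<omega>) \<in> lspan W"
proof -
  from assms obtain b b' where "L = (\<lambda>\<omega>. \<Sum>w\<in>W. b w * w \<omega>)" "L' = (\<lambda>\<omega>. \<Sum>w\<in>W. b' w * w \<omega>)"
    unfolding lspan_def by auto
  then have "(\<lambda>\<omega>. L \<omega> + L' \<omega>) = (\<lambda>\<omega>. \<Sum>w\<in>W. (b w + b' w) * w \<omega>)"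
    by (simp add: sum.distrib distrib_right)
  then show ?thesis unfolding lspan_def by (auto intro!: exI[of _ "\<lambda>w. b w + b' w"])
qed

lemma lspan_scale:
  assumes "L \<in> lspan W"
  shows "(\<lambda>\<omega>. c * L \<omega>) \<in> lspan W"
proof -
  from assms obtain b where "L = (\<lambda>\<omega>. \<Sum>w\<in>W. b w * w \<omega>)"
    unfolding lspan_def by auto
  then have "(\<lambda>\<omega>. c * L \<omega>) = (\<lambda>\<omega>. \<Sum>w\<in>W. (c * b w) * w \<omega>)"
    by (simp add: sum_distrib_left mult.assoc)
  then show ?thesis unfolding lspan_def by (auto intro!: exI[of _ "\<lambda>w. c * b w"])
qed

lemma lspan_diff: "L \<in> lspan W \<Longrightarrow> L' \<in> lspan W \<Longrightarrow> (\<lambda>\<omega>. L \<omega> - L' \<omega>) \<in> lspan W"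
  using lspan_add[OF _ lspan_scale[of L' W "-1"], of L] by simp

lemma lspan_sum: "(\<And>j. j \<in> J \<Longrightarrow> U j \<in> lspan W) \<Longrightarrow> (\<lambda>\<omega>. \<Sum>j\<in>J. U j \<omega>) \<in> lspan W"
  using lspan_zero by (induction J rule: infinite_finite_induct) (auto intro: lspan_add)

lemma lspan_mono:
  assumes "finite W'" "W \<subseteq> W'"
  shows "lspan W \<subseteq> lspan W'"
  unfolding lspan_def[of W] using lspan_base[OF assms(1)] assms(2)
  by (auto intro!: lspan_sum lspan_scale)

lemma cov_lspan:
  assumes "W \<subseteq> H" "V \<in> H" "\<And>w. w \<in> W \<Longrightarrow> cov V w = 0" "L \<in> lspan W"
  shows "cov V L = 0"
proof -
  obtain b where L: "L = (\<lambda>\<omega>. \<Sum>w\<in>W. b w * w \<omega>)"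
    using assms(4) unfolding lspan_def by auto
  have "cov L V = (\<Sum>w\<in>W. b w * cov w V)"
    unfolding L using assms by (subst cov_sum) (auto intro!: H_scale sum.cong cov_scale)
  then show ?thesis using assms(3) by (simp add: covariance_commute)
qed

text \<open>The squared distance from \<open>V\<close> to the span in the covariance seminorm.
  Constants are invisible to that seminorm, so predictors need no intercept. As an infimum it is
  monotone in \<open>W\<close> at once.\<close>

definition cvar :: "('w \<Rightarrow> real) \<Rightarrow> ('w \<Rightarrow> real) set \<Rightarrow> real" where
  "cvar V W = (INF L\<in>lspan W. cov (\<lambda>\<omega>. V \<omega> - L \<omega>) (\<lambda>\<omega>. V \<omega> - L \<omega>))"

text \<open>A relation rather than a function: if covariances are singular, several elements of the
  span may give an orthogonal remainder.\<close>

definition residual :: "('w \<Rightarrow> real) \<Rightarrow> ('w \<Rightarrow> real) set \<Rightarrow> ('w \<Rightarrow> real) \<Rightarrow> bool" where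
  "residual V W R \<longleftrightarrow> (\<exists>L\<in>lspan W. R = (\<lambda>\<omega>. V \<omega> - L \<omega>)) \<and> (\<forall>w\<in>W. cov R w = 0)"

lemma residual_in_H: "W \<subseteq> H \<Longrightarrow> V \<in> H \<Longrightarrow> residual V W R \<Longrightarrow> R \<in> H"
  unfolding residual_def using H_diff lspan_in_H by metis

lemma residual_cov_eq:
  assumes "W \<subseteq> H" "V \<in> H" "residual V W R" "Q \<in> H" "\<And>w. w \<in> W \<Longrightarrow> cov Q w = 0"
  shows "cov Q R = cov Q V"
proof -
  obtain L where L: "L \<in> lspan W" "R = (\<lambda>\<omega>. V \<omega> - L \<omega>)"
    using assms(3) unfolding residual_def by auto
  have "cov R Q = cov V Q - cov L Q"
    unfolding L(2) using assms lspan_in_H[OF _ L(1)] by (intro cov_diff)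
  then show ?thesis
    using cov_lspan[OF assms(1,4,5) L(1)] by (simp add: covariance_commute)
qed

lemma residual_self:
  assumes "W \<subseteq> H" "V \<in> H" "residual V W R"
  shows "cov R V = cov R R"
  using residual_cov_eq[OF assms residual_in_H[OF assms]] assms(3) by (simp add: residual_def)

text \<open>One Gram-Schmidt step: the only new direction is the part \<open>Q\<close> of
  \<open>w\<close> orthogonal to the old span. If \<open>Q\<close> has variance 0, the quotient
  \<kappa> is 0 by convention, which is right because then \<open>cov R Q = 0\<close> as
  well.\<close>

lemma residual_insert:
  assumes W: "finite W" "W \<subseteq> H" and H: "V \<in> H" "w \<in> H"
    and R: "residual V W R" and Q: "residual w W Q"
  defines "\<kappa> \<equiv> cov R Q / cov Q Q"
  shows "residual V (insert w W) (\<lambda>\<omega>. R \<omega> - \<kappa> * Q \<omega>)"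
proof -
  have RH: "R \<in> H" and QH: "Q \<in> H" using assms by (auto intro: residual_in_H)
  obtain L where L: "L \<in> lspan W" "R = (\<lambda>\<omega>. V \<omega> - L \<omega>)"
    using R unfolding residual_def by auto
  obtain K where K: "K \<in> lspan W" "Q = (\<lambda>\<omega>. w \<omega> - K \<omega>)"
    using Q unfolding residual_def by auto
  have "L \<in> lspan (insert w W)" "K \<in> lspan (insert w W)" "w \<in> lspan (insert w W)"
    using L(1) K(1) lspan_mono[of "insert w W" W] lspan_base[of "insert w W" w] W(1) by auto
  then have "(\<lambda>\<omega>. L \<omega> + \<kappa> * (w \<omega> - K \<omega>)) \<in> lspan (insert w W)"
    by (intro lspan_add lspan_scale lspan_diff)
  moreover have "(\<lambda>\<omega>. R \<omega> - \<kappa> * Q \<omega>) = (\<lambda>\<omega>. V \<omega> - (L \<omega> + \<kappa> * (w \<omega> - K \<omega>)))"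
    by (simp add: L K algebra_simps)
  moreover have "cov (\<lambda>\<omega>. R \<omega> - \<kappa> * Q \<omega>) v = 0" if "v \<in> insert w W" for v
  proof -
    have vH: "v \<in> H" using that assms by auto
    have eq: "cov (\<lambda>\<omega>. R \<omega> - \<kappa> * Q \<omega>) v = cov R v - \<kappa> * cov Q v"
      using RH QH vH by (simp add: cov_diff H_scale cov_scale)
    show ?thesis
    proof (cases "v \<in> W")
      case True
      then show ?thesis using eq R Q by (simp add: residual_def)
    next
      case False
      then have v: "v = w" using that by simp
      have "cov R w = cov R Q"
        using residual_cov_eq[OF W(2) H(2) Q RH] R by (simp add: residual_def)
      moreover have "cov Q w = cov Q Q"
        using residual_self[OF W(2) H(2) Q] .
      moreover have "cov Q Q = 0 \<Longrightarrow> cov R Q = 0"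
        using cov_zero_if_null[OF RH QH] .
      ultimately show ?thesis using eq by (auto simp: v \<kappa>_def)
    qed
  qed
  ultimately show ?thesis unfolding residual_def by auto
qed

lemma residual_exists:
  assumes "finite W" "W \<subseteq> H" "V \<in> H"
  shows "\<exists>R. residual V W R"
  using assms
proof (induction W arbitrary: V rule: finite_induct)
  case empty
  then show ?case
    by (auto simp: residual_def intro!: exI[of _ V] bexI[OF _ lspan_zero])
next
  case (insert w W)
  then show ?case using residual_insert[of W V w] by (meson insert_subset)
qed

lemma bdd_below_cvar: "bdd_below ((\<lambda>L. cov (\<lambda>\<omega>. V \<omega> - L \<omega>) (\<lambda>\<omega>. V \<omega> - L \<omega>)) ` lspan W)"
  using cov_self_nonneg by (auto intro!: bdd_belowI[where m = 0])

lemma cvar_le: "L \<in> lspan W \<Longrightarrow> cvar V W \<le> cov (\<lambda>\<omega>. V \<omega> - L \<omega>) (\<lambda>\<omega>. V \<omega> - L \<omega>)"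
  unfolding cvar_def by (rule cINF_lower[OF bdd_below_cvar])

lemma cvar_nonneg: "0 \<le> cvar V W"
  unfolding cvar_def using lspan_zero cov_self_nonneg by (intro cINF_greatest) auto

lemma cvar_le_cov: "cvar V W \<le> cov V V"
  using cvar_le[OF lspan_zero] by simp

lemma cvar_mono: "finite W' \<Longrightarrow> W \<subseteq> W' \<Longrightarrow> cvar V W' \<le> cvar V W"
  unfolding cvar_def using lspan_zero
  by (intro cINF_superset_mono lspan_mono bdd_below_cvar) auto

lemma cvar_member: "finite W \<Longrightarrow> V \<in> W \<Longrightarrow> cvar V W = 0"
  using cvar_le[OF lspan_base, of W V V] cvar_nonneg[of V W] by (simp add: covariance_def)

text \<open>Pythagoras: any other predictor differs from the one behind \<open>R\<close> by an
  element of the span, and this element is orthogonal to \<open>R\<close>.\<close>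

lemma cvar_residual:
  assumes "W \<subseteq> H" "V \<in> H" "residual V W R"
  shows "cvar V W = cov R R"
proof (rule antisym)
  obtain L where L: "L \<in> lspan W" "R = (\<lambda>\<omega>. V \<omega> - L \<omega>)"
    using assms(3) unfolding residual_def by auto
  have RH: "R \<in> H" using assms by (rule residual_in_H)
  show "cvar V W \<le> cov R R" unfolding L(2) by (rule cvar_le[OF L(1)])
  show "cov R R \<le> cvar V W"
    unfolding cvar_def
  proof (rule cINF_greatest)
    fix K assume K: "K \<in> lspan W"
    let ?D = "\<lambda>\<omega>. K \<omega> - L \<omega>"
    have D: "?D \<in> lspan W" using K L(1) by (rule lspan_diff)
    have DH: "?D \<in> H" using lspan_in_H[OF assms(1) D] .
    have "cov R ?D = 0"
      using assms(3) by (intro cov_lspan[OF assms(1) RH _ D]) (simp add: residual_def)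
    then have "cov (\<lambda>\<omega>. R \<omega> - 1 * ?D \<omega>) (\<lambda>\<omega>. R \<omega> - 1 * ?D \<omega>) = cov R R + cov ?D ?D"
      using cov_quadratic[OF RH DH, of 1] by simp
    moreover have "(\<lambda>\<omega>. R \<omega> - 1 * ?D \<omega>) = (\<lambda>\<omega>. V \<omega> - K \<omega>)" by (simp add: L(2))
    ultimately show "cov R R \<le> cov (\<lambda>\<omega>. V \<omega> - K \<omega>) (\<lambda>\<omega>. V \<omega> - K \<omega>)"
      using cov_self_nonneg[of ?D] by simp
  qed (use lspan_zero in auto)
qed

lemma cvar_insert:
  assumes W: "finite W" "W \<subseteq> H" and H: "V \<in> H" "w \<in> H"
    and R: "residual V W R" and Q: "residual w W Q"
  shows "cvar V (insert w W) = cvar V W - (cov R Q)\<^sup>2 / cvar w W"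
proof -
  have RH: "R \<in> H" and QH: "Q \<in> H" using assms by (auto intro: residual_in_H)
  have "cvar V (insert w W) = cov R R - 2 * (cov R Q / cov Q Q) * cov R Q + (cov R Q / cov Q Q)\<^sup>2 * cov Q Q"
    using cvar_residual[OF _ H(1) residual_insert[OF assms]] W H
    unfolding cov_quadratic[OF RH QH] by blast
  also have "\<dots> = cov R R - (cov R Q)\<^sup>2 / cov Q Q"
    by (cases "cov Q Q = 0") (auto simp: power2_eq_square field_simps)
  finally show ?thesis
    using cvar_residual[OF W(2) H(1) R] cvar_residual[OF W(2) H(2) Q] by simp
qed

text \<open>
  Conditionally on \<open>W\<close>, both reductions are governed by the same conditional covariance of \<open>V\<close>
  and \<open>w\<close>.
\<close>

lemma cvar_exchange:
  assumes W: "finite W" "W \<subseteq> H" and H: "V \<in> H" "w \<in> H"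
  obtains c where "cvar V (insert w W) = cvar V W - c\<^sup>2 / cvar w W"
    and "cvar w (insert V W) = cvar w W - c\<^sup>2 / cvar V W"
proof -
  obtain R Q where "residual V W R" "residual w W Q"
    using residual_exists[OF W] H by meson
  then show thesis
    using that[of "cov R Q"] cvar_insert[OF W H(1,2), of R Q] cvar_insert[OF W H(2,1), of Q R]
    by (simp add: covariance_commute)
qed

text \<open>In a Gaussian space uncorrelated means independent: the variance of the sum of two
  uncorrelated variables is the sum of the variances, so its characteristic function
  factors.\<close>

lemma indep_residual:
  assumes W: "finite W" "W \<subseteq> H" and V: "V \<in> H" and R: "residual V W R"
  defines "Z \<equiv> \<lambda>\<omega>. R \<omega> - expectation R"
  shows "indep_elements borel Z (borel_vec W) (rvec W (\<lambda>w. w))"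
proof (rule indep_elements_rvecI[OF W(1)])
  have RH: "R \<in> H" using W(2) V R by (rule residual_in_H)
  then have ZH: "Z \<in> H" unfolding Z_def by (intro H_diff H_const)
  then show "Z \<in> borel_measurable M" by (rule H_measurable)
  show "w \<in> borel_measurable M" if "w \<in> W" for w using that W by (auto intro: H_measurable)
  fix u c
  let ?T = "\<lambda>\<omega>. \<Sum>w\<in>W. c w * w \<omega>" and ?uZ = "\<lambda>\<omega>. u * Z \<omega>"
  have T: "?T \<in> lspan W" by (auto simp: lspan_def)
  have TH: "?T \<in> H" using W(2) T by (rule lspan_in_H)
  have uH: "?uZ \<in> H" using ZH by (rule H_scale)
  have cZ: "cov Z w = 0" if "w \<in> W" for w
    unfolding Z_def using RH H_const that W R by (subst cov_diff) (auto simp: cov_const residual_def)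
  have c0: "cov ?uZ ?T = 0"
    using cov_lspan[OF W(2) ZH cZ T] ZH TH by (simp add: cov_scale)
  have sH: "(\<lambda>\<omega>. ?uZ \<omega> + ?T \<omega>) \<in> H" using uH TH by (rule H_add)
  have "cov (\<lambda>\<omega>. ?uZ \<omega> + ?T \<omega>) (\<lambda>\<omega>. ?uZ \<omega> + ?T \<omega>) = cov ?uZ ?uZ + cov ?T ?T"
    using cov_quadratic[OF uH TH, of "-1"] c0 by simp
  moreover have "expectation (\<lambda>\<omega>. ?uZ \<omega> + ?T \<omega>) = expectation ?uZ + expectation ?T"
    using H_integrable uH TH by (intro Bochner_Integration.integral_add)
  ultimately show "(\<integral>x. iexp (?uZ x + ?T x) \<partial>M) = (\<integral>x. iexp (?uZ x) \<partial>M) * (\<integral>x. iexp (?T x) \<partial>M)"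
    unfolding H_char[OF sH] H_char[OF uH] H_char[OF TH]
    by (simp only: iexp_add) (simp add: exp_add[symmetric] add_divide_distrib algebra_simps)
qed

lemma residual_normal:
  assumes W: "finite W" "W \<subseteq> H" and V: "V \<in> H" and R: "residual V W R" and pos: "cvar V W > 0"
  defines "Z \<equiv> \<lambda>\<omega>. R \<omega> - expectation R"
  shows "distributed M lborel Z (normal_density 0 (sqrt (cvar V W)))"
    and "has_bochner_integral M (\<lambda>\<omega>. (Z \<omega>)\<^sup>2) ((sqrt (cvar V W))\<^sup>2)"
proof -
  have RH: "R \<in> H" using W(2) V R by (rule residual_in_H)
  then have ZH: "Z \<in> H" unfolding Z_def by (intro H_diff H_const)
  have EZ: "expectation Z = 0" using H_integrable[OF RH] by (simp add: Z_def prob_space)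
  have var: "cov Z Z = cvar V W"
    unfolding cvar_residual[OF W(2) V R] using EZ by (simp add: covariance_def) (simp add: Z_def)
  show "distributed M lborel Z (normal_density 0 (sqrt (cvar V W)))"
  proof (rule char_imp_normal)
    fix t
    have "cov (\<lambda>\<omega>. t * Z \<omega>) (\<lambda>\<omega>. t * Z \<omega>) = t\<^sup>2 * cvar V W"
      using cov_scale[OF ZH H_scale[OF ZH, of t], of t] cov_scale[OF ZH ZH, of t]
        covariance_commute[of M Z "\<lambda>\<omega>. t * Z \<omega>"]
      by (simp only: var power2_eq_square mult.assoc)
    then show "(\<integral>\<omega>. iexp (t * Z \<omega>) \<partial>M) = iexp (t * 0) * exp (- of_real (t\<^sup>2 * (sqrt (cvar V W))\<^sup>2 / 2))"
      using EZ pos unfolding H_char[OF H_scale[OF ZH]] by simp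
  qed (use pos H_measurable[OF ZH] in auto)
  show "has_bochner_integral M (\<lambda>\<omega>. (Z \<omega>)\<^sup>2) ((sqrt (cvar V W))\<^sup>2)"
    using H_square[OF ZH] var EZ pos by (simp add: has_bochner_integral_iff covariance_def power2_eq_square)
qed

section \<open>Conditional variance and mutual information in a Gaussian space\<close>

lemma real_cond_exp_indep:
  assumes ind: "indep_elements borel Z (borel_vec J) (rvec J W)"
    and [measurable]: "g \<in> borel_measurable borel" and int: "integrable M (\<lambda>\<omega>. g (Z \<omega>) :: real)"
  shows "AE \<omega> in M. real_cond_exp M (gen_algebra M J W) (\<lambda>\<omega>. g (Z \<omega>)) \<omega> = expectation (\<lambda>\<omega>. g (Z \<omega>))"
proof -
  let ?F = "gen_algebra M J W"
  have W: "rvec J W \<in> measurable M (borel_vec J)" using ind by (simp add: indep_elements_def)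
  note sets = sets_gen_algebra[OF W]
  interpret finite_measure_subalgebra M ?F
    by unfold_locales (rule subalgebra_gen_algebra[OF W])
  show ?thesis
  proof (rule real_cond_exp_charact[OF _ int])
    fix A assume "A \<in> sets ?F"
    then obtain C where C [measurable]: "C \<in> sets (borel_vec J)" and A: "A = rvec J W -` C \<inter> space M"
      using sets by auto
    have [measurable]: "A \<in> sets M" unfolding A using W C by (rule measurable_sets)
    have "indep_elements borel (\<lambda>\<omega>. g (Z \<omega>)) borel (\<lambda>\<omega>. indicator C (rvec J W \<omega>) :: real)"
      by (rule indep_elements_compose[OF ind]) auto
    note ind' = indep_elements_imp_indep_var[OF this]
    have ind_eq: "indicator C (rvec J W \<omega>) = (indicator A \<omega> :: real)" if "\<omega> \<in> space M" for \<omega>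
      using that by (simp add: A indicator_def)
    have "integrable M (indicator A :: _ \<Rightarrow> real)"
      by (intro integrable_const_bound[where B = 1]) auto
    then have intC: "integrable M (\<lambda>\<omega>. indicator C (rvec J W \<omega>) :: real)"
      by (subst Bochner_Integration.integrable_cong[OF refl ind_eq])
    have "(\<integral>\<omega>\<in>A. g (Z \<omega>) \<partial>M) = (\<integral>\<omega>. g (Z \<omega>) * indicator C (rvec J W \<omega>) \<partial>M)"
      unfolding set_lebesgue_integral_def using ind_eq
      by (intro Bochner_Integration.integral_cong) (auto simp: mult.commute)
    also have "\<dots> = expectation (\<lambda>\<omega>. g (Z \<omega>)) * expectation (\<lambda>\<omega>. indicator C (rvec J W \<omega>))"
      by (rule indep_var_lebesgue_integral[OF ind' int intC])
    also have "expectation (\<lambda>\<omega>. indicator C (rvec J W \<omega>)) = expectation (indicator A :: _ \<Rightarrow> real)"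
      using ind_eq by (intro Bochner_Integration.integral_cong) auto
    finally show "(\<integral>\<omega>\<in>A. g (Z \<omega>) \<partial>M) = (\<integral>\<omega>\<in>A. expectation (\<lambda>\<omega>. g (Z \<omega>)) \<partial>M)"
      by (simp add: set_lebesgue_integral_def)
  qed auto
qed

text \<open>\<open>V\<close> is the sum of a part measurable with respect to the conditioning
  algebra and an independent centred residual \<open>Z\<close>. The inner conditional expectation
  removes the first part exactly, and the conditional expectation of the square of \<open>Z\<close>
  is the constant variance of \<open>Z\<close>.\<close>

lemma cond_var_eq_cvar:
  assumes J: "finite J" "W ` J \<subseteq> H" and V: "V \<in> H"
  shows "AE \<omega> in M. cond_var M V J W \<omega> = cvar V (W ` J)"
proof -
  let ?F = "gen_algebra M J W"
  have fin: "finite (W ` J)" using J by simp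
  obtain R where R: "residual V (W ` J) R" using residual_exists[OF fin J(2) V] by auto
  have RH: "R \<in> H" using J(2) V R by (rule residual_in_H)
  define Z where "Z = (\<lambda>\<omega>. R \<omega> - expectation R)"
  have ZH: "Z \<in> H" unfolding Z_def by (intro H_diff H_const RH)
  have EZ: "expectation Z = 0" using H_integrable[OF RH] by (simp add: Z_def prob_space)
  obtain L where L: "L \<in> lspan (W ` J)" "R = (\<lambda>\<omega>. V \<omega> - L \<omega>)"
    using R unfolding residual_def by auto
  have LH: "L \<in> H" using lspan_in_H[OF J(2) L(1)] .
  \<comment> \<open>Spans are indexed by sets of functions, observations by \<open>J\<close>.
    Copying components moves independence from the former to the latter even if \<open>W\<close> is
    not injective.\<close>
  have "(\<lambda>z. \<lambda>j\<in>J. z (W j)) \<in> measurable (borel_vec (W ` J)) (borel_vec J)"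
    by (intro measurable_restrict measurable_component_singleton) auto
  from indep_elements_compose[OF indep_residual[OF fin J(2) V R] measurable_ident this]
  have ind: "indep_elements borel Z (borel_vec J) (rvec J W)"
    by (simp add: rvec_def Z_def cong: restrict_cong)
  have Wm: "rvec J W \<in> measurable M (borel_vec J)" using ind by (simp add: indep_elements_def)
  interpret S: finite_measure_subalgebra M ?F
    by unfold_locales (rule subalgebra_gen_algebra[OF Wm])
  note comp = measurable_gen_algebra_component[OF Wm]
  have LF: "L \<in> borel_measurable ?F"
    using L(1) comp unfolding lspan_def by (auto intro!: borel_measurable_sum borel_measurable_times)
  define m where "m = expectation R"
  have V_eq: "V = (\<lambda>\<omega>. (L \<omega> + m) + Z \<omega>)" by (simp add: L(2) m_def Z_def)
  have iL: "integrable M (\<lambda>\<omega>. L \<omega> + m)" using H_integrable[OF LH] by simp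
  have "AE \<omega> in M. real_cond_exp M ?F (\<lambda>\<omega>. (L \<omega> + m) + Z \<omega>) \<omega>
      = real_cond_exp M ?F (\<lambda>\<omega>. L \<omega> + m) \<omega> + real_cond_exp M ?F Z \<omega>"
    using iL H_integrable[OF ZH] by (rule S.real_cond_exp_add)
  moreover have "AE \<omega> in M. real_cond_exp M ?F (\<lambda>\<omega>. L \<omega> + m) \<omega> = L \<omega> + m"
    using iL LF by (intro S.real_cond_exp_F_meas) auto
  moreover have "AE \<omega> in M. real_cond_exp M ?F Z \<omega> = 0"
    using real_cond_exp_indep[OF ind, of "\<lambda>z. z"] H_integrable[OF ZH] EZ by simp
  ultimately have "AE \<omega> in M. (V \<omega> - real_cond_exp M ?F V \<omega>)\<^sup>2 = (Z \<omega>)\<^sup>2"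
    unfolding V_eq by eventually_elim simp
  then have "AE \<omega> in M. real_cond_exp M ?F (\<lambda>\<omega>. (V \<omega> - real_cond_exp M ?F V \<omega>)\<^sup>2) \<omega>
      = real_cond_exp M ?F (\<lambda>\<omega>. (Z \<omega>)\<^sup>2) \<omega>"
    using H_measurable[OF V] H_measurable[OF ZH] by (intro S.real_cond_exp_cong) auto
  moreover have "AE \<omega> in M. real_cond_exp M ?F (\<lambda>\<omega>. (Z \<omega>)\<^sup>2) \<omega> = cvar V (W ` J)"
  proof -
    have "expectation (\<lambda>\<omega>. (Z \<omega>)\<^sup>2) = cvar V (W ` J)"
      unfolding cvar_residual[OF J(2) V R] by (simp add: covariance_def Z_def power2_eq_square)
    then show ?thesis
      using real_cond_exp_indep[OF ind, of "\<lambda>z. z\<^sup>2"] H_square[OF ZH] by simp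
  qed
  ultimately show ?thesis
    unfolding cond_var_def Let_def by eventually_elim simp
qed

text \<open>The chain rule is fed with two decompositions of \<open>v\<close>: into predictor and
  residual given \<open>y\<close> on \<open>J\<close>, and given both \<open>f\<close> on
  \<open>A\<close> and \<open>y\<close> on \<open>J\<close>. Positivity of the smaller conditional
  variance makes both residuals nondegenerate; the factor 1/2 arises in passing from standard
  deviations to variances.\<close>

lemma has_information_step:
  fixes f :: "'i \<Rightarrow> 'w \<Rightarrow> real" and y :: "'j \<Rightarrow> 'w \<Rightarrow> real"
  assumes A: "finite A" "f ` A \<subseteq> H" and J: "finite J" "y ` J \<subseteq> H" and v: "v \<in> H"
    and info: "has_information (borel_vec A) (rvec A f) (borel_vec J) (rvec J y) i"
    and pos: "cvar v (f ` A \<union> y ` J) > 0"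
  shows "has_information (borel_vec A) (rvec A f) (borel \<Otimes>\<^sub>M borel_vec J) (\<lambda>\<omega>. (v \<omega>, rvec J y \<omega>))
    (i + ln (cvar v (y ` J) / cvar v (f ` A \<union> y ` J)) / 2)"
proof -
  let ?W = "y ` J" and ?W' = "f ` A \<union> y ` J"
  have W: "finite ?W" "?W \<subseteq> H" and W': "finite ?W'" "?W' \<subseteq> H" using A J by auto
  have pos0: "cvar v ?W > 0" using cvar_mono[OF W'(1), of ?W v] pos by auto
  obtain R where R: "residual v ?W R" using residual_exists[OF W v] by auto
  obtain R' where R': "residual v ?W' R'" using residual_exists[OF W' v] by auto
  obtain b where b: "R = (\<lambda>\<omega>. v \<omega> - (\<Sum>w\<in>?W. b w * w \<omega>))"
    using R unfolding residual_def lspan_def by auto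
  obtain b' where b': "R' = (\<lambda>\<omega>. v \<omega> - (\<Sum>w\<in>?W'. b' w * w \<omega>))"
    using R' unfolding residual_def lspan_def by auto
  define L where "L = (\<lambda>t. expectation R + (\<Sum>w\<in>?W. b w * t (inv_into J y w)))"
  \<comment> \<open>The predictor sums over a set of functions, whereas \<open>L'\<close> receives
    vectors over indices, so each function is read at an index chosen by \<open>inv_into\<close>. A
    function in both images can be read from either vector; the first one is used.\<close>
  define L' where "L' = (\<lambda>(a, t). expectation R' + (\<Sum>w\<in>?W'. b' w *
      (if w \<in> f ` A then a (inv_into A f w) else t (inv_into J y w))))"
  have inv: "inv_into J y w \<in> J" "y (inv_into J y w) = w" if "w \<in> y ` J" for w
    using that by (auto intro: inv_into_into f_inv_into_f)
  have inv': "inv_into A f w \<in> A" "f (inv_into A f w) = w" if "w \<in> f ` A" for w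
    using that by (auto intro: inv_into_into f_inv_into_f)
  have Lm: "L \<in> borel_measurable (borel_vec J)"
    unfolding L_def using inv by (intro borel_measurable_add borel_measurable_const borel_measurable_sum
        borel_measurable_times measurable_component_singleton) auto
  have ca: "(\<lambda>z. fst z j) \<in> borel_measurable (borel_vec A \<Otimes>\<^sub>M borel_vec J)" if "j \<in> A" for j
    using that by (intro measurable_compose[OF measurable_fst measurable_component_singleton])
  have ct: "(\<lambda>z. snd z j) \<in> borel_measurable (borel_vec A \<Otimes>\<^sub>M borel_vec J)" if "j \<in> J" for j
    using that by (intro measurable_compose[OF measurable_snd measurable_component_singleton])
  have L'm: "L' \<in> borel_measurable (borel_vec A \<Otimes>\<^sub>M borel_vec J)"
  proof -
    have "(\<lambda>z. if w \<in> f ` A then fst z (inv_into A f w) else snd z (inv_into J y w))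
        \<in> borel_measurable (borel_vec A \<Otimes>\<^sub>M borel_vec J)" if "w \<in> ?W'" for w
      using that inv inv' by (cases "w \<in> f ` A") (auto intro!: ca ct)
    then show ?thesis
      unfolding L'_def split_beta'
      by (intro borel_measurable_add borel_measurable_const borel_measurable_sum borel_measurable_times)
  qed
  have "(\<lambda>z. \<lambda>j\<in>J. z (y j)) \<in> measurable (borel_vec ?W) (borel_vec J)"
    by (intro measurable_restrict measurable_component_singleton) auto
  from indep_elements_compose[OF indep_residual[OF W v R] measurable_ident this]
  have ind: "indep_elements borel (\<lambda>\<omega>. R \<omega> - expectation R) (borel_vec J) (rvec J y)"
    by (simp add: rvec_def cong: restrict_cong)
  have "(\<lambda>z. (\<lambda>j\<in>A. z (f j), \<lambda>j\<in>J. z (y j))) \<in> measurable (borel_vec ?W') (borel_vec A \<Otimes>\<^sub>M borel_vec J)"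
    by (intro measurable_Pair measurable_restrict measurable_component_singleton) auto
  from indep_elements_compose[OF indep_residual[OF W' v R'] measurable_ident this]
  have ind': "indep_elements borel (\<lambda>\<omega>. R' \<omega> - expectation R') (borel_vec A \<Otimes>\<^sub>M borel_vec J)
      (\<lambda>\<omega>. (rvec A f \<omega>, rvec J y \<omega>))"
    by (simp add: rvec_def cong: restrict_cong)
  have "has_information (borel_vec A) (rvec A f) (borel \<Otimes>\<^sub>M borel_vec J) (\<lambda>\<omega>. (v \<omega>, rvec J y \<omega>))
    (i + ln (sqrt (cvar v ?W) / sqrt (cvar v ?W')))"
  proof (rule has_information_chain[OF info residual_normal(1)[OF W v R pos0] ind
        residual_normal(2)[OF W v R pos0] _ residual_normal(1)[OF W' v R' pos] ind'
        residual_normal(2)[OF W' v R' pos] _ Lm L'm])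
    fix \<omega> assume "\<omega> \<in> space M"
    have "(\<Sum>w\<in>?W. b w * rvec J y \<omega> (inv_into J y w)) = (\<Sum>w\<in>?W. b w * w \<omega>)"
      using inv by (intro sum.cong) (auto simp: rvec_def)
    then show "v \<omega> = L (rvec J y \<omega>) + (R \<omega> - expectation R)"
      by (simp add: L_def b)
    have "(\<Sum>w\<in>?W'. b' w * (if w \<in> f ` A then rvec A f \<omega> (inv_into A f w) else rvec J y \<omega> (inv_into J y w)))
        = (\<Sum>w\<in>?W'. b' w * w \<omega>)"
      using inv inv' by (intro sum.cong) (auto simp: rvec_def)
    then show "v \<omega> = L' (rvec A f \<omega>, rvec J y \<omega>) + (R' \<omega> - expectation R')"
      by (simp add: L'_def b')
  qed (use pos pos0 in auto)
  moreover have "ln (sqrt (cvar v ?W) / sqrt (cvar v ?W')) = ln (cvar v ?W / cvar v ?W') / 2"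
    using pos pos0 by (simp add: ln_div ln_sqrt diff_divide_distrib)
  ultimately show ?thesis by simp
qed

end

section \<open>The Gaussian space of the model\<close>

definition lincombs :: "'i set \<Rightarrow> ('i \<Rightarrow> 'w \<Rightarrow> real) \<Rightarrow> ('w \<Rightarrow> real) set" where
  "lincombs D Z = {\<lambda>\<omega>. \<Sum>i\<in>F. c i * Z i \<omega> | F c. finite F \<and> F \<subseteq> D}"

lemma lincombsI: "finite F \<Longrightarrow> F \<subseteq> D \<Longrightarrow> (\<lambda>\<omega>. \<Sum>i\<in>F. c i * Z i \<omega>) \<in> lincombs D Z"
  unfolding lincombs_def by blast

lemma lincombs_zero: "(\<lambda>_. 0) \<in> lincombs D Z"
  unfolding lincombs_def by (auto intro!: exI[of _ "{}"])

lemma lincombs_base: "i \<in> D \<Longrightarrow> Z i \<in> lincombs D Z"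
  unfolding lincombs_def by (auto intro!: exI[of _ "{i}"] exI[of _ "\<lambda>_. 1"])

lemma lincombs_add:
  assumes "P \<in> lincombs D Z" "Q \<in> lincombs D Z"
  shows "(\<lambda>\<omega>. P \<omega> + Q \<omega>) \<in> lincombs D Z"
proof -
  from assms obtain F c G d where
    P: "P = (\<lambda>\<omega>. \<Sum>i\<in>F. c i * Z i \<omega>)" "finite F" "F \<subseteq> D" and
    Q: "Q = (\<lambda>\<omega>. \<Sum>i\<in>G. d i * Z i \<omega>)" "finite G" "G \<subseteq> D"
    unfolding lincombs_def by auto
  have ext: "(\<Sum>i\<in>K. b i * Z i \<omega>) = (\<Sum>i\<in>F \<union> G. (if i \<in> K then b i else 0) * Z i \<omega>)"
    if "K \<subseteq> F \<union> G" for K \<omega> and b :: "_ \<Rightarrow> real"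
    using that P(2) Q(2) by (intro sum.mono_neutral_cong_left) auto
  have "(\<lambda>\<omega>. P \<omega> + Q \<omega>) = (\<lambda>\<omega>. \<Sum>i\<in>F \<union> G. ((if i \<in> F then c i else 0) + (if i \<in> G then d i else 0)) * Z i \<omega>)"
    unfolding P(1) Q(1) by (simp add: ext[of F] ext[of G] sum.distrib distrib_right)
  with P(2,3) Q(2,3) show ?thesis
    by (simp only:) (intro lincombsI, auto)
qed

lemma lincombs_scale:
  assumes "P \<in> lincombs D Z"
  shows "(\<lambda>\<omega>. a * P \<omega>) \<in> lincombs D Z"
proof -
  from assms obtain F c where P: "P = (\<lambda>\<omega>. \<Sum>i\<in>F. c i * Z i \<omega>)" "finite F" "F \<subseteq> D"
    unfolding lincombs_def by auto
  then have "(\<lambda>\<omega>. a * P \<omega>) = (\<lambda>\<omega>. \<Sum>i\<in>F. (a * c i) * Z i \<omega>)"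
    by (simp add: sum_distrib_left mult.assoc)
  with P(2,3) show ?thesis by (simp only: lincombsI)
qed

lemma lincombs_measurable:
  assumes "P \<in> lincombs D Z" "\<And>i. i \<in> D \<Longrightarrow> Z i \<in> borel_measurable N"
  shows "P \<in> borel_measurable N"
  using assms unfolding lincombs_def
  by (auto intro!: borel_measurable_sum borel_measurable_times)

section \<open>Gaussian variables through characteristic functions\<close>

context prob_space
begin

text \<open>A common form for both alternatives of \<open>gaussian_rv\<close>, point masses and
  normal densities. It is preserved by independent sums without distinguishing these cases.\<close>

definition gauss_char :: "('a \<Rightarrow> real) \<Rightarrow> bool" where
  "gauss_char U \<longleftrightarrow> U \<in> borel_measurable M \<and> integrable M (\<lambda>\<omega>. (U \<omega>)\<^sup>2) \<and>
     (\<integral>\<omega>. iexp (U \<omega>) \<partial>M) = iexp (expectation U) * exp (- of_real (covariance M U U / 2))"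

lemma covariance_square:
  assumes "U \<in> borel_measurable M" "integrable M (\<lambda>\<omega>. (U \<omega>)\<^sup>2)"
  shows "covariance M U U = expectation (\<lambda>\<omega>. (U \<omega>)\<^sup>2) - (expectation U)\<^sup>2"
proof -
  have "integrable M U" using assms by (rule square_integrable_imp_integrable)
  then show ?thesis
    using assms by (simp add: covariance_def algebra_simps power2_eq_square prob_space)
qed

lemma gauss_char_normal:
  assumes "distributed M lborel U (normal_density m s)" "s > 0"
  shows "gauss_char U" and "covariance M U U = s\<^sup>2"
proof -
  have m [measurable]: "U \<in> borel_measurable M"
    using distributed_measurable[OF assms(1)] by simp
  have E: "expectation U = m" using assms by (intro normal_distributed_expectation)
  show cov: "covariance M U U = s\<^sup>2"
    using normal_distributed_variance[OF assms(2,1)] by (simp add: covariance_def power2_eq_square)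
  have "integrable M (\<lambda>\<omega>. (U \<omega> - m)\<^sup>2)"
    using integrable_normal_moment[OF assms(2), of m 2]
    by (subst distributed_integrable[OF assms(1), symmetric]) auto
  moreover have "integrable M (\<lambda>\<omega>. U \<omega> - m)"
    using integrable_normal_moment[OF assms(2), of m 1]
    by (subst distributed_integrable[OF assms(1), symmetric, where g = "\<lambda>x. x - m"]) auto
  ultimately have "integrable M (\<lambda>\<omega>. (U \<omega> - m)\<^sup>2 + 2 * m * (U \<omega> - m) + m\<^sup>2)" by simp
  moreover have "(\<lambda>\<omega>. (U \<omega> - m)\<^sup>2 + 2 * m * (U \<omega> - m) + m\<^sup>2) = (\<lambda>\<omega>. (U \<omega>)\<^sup>2)"
    by (simp add: fun_eq_iff power2_eq_square algebra_simps)
  ultimately have sq: "integrable M (\<lambda>\<omega>. (U \<omega>)\<^sup>2)" by simp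
  define Y where "Y = (\<lambda>\<omega>. (U \<omega> - m) / s)"
  have [measurable]: "Y \<in> borel_measurable M" unfolding Y_def by measurable
  have "distributed M lborel Y std_normal_density"
    using assms(1) unfolding Y_def by (subst normal_standard_normal_convert[OF assms(2), symmetric])
  then have "distr M borel Y = std_normal_distribution"
    unfolding distributed_def by (metis distr_cong sets_lborel)
  then have "char (distr M borel Y) s = exp (- of_real (s\<^sup>2 / 2))"
    by (simp add: char_std_normal_distribution of_real_exp)
  then have "(\<integral>\<omega>. iexp (s * Y \<omega>) \<partial>M) = exp (- of_real (s\<^sup>2 / 2))"
    by (simp add: char_def integral_distr)
  moreover have "iexp (U \<omega>) = iexp m * iexp (s * Y \<omega>)" for \<omega>
    using assms(2) by (simp add: Y_def iexp_add[symmetric] del: of_real_mult of_real_divide of_real_diff)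
  ultimately show "gauss_char U"
    unfolding gauss_char_def using m sq E cov by simp
qed

lemma gauss_char_gaussian_rv:
  assumes "gaussian_rv M U"
  shows "gauss_char U"
proof -
  have m [measurable]: "U \<in> borel_measurable M" using assms by (simp add: gaussian_rv_def)
  consider c where "AE \<omega> in M. U \<omega> = c" | c s where "s > 0" "distributed M lborel U (normal_density c s)"
    using assms unfolding gaussian_rv_def by blast
  then show ?thesis
  proof cases
    case 1
    have E: "expectation U = c"
      using 1 by (subst integral_cong_AE[where g = "\<lambda>_. c"]) (auto simp: prob_space)
    have "covariance M U U = 0"
      unfolding covariance_def E using 1 by (intro integral_eq_zero_AE) auto
    moreover have "integrable M (\<lambda>\<omega>. (U \<omega>)\<^sup>2)"
      using 1 by (subst integrable_cong_AE[where g = "\<lambda>_. c\<^sup>2"]) auto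
    moreover have "(\<integral>\<omega>. iexp (U \<omega>) \<partial>M) = iexp c"
      using 1 by (subst integral_cong_AE[where g = "\<lambda>_. iexp c"]) (auto simp: prob_space)
    ultimately show ?thesis unfolding gauss_char_def using m E by simp
  next
    case 2
    then show ?thesis using gauss_char_normal by blast
  qed
qed

lemma covariance_indep:
  assumes "gauss_char U" "gauss_char V" "indep_var borel U borel V"
  shows "integrable M (\<lambda>\<omega>. U \<omega> * V \<omega>)" "covariance M U V = 0"
proof -
  have i: "integrable M U" "integrable M V"
    using assms by (auto simp: gauss_char_def intro: square_integrable_imp_integrable)
  show int: "integrable M (\<lambda>\<omega>. U \<omega> * V \<omega>)" by (rule indep_var_integrable[OF assms(3) i])
  show "covariance M U V = 0"
    using i int indep_var_lebesgue_integral[OF assms(3) i]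
    by (simp add: covariance_def algebra_simps prob_space)
qed

lemma gauss_char_add:
  assumes U: "gauss_char U" and V: "gauss_char V" and ind: "indep_var borel U borel V"
  shows "gauss_char (\<lambda>\<omega>. U \<omega> + V \<omega>)"
proof -
  have [measurable]: "U \<in> borel_measurable M" "V \<in> borel_measurable M"
    and sq: "integrable M (\<lambda>\<omega>. (U \<omega>)\<^sup>2)" "integrable M (\<lambda>\<omega>. (V \<omega>)\<^sup>2)"
    using U V by (auto simp: gauss_char_def)
  have i: "integrable M U" "integrable M V"
    using sq by (auto intro: square_integrable_imp_integrable)
  note int = covariance_indep(1)[OF U V ind]
  have sq2: "integrable M (\<lambda>\<omega>. (U \<omega> + V \<omega>)\<^sup>2)"
    using sq int by (simp add: power2_sum mult.assoc)
  have cov: "covariance M (\<lambda>\<omega>. U \<omega> + V \<omega>) (\<lambda>\<omega>. U \<omega> + V \<omega>) = covariance M U U + covariance M V V"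
    using i sq int sq2 indep_var_lebesgue_integral[OF ind i]
    by (simp add: covariance_square power2_sum mult.assoc)
  have "(\<integral>\<omega>. iexp (U \<omega> + V \<omega>) \<partial>M) = (\<integral>\<omega>. iexp (U \<omega>) \<partial>M) * (\<integral>\<omega>. iexp (V \<omega>) \<partial>M)"
    using char_distr_add[OF ind, of 1] by (simp add: char_def integral_distr)
  then show ?thesis
    using U V sq2 i unfolding gauss_char_def cov
    by (simp add: exp_add[symmetric] algebra_simps add_divide_distrib)
qed

lemma gauss_char_shift:
  assumes "gauss_char U"
  shows "gauss_char (\<lambda>\<omega>. c + U \<omega>)"
proof -
  have U [measurable]: "U \<in> borel_measurable M" and sq: "integrable M (\<lambda>\<omega>. (U \<omega>)\<^sup>2)"
    using assms by (auto simp: gauss_char_def)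
  have i: "integrable M U" using U sq by (rule square_integrable_imp_integrable)
  have "covariance M (\<lambda>\<omega>. c + U \<omega>) (\<lambda>\<omega>. c + U \<omega>) = covariance M U U"
    using i by (simp add: covariance_def prob_space)
  moreover have "(\<integral>\<omega>. iexp (c + U \<omega>) \<partial>M) = iexp c * (\<integral>\<omega>. iexp (U \<omega>) \<partial>M)"
    unfolding iexp_add by simp
  ultimately show ?thesis
    using assms i sq unfolding gauss_char_def
    by (simp add: power2_sum prob_space exp_add[symmetric] algebra_simps)
qed

end

section \<open>The process and its noise as one Gaussian space\<close>

locale gp =
  fixes M :: "'w measure" and D :: "'a set" and f :: "'a \<Rightarrow> 'w \<Rightarrow> real"
    and \<epsilon> :: "'a \<times> nat \<Rightarrow> 'w \<Rightarrow> real" and \<mu> :: "'a \<Rightarrow> real" and k :: "'a \<Rightarrow> 'a \<Rightarrow> real"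
    and \<rho> :: "'a \<Rightarrow> real"
  assumes model: "gp_model M D f \<epsilon> \<mu> k \<rho>" and \<rho>_pos: "x \<in> D \<Longrightarrow> \<rho> x > 0"
begin

sublocale prob_space M
  using model by (simp add: gp_model_def)

text \<open>Combinations of process values and of noises are kept apart because Gaussianity of the
  total comes from independence of the two groups.\<close>

definition H :: "('w \<Rightarrow> real) set" where
  "H = {\<lambda>\<omega>. c + (P \<omega> + Q \<omega>) | c P Q. P \<in> lincombs D f \<and> Q \<in> lincombs (D \<times> UNIV) \<epsilon>}"

lemma H_I:
  "P \<in> lincombs D f \<Longrightarrow> Q \<in> lincombs (D \<times> UNIV) \<epsilon> \<Longrightarrow> (\<lambda>\<omega>. c + (P \<omega> + Q \<omega>)) \<in> H"
  unfolding H_def by blast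

lemma f_gaussian: "P \<in> lincombs D f \<Longrightarrow> gauss_char P"
  using model unfolding gp_model_def gaussian_process_def lincombs_def
  by (auto intro!: gauss_char_gaussian_rv)

lemma noise_normal: "x \<in> D \<Longrightarrow> distributed M lborel (\<epsilon> (x, j)) (normal_density 0 (\<rho> x))"
  using model unfolding gp_model_def by blast

lemma noise_indep: "indep_vars (\<lambda>_. borel) \<epsilon> (D \<times> UNIV)"
  using model unfolding gp_model_def by blast

lemma noise_gaussian:
  assumes "Q \<in> lincombs (D \<times> UNIV) \<epsilon>"
  shows "gauss_char Q"
proof -
  from assms obtain F c where Q: "Q = (\<lambda>\<omega>. \<Sum>i\<in>F. c i * \<epsilon> i \<omega>)" "finite F" "F \<subseteq> D \<times> UNIV"
    unfolding lincombs_def by auto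
  have "gauss_char (\<lambda>\<omega>. \<Sum>i\<in>F. c i * \<epsilon> i \<omega>)"
    using Q(2,3)
  proof (induction F rule: finite_induct)
    case empty
    then show ?case using gauss_char_gaussian_rv[of "\<lambda>_. 0"] by (auto simp: gaussian_rv_def)
  next
    case (insert i F)
    obtain x j where i: "i = (x, j)" "x \<in> D" using insert.prems by (cases i) auto
    have "gaussian_rv M (\<lambda>\<omega>. 0 + c i * \<epsilon> i \<omega>)"
    proof (cases "c i = 0")
      case True
      then show ?thesis by (auto simp: gaussian_rv_def)
    next
      case False
      note n = normal_density_affine[OF noise_normal[OF i(2), of j] \<rho>_pos[OF i(2)] False, of 0]
      show ?thesis
        unfolding gaussian_rv_def using n distributed_measurable[OF n] False \<rho>_pos[OF i(2)] i(1)
        by (intro conjI disjI2 exI[of _ "0::real"] exI[of _ "\<bar>c i\<bar> * \<rho> x"]) auto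
    qed
    then have 1: "gauss_char (\<lambda>\<omega>. c i * \<epsilon> i \<omega>)" using gauss_char_gaussian_rv by simp
    have "indep_vars (\<lambda>_. borel) (\<lambda>i \<omega>. c i * \<epsilon> i \<omega>) (insert i F)"
      using indep_vars_subset[OF noise_indep insert.prems]
      by (rule indep_vars_compose2) simp
    then have "indep_var borel (\<lambda>\<omega>. c i * \<epsilon> i \<omega>) borel (\<lambda>\<omega>. \<Sum>i\<in>F. c i * \<epsilon> i \<omega>)"
      using insert.hyps by (intro indep_vars_sum)
    from gauss_char_add[OF 1 _ this] show ?case using insert by simp
  qed
  then show ?thesis using Q(1) by simp
qed

lemma f_measurable: "x \<in> D \<Longrightarrow> f x \<in> borel_measurable M"
  using f_gaussian[OF lincombs_base[of x D f]] by (simp add: gauss_char_def)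

lemma noise_measurable: "i \<in> D \<times> UNIV \<Longrightarrow> \<epsilon> i \<in> borel_measurable M"
  using noise_gaussian[OF lincombs_base] by (simp add: gauss_char_def)

lemma indep_f_noise:
  assumes "P \<in> lincombs D f" "Q \<in> lincombs (D \<times> UNIV) \<epsilon>"
  shows "indep_var borel P borel Q"
proof (rule indep_elements_imp_indep_var)
  have ind: "indep_set (sets (gen_algebra M D f)) (sets (gen_algebra M (D \<times> UNIV) \<epsilon>))"
    using model by (simp add: gp_model_def)
  have sp: "space (gen_algebra M D f) = space M" "space (gen_algebra M (D \<times> UNIV) \<epsilon>) = space M"
    by (simp_all add: gen_algebra_def)
  have P: "P \<in> borel_measurable (gen_algebra M D f)"
    using f_measurable by (intro lincombs_measurable[OF assms(1)] measurable_gen_algebra_component rvec_measurable)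
  have Q: "Q \<in> borel_measurable (gen_algebra M (D \<times> UNIV) \<epsilon>)"
    using noise_measurable by (intro lincombs_measurable[OF assms(2)] measurable_gen_algebra_component rvec_measurable)
  show "indep_elements borel P borel Q"
    unfolding indep_elements_def
  proof (intro conjI ballI)
    show "P \<in> borel_measurable M" "Q \<in> borel_measurable M"
      using f_gaussian[OF assms(1)] noise_gaussian[OF assms(2)] by (auto simp: gauss_char_def)
    fix A B :: "real set" assume "A \<in> sets borel" "B \<in> sets borel"
    then have "prob ((P -` A \<inter> space M) \<inter> (Q -` B \<inter> space M)) = prob (P -` A \<inter> space M) * prob (Q -` B \<inter> space M)"
      using measurable_sets[OF P] measurable_sets[OF Q] by (intro indep_setD[OF ind]) (auto simp: sp)
    moreover have "(P -` A \<inter> space M) \<inter> (Q -` B \<inter> space M) = P -` A \<inter> Q -` B \<inter> space M" by auto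
    ultimately show "prob (P -` A \<inter> Q -` B \<inter> space M) = prob (P -` A \<inter> space M) * prob (Q -` B \<inter> space M)"
      by simp
  qed
qed

lemma H_gaussian: "U \<in> H \<Longrightarrow> gauss_char U"
  using gauss_char_shift gauss_char_add f_gaussian noise_gaussian indep_f_noise
  unfolding H_def by fast

sublocale gaussian_space M H
proof
  fix U V :: "'w \<Rightarrow> real" and c :: real
  assume U: "U \<in> H"
  show "U \<in> borel_measurable M" "integrable M (\<lambda>\<omega>. (U \<omega>)\<^sup>2)"
    "(\<integral>\<omega>. iexp (U \<omega>) \<partial>M) = iexp (expectation U) * exp (- of_real (covariance M U U / 2))"
    using H_gaussian[OF U] by (auto simp: gauss_char_def)
  obtain a P Q where U': "U = (\<lambda>\<omega>. a + (P \<omega> + Q \<omega>))" "P \<in> lincombs D f" "Q \<in> lincombs (D \<times> UNIV) \<epsilon>"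
    using U unfolding H_def by auto
  have "(\<lambda>\<omega>. c * U \<omega>) = (\<lambda>\<omega>. c * a + (c * P \<omega> + c * Q \<omega>))"
    by (simp add: U'(1) algebra_simps)
  then show "(\<lambda>\<omega>. c * U \<omega>) \<in> H"
    using H_I[OF lincombs_scale[OF U'(2)] lincombs_scale[OF U'(3)]] by simp
  assume "V \<in> H"
  then obtain b P' Q' where V': "V = (\<lambda>\<omega>. b + (P' \<omega> + Q' \<omega>))" "P' \<in> lincombs D f" "Q' \<in> lincombs (D \<times> UNIV) \<epsilon>"
    unfolding H_def by auto
  have "(\<lambda>\<omega>. U \<omega> + V \<omega>) = (\<lambda>\<omega>. (a + b) + ((P \<omega> + P' \<omega>) + (Q \<omega> + Q' \<omega>)))"
    by (simp add: U'(1) V'(1) algebra_simps)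
  then show "(\<lambda>\<omega>. U \<omega> + V \<omega>) \<in> H"
    using H_I[OF lincombs_add[OF U'(2) V'(2)] lincombs_add[OF U'(3) V'(3)]] by simp
next
  fix c :: real
  show "(\<lambda>_. c) \<in> H"
    using H_I[OF lincombs_zero lincombs_zero, of c] by simp
qed

lemma f_in_H: "x \<in> D \<Longrightarrow> f x \<in> H"
  using H_I[OF lincombs_base lincombs_zero, of x 0] by simp

lemma noise_in_H: "i \<in> D \<times> UNIV \<Longrightarrow> \<epsilon> i \<in> H"
  using H_I[OF lincombs_zero lincombs_base, of i 0] by simp

lemma obs_in_H: "i \<in> D \<times> UNIV \<Longrightarrow> obs f \<epsilon> i \<in> H"
  unfolding obs_def[abs_def] by (auto intro!: H_add f_in_H noise_in_H)

lemma cov_f: "x \<in> D \<Longrightarrow> x' \<in> D \<Longrightarrow> cov (f x) (f x') = k x x'"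
  using model by (simp add: gp_model_def gaussian_process_def)

lemma cov_f_noise: "x \<in> D \<Longrightarrow> i \<in> D \<times> UNIV \<Longrightarrow> cov (f x) (\<epsilon> i) = 0"
  by (intro covariance_indep(2) f_gaussian noise_gaussian lincombs_base indep_f_noise)

lemma cov_noise:
  assumes "i \<in> D \<times> UNIV" "j \<in> D \<times> UNIV" "i \<noteq> j"
  shows "cov (\<epsilon> i) (\<epsilon> j) = 0"
proof (rule covariance_indep(2))
  have "indep_vars (\<lambda>_. borel) \<epsilon> (insert i {j})"
    using assms by (intro indep_vars_subset[OF noise_indep]) auto
  from indep_vars_sum[OF _ _ this] assms(3)
  show "indep_var borel (\<epsilon> i) borel (\<epsilon> j)" by simp
qed (use assms(1,2) in \<open>auto intro!: noise_gaussian lincombs_base\<close>)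

lemma var_noise: "i \<in> D \<times> UNIV \<Longrightarrow> cov (\<epsilon> i) (\<epsilon> i) = (\<rho> (fst i))\<^sup>2"
  using gauss_char_normal(2)[OF noise_normal \<rho>_pos] by auto

end

section \<open>Information gain of one observation\<close>

lemma occs_finite [simp]: "finite (occs X)"
proof -
  have "occs X = (SIGMA x:set_mset X. {..<count X x})"
    by (auto simp: occs_def)
      (metis less_zeroE not_in_iff)
  then show ?thesis by simp
qed

lemma occs_empty [simp]: "occs {#} = {}"
  by (simp add: occs_def)

lemma occs_add_mset: "occs (add_mset z X) = insert (z, count X z) (occs X)"
  by (auto simp: occs_def split: if_splits)

lemma occs_mono: "X \<subseteq># Y \<Longrightarrow> occs X \<subseteq> occs Y"
  unfolding occs_def by (auto dest: mset_subset_eq_count order_less_le_trans)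

lemma occs_fst: "i \<in> occs X \<Longrightarrow> fst i \<in># X"
  unfolding occs_def by (auto simp: count_greater_zero_iff[symmetric] simp del: count_greater_zero_iff)

lemma (in prob_space) has_information_rvec_insert:
  assumes "has_information MF F (borel \<Otimes>\<^sub>M borel_vec J) (\<lambda>x. (y i x, rvec J y x)) r" and "i \<notin> J"
  shows "has_information MF F (borel_vec (insert i J)) (rvec (insert i J) y) r"
proof -
  define g :: "real \<times> ('c \<Rightarrow> real) \<Rightarrow> 'c \<Rightarrow> real"
    where "g = (\<lambda>z. \<lambda>j\<in>insert i J. if j = i then fst z else snd z j)"
  define h :: "('c \<Rightarrow> real) \<Rightarrow> real \<times> ('c \<Rightarrow> real)" where "h = (\<lambda>z. (z i, \<lambda>j\<in>J. z j))"
  have "(\<lambda>z. if j = i then fst z else snd z j) \<in> borel_measurable (borel \<Otimes>\<^sub>M borel_vec J)"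
    if "j \<in> insert i J" for j
    using that \<open>i \<notin> J\<close>
    by (cases "j = i") (auto intro!: measurable_compose[OF measurable_snd measurable_component_singleton])
  then have g: "g \<in> measurable (borel \<Otimes>\<^sub>M borel_vec J) (borel_vec (insert i J))"
    unfolding g_def by (rule measurable_restrict)
  have h: "h \<in> measurable (borel_vec (insert i J)) (borel \<Otimes>\<^sub>M borel_vec J)"
    unfolding h_def by (intro measurable_Pair measurable_restrict measurable_component_singleton) auto
  have "h (g z) = z" if "z \<in> space (borel \<Otimes>\<^sub>M borel_vec J)" for z
    using that \<open>i \<notin> J\<close>
    by (auto simp: h_def g_def space_pair_measure space_PiM PiE_def extensional_def restrict_def fun_eq_iff
        prod_eq_iff)
  with has_information_iso[OF assms(1) g h]
  have "has_information MF F (borel_vec (insert i J)) (\<lambda>x. g (y i x, rvec J y x)) r" by blast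
  moreover have "g (y i x, rvec J y x) = rvec (insert i J) y x" for x
    by (auto simp: g_def rvec_def fun_eq_iff)
  ultimately show ?thesis by simp
qed

section \<open>Variance reduction against information gain\<close>

context gp
begin

abbreviation "Y X \<equiv> obs f \<epsilon> ` occs X"
abbreviation "v x X \<equiv> cvar (f x) (Y X)"
abbreviation "info A X \<equiv> minfo M A f (occs X) (obs f \<epsilon>)"

lemma Y_in_H: "set_mset X \<subseteq> D \<Longrightarrow> Y X \<subseteq> H"
  using occs_fst by (fastforce intro!: obs_in_H simp: mem_Times_iff)

lemma Y_add: "Y (add_mset z X) = insert (obs f \<epsilon> (z, count X z)) (Y X)"
  by (simp add: occs_add_mset)

lemma fA_in_H: "A \<subseteq> D \<Longrightarrow> f ` A \<subseteq> H"
  using f_in_H by auto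

lemma k_nonneg: "x \<in> D \<Longrightarrow> k x x \<ge> 0"
  using cov_self_nonneg[of "f x"] cov_f[of x x] by simp

lemma obs_eq: "obs f \<epsilon> i = (\<lambda>\<omega>. f (fst i) \<omega> + \<epsilon> i \<omega>)"
  by (rule ext) (simp add: obs_def)

lemma cov_obs:
  assumes "i \<in> D \<times> UNIV" "V \<in> H"
  shows "cov (obs f \<epsilon> i) V = cov (f (fst i)) V + cov (\<epsilon> i) V"
  unfolding obs_eq using assms by (intro cov_add f_in_H noise_in_H) auto

text \<open>Noise orthogonal to \<open>W\<close> cannot be predicted from it, so the residual of the
  observation is that of \<open>f\<close> plus the noise. These two are uncorrelated and their
  variances add.\<close>

lemma cvar_fresh:
  assumes W: "finite W" "W \<subseteq> H" and i: "i \<in> D \<times> UNIV" and fresh: "\<And>w. w \<in> W \<Longrightarrow> cov (\<epsilon> i) w = 0"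
  shows "cvar (obs f \<epsilon> i) W = cvar (f (fst i)) W + (\<rho> (fst i))\<^sup>2"
proof -
  have fH: "f (fst i) \<in> H" and eH: "\<epsilon> i \<in> H" and oH: "obs f \<epsilon> i \<in> H"
    using i by (auto intro: f_in_H noise_in_H obs_in_H)
  obtain R where R: "residual (f (fst i)) W R" using residual_exists[OF W fH] by auto
  have RH: "R \<in> H" using W(2) fH R by (rule residual_in_H)
  have "residual (obs f \<epsilon> i) W (\<lambda>\<omega>. R \<omega> + \<epsilon> i \<omega>)"
    unfolding residual_def
  proof (intro conjI ballI)
    obtain L where "L \<in> lspan W" "R = (\<lambda>\<omega>. f (fst i) \<omega> - L \<omega>)"
      using R unfolding residual_def by auto
    then show "\<exists>L\<in>lspan W. (\<lambda>\<omega>. R \<omega> + \<epsilon> i \<omega>) = (\<lambda>\<omega>. obs f \<epsilon> i \<omega> - L \<omega>)"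
      by (intro bexI[of _ L]) (auto simp: obs_def)
    show "cov (\<lambda>\<omega>. R \<omega> + \<epsilon> i \<omega>) w = 0" if "w \<in> W" for w
      using that R fresh[OF that] RH eH W by (subst cov_add) (auto simp: residual_def)
  qed
  then have "cvar (obs f \<epsilon> i) W = cov (\<lambda>\<omega>. R \<omega> - (-1) * \<epsilon> i \<omega>) (\<lambda>\<omega>. R \<omega> - (-1) * \<epsilon> i \<omega>)"
    using cvar_residual[OF W(2) oH] by simp
  also have "\<dots> = cov R R + 2 * cov R (\<epsilon> i) + cov (\<epsilon> i) (\<epsilon> i)"
    by (subst cov_quadratic[OF RH eH]) simp
  also have "cov R (\<epsilon> i) = 0"
    using residual_cov_eq[OF W(2) fH R eH fresh] cov_f_noise[of "fst i" i] i
      covariance_commute[of M R "\<epsilon> i"] covariance_commute[of M "f (fst i)" "\<epsilon> i"]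
    by auto
  finally show ?thesis
    using cvar_residual[OF W(2) fH R] var_noise[OF i] by simp
qed

text \<open>The number \<open>count X z\<close> is the first one that \<open>occs X\<close> does not
  use at \<open>z\<close>, so its noise occurs neither in \<open>f\<close> on \<open>A\<close> nor
  in the past observations.\<close>

lemma noise_uncorrelated:
  assumes "z \<in> D" "set_mset X \<subseteq> D" "A \<subseteq> D" "w \<in> f ` A \<union> Y X"
  shows "cov (\<epsilon> (z, count X z)) w = 0"
  using assms(4)
proof
  assume "w \<in> f ` A"
  then show ?thesis using assms cov_f_noise by (auto simp: covariance_commute)
next
  assume "w \<in> Y X"
  then obtain i where i: "i \<in> occs X" "w = obs f \<epsilon> i" by auto
  have iD: "i \<in> D \<times> UNIV" using occs_fst[OF i(1)] assms(2) by (cases i) auto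
  have "i \<noteq> (z, count X z)" using i(1) by (auto simp: occs_def)
  then have "cov (\<epsilon> i) (\<epsilon> (z, count X z)) = 0" using iD assms(1) by (intro cov_noise) auto
  moreover have "cov (f (fst i)) (\<epsilon> (z, count X z)) = 0" using iD assms(1) by (intro cov_f_noise) auto
  ultimately show ?thesis
    unfolding i(2) covariance_commute[of M "\<epsilon> (z, count X z)"]
    using iD assms(1) by (subst cov_obs) (auto intro: noise_in_H)
qed

text \<open>Serves both variances that enter the gain: taking \<open>A = {}\<close> gives the one
  without knowledge of \<open>f\<^sub>A\<close>.\<close>

lemma cvar_obs:
  assumes "z \<in> D" "set_mset X \<subseteq> D" "A \<subseteq> D" "finite A"
  shows "cvar (obs f \<epsilon> (z, count X z)) (f ` A \<union> Y X) = cvar (f z) (f ` A \<union> Y X) + (\<rho> z)\<^sup>2"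
  using cvar_fresh[of "f ` A \<union> Y X" "(z, count X z)"] noise_uncorrelated[OF assms(1-3)]
    Y_in_H[OF assms(2)] fA_in_H[OF assms(3)] assms by auto

text \<open>
  Numerator and denominator are the conditional variances of a fresh observation at \<open>z\<close> given the
  past observations, without and with \<open>f\<^sub>A\<close>.
\<close>

definition gain :: "'a set \<Rightarrow> 'a multiset \<Rightarrow> 'a \<Rightarrow> real" where
  "gain A X z = ln ((v z X + (\<rho> z)\<^sup>2) / (cvar (f z) (f ` A \<union> Y X) + (\<rho> z)\<^sup>2)) / 2"

context
  fixes A :: "'a set"
  assumes A: "finite A" "A \<subseteq> D"
begin

lemma has_information_gain:
  assumes X: "set_mset X \<subseteq> D" and z: "z \<in> D"
    and i: "has_information (borel_vec A) (rvec A f) (borel_vec (occs X)) (rvec (occs X) (obs f \<epsilon>)) i"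
  shows "has_information (borel_vec A) (rvec A f) (borel \<Otimes>\<^sub>M borel_vec (occs X))
    (\<lambda>\<omega>. (obs f \<epsilon> (z, count X z) \<omega>, rvec (occs X) (obs f \<epsilon>) \<omega>)) (i + gain A X z)"
proof -
  have "cvar (obs f \<epsilon> (z, count X z)) (Y X) = v z X + (\<rho> z)\<^sup>2"
    using cvar_obs[OF z X, of "{}"] by simp
  moreover have "0 < cvar (f z) (f ` A \<union> Y X) + (\<rho> z)\<^sup>2"
    using cvar_nonneg[of "f z" "f ` A \<union> Y X"] \<rho>_pos[OF z] by (intro add_nonneg_pos) auto
  ultimately show ?thesis
    using has_information_step[OF A(1) fA_in_H[OF A(2)] _ Y_in_H[OF X] obs_in_H[of "(z, count X z)"] i]
      z cvar_obs[OF z X A(2,1)]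
    by (simp add: gain_def)
qed

text \<open>Induction over the observations yields some value together with its density; uniqueness
  of the value identifies it with \<open>info A X\<close>.\<close>

lemma has_information_info:
  assumes "set_mset X \<subseteq> D"
  shows "has_information (borel_vec A) (rvec A f) (borel_vec (occs X)) (rvec (occs X) (obs f \<epsilon>)) (info A X)"
proof -
  have "\<exists>i. has_information (borel_vec A) (rvec A f) (borel_vec (occs X)) (rvec (occs X) (obs f \<epsilon>)) i"
    using assms
  proof (induction X)
    case empty
    have "rvec A f \<in> measurable M (borel_vec A)" using f_measurable A by (intro rvec_measurable) auto
    from has_information_trivial[OF this, of "\<lambda>_. undefined" "borel_vec {}"]
    show ?case by (auto simp: rvec_def space_PiM restrict_def)
  next
    case (add z X)
    then obtain i where i: "has_information (borel_vec A) (rvec A f) (borel_vec (occs X)) (rvec (occs X) (obs f \<epsilon>)) i"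
      by auto
    have "set_mset X \<subseteq> D" "z \<in> D" using add.prems by auto
    from has_information_gain[OF this i]
    have "has_information (borel_vec A) (rvec A f) (borel_vec (occs (add_mset z X)))
        (rvec (occs (add_mset z X)) (obs f \<epsilon>)) (i + gain A X z)"
      unfolding occs_add_mset by (rule has_information_rvec_insert) (simp add: occs_def)
    then show ?case by blast
  qed
  then obtain i where i: "has_information (borel_vec A) (rvec A f) (borel_vec (occs X)) (rvec (occs X) (obs f \<epsilon>)) i"
    by blast
  from has_information_imp_mutual_information[OF i] i show ?thesis
    by (simp add: minfo_def)
qed

lemma info_empty: "info A {#} = 0"
proof -
  have "rvec A f \<in> measurable M (borel_vec A)" using f_measurable A by (intro rvec_measurable) auto
  from has_information_trivial[OF this, of "\<lambda>_. undefined" "borel_vec {}"]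
  have "has_information (borel_vec A) (rvec A f) (borel_vec {}) (rvec {} (obs f \<epsilon>)) 0"
    by (auto simp: rvec_def space_PiM restrict_def)
  then show ?thesis
    unfolding minfo_def using has_information_imp_mutual_information by auto
qed

text \<open>Conditional mutual information is a difference of two mutual informations, so both
  claims are the chain rule. Together they show that ITL maximises the increments of
  \<open>info A\<close> greedily.\<close>

lemma info_add:
  assumes "set_mset X \<subseteq> D" "z \<in> D"
  shows "info A (add_mset z X) = info A X + gain A X z"
    and "cond_minfo M A f (obs f \<epsilon> (z, count X z)) (occs X) (obs f \<epsilon>) = gain A X z"
proof -
  note i = has_information_gain[OF assms has_information_info[OF assms(1)]]
  have "(z, count X z) \<notin> occs X" by (simp add: occs_def)
  from has_information_imp_mutual_information[OF has_information_rvec_insert[OF i this]]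
  show "info A (add_mset z X) = info A X + gain A X z"
    unfolding minfo_def by (simp add: occs_add_mset)
  show "cond_minfo M A f (obs f \<epsilon> (z, count X z)) (occs X) (obs f \<epsilon>) = gain A X z"
    unfolding cond_minfo_def conditional_mutual_information_def
    using has_information_imp_mutual_information[OF i] by (simp add: minfo_def)
qed

lemma ln_quotient_ge:
  assumes "0 < (t::real)" "t \<le> s"
  shows "(s - t) / s \<le> ln (s / t)"
proof -
  have "ln (t / s) \<le> t / s - 1" using assms by (intro ln_le_minus_one) auto
  moreover have "ln (s / t) = - ln (t / s)" using assms by (simp add: ln_div)
  moreover have "(s - t) / s = 1 - t / s" using assms by (simp add: field_simps)
  ultimately show ?thesis by simp
qed

text \<open>Linearises the logarithm, so that gains can be compared with differences of
  variances.\<close>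

lemma gain_ge:
  assumes X: "set_mset X \<subseteq> D" and z: "z \<in> D"
  defines "s \<equiv> v z X + (\<rho> z)\<^sup>2"
  shows "(s - (cvar (f z) (f ` A \<union> Y X) + (\<rho> z)\<^sup>2)) / s / 2 \<le> gain A X z"
proof -
  have "0 < cvar (f z) (f ` A \<union> Y X) + (\<rho> z)\<^sup>2"
    using cvar_nonneg[of "f z" "f ` A \<union> Y X"] \<rho>_pos[OF z] by (intro add_nonneg_pos) auto
  moreover have "cvar (f z) (f ` A \<union> Y X) \<le> v z X"
    using A by (intro cvar_mono) auto
  ultimately show ?thesis
    unfolding gain_def s_def by (intro divide_right_mono ln_quotient_ge) auto
qed

lemma gain_nonneg:
  assumes X: "set_mset X \<subseteq> D" and z: "z \<in> D"
  shows "0 \<le> gain A X z"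
proof -
  have "cvar (f z) (f ` A \<union> Y X) \<le> v z X"
    using A by (intro cvar_mono) auto
  moreover have "0 \<le> v z X + (\<rho> z)\<^sup>2" using cvar_nonneg[of "f z" "Y X"] by simp
  ultimately have "0 \<le> (v z X + (\<rho> z)\<^sup>2 - (cvar (f z) (f ` A \<union> Y X) + (\<rho> z)\<^sup>2)) / (v z X + (\<rho> z)\<^sup>2) / 2"
    by (intro divide_nonneg_nonneg) auto
  then show ?thesis using gain_ge[OF assms] by linarith
qed

text \<open>If \<open>c\<close> is the conditional covariance of \<open>f a\<close> and the new
  observation, of conditional variance \<open>s\<close>, then observing lowers the variance of
  \<open>f a\<close> by \<open>c\<^sup>2 / s\<close>, and revealing \<open>f a\<close> would lower
  that of the observation by \<open>c\<^sup>2 / v a X\<close>. Revealing all of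
  \<open>f\<^sub>A\<close> lowers it at least as much, and this drop divided by \<open>s\<close> is
  at most twice the gain.\<close>

lemma reduction_le_gain:
  assumes X: "set_mset X \<subseteq> D" and z: "z \<in> D" and a: "a \<in> A"
  shows "v a X - v a (add_mset z X) \<le> 2 * k a a * gain A X z"
proof -
  let ?y = "obs f \<epsilon> (z, count X z)"
  have aD: "a \<in> D" using a A by auto
  have fin: "finite (Y X)" by simp
  obtain c where c: "cvar (f a) (insert ?y (Y X)) = v a X - c\<^sup>2 / cvar ?y (Y X)"
    "cvar ?y (insert (f a) (Y X)) = cvar ?y (Y X) - c\<^sup>2 / v a X"
    using cvar_exchange[OF fin Y_in_H[OF X] f_in_H[OF aD] obs_in_H[of "(z, count X z)"]] z by auto
  define s where "s = v z X + (\<rho> z)\<^sup>2"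
  have s: "cvar ?y (Y X) = s" using cvar_obs[OF z X, of "{}"] by (simp add: s_def)
  have "s > 0" unfolding s_def
    using cvar_nonneg[of "f z" "Y X"] \<rho>_pos[OF z] by (intro add_nonneg_pos) auto
  have va: "v a X \<le> k a a" using cvar_le_cov[of "f a" "Y X"] cov_f[OF aD aD] by simp
  have va0: "0 \<le> v a X" by (rule cvar_nonneg)
  have g0: "0 \<le> gain A X z" using X z by (rule gain_nonneg)
  have "v a X - v a (add_mset z X) \<le> 2 * v a X * gain A X z"
  proof (cases "v a X = 0")
    case True
    then show ?thesis using cvar_nonneg[of "f a" "Y (add_mset z X)"] by simp
  next
    case False
    with va0 have pos: "v a X > 0" by simp
    have "cvar ?y (f ` A \<union> Y X) \<le> cvar ?y (insert (f a) (Y X))"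
      using A a by (intro cvar_mono) auto
    then have "c\<^sup>2 / v a X \<le> s - (cvar (f z) (f ` A \<union> Y X) + (\<rho> z)\<^sup>2)"
      using c(2) cvar_obs[OF z X A(2,1)] by (simp add: s)
    then have "c\<^sup>2 / v a X / s / 2 \<le> (s - (cvar (f z) (f ` A \<union> Y X) + (\<rho> z)\<^sup>2)) / s / 2"
      using \<open>s > 0\<close> by (intro divide_right_mono) auto
    also have "\<dots> \<le> gain A X z" unfolding s_def by (rule gain_ge[OF X z])
    finally have "c\<^sup>2 / s \<le> 2 * v a X * gain A X z"
      using pos \<open>s > 0\<close> by (simp add: field_simps)
    then show ?thesis using c(1) by (simp add: s Y_add del: image_insert)
  qed
  also have "\<dots> \<le> 2 * k a a * gain A X z"
    using va g0 by (intro mult_right_mono) auto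
  finally show ?thesis .
qed

text \<open>Here \<open>f z\<close> is itself a target, so once \<open>f\<^sub>A\<close> is known
  only noise remains in the observation: all of \<open>v z X\<close> counts as information.\<close>

lemma variance_le_gain:
  assumes X: "set_mset X \<subseteq> D" and z: "z \<in> A"
  shows "v z X \<le> 2 * (k z z + (\<rho> z)\<^sup>2) * gain A X z"
proof -
  have zD: "z \<in> D" using z A by auto
  define s where "s = v z X + (\<rho> z)\<^sup>2"
  have "s > 0" unfolding s_def
    using cvar_nonneg[of "f z" "Y X"] \<rho>_pos[OF zD] by (intro add_nonneg_pos) auto
  have "v z X / s / 2 \<le> gain A X z"
    using gain_ge[OF X zD] cvar_member[of "f ` A \<union> Y X" "f z"] A z by (simp add: s_def)
  then have "v z X \<le> 2 * s * gain A X z" using \<open>s > 0\<close> by (simp add: field_simps)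
  also have "\<dots> \<le> 2 * (k z z + (\<rho> z)\<^sup>2) * gain A X z"
    using cvar_le_cov[of "f z" "Y X"] cov_f[OF zD zD] gain_nonneg[OF X zD]
    by (intro mult_right_mono) (auto simp: s_def)
  finally show ?thesis .
qed

text \<open>Provides the positive lower bound of the capacity, in terms of \<open>k\<close> and
  \<open>\<rho>\<close> only. A single observation at a point correlated with a target reduces the
  variance of that target by an explicit amount, which \<open>reduction_le_gain\<close> turns into
  information.\<close>

lemma first_gain_ge:
  assumes a: "a \<in> A" and z: "z \<in> D" and k: "k a z \<noteq> 0"
  shows "k a a > 0" and "(k a z)\<^sup>2 / (k z z + (\<rho> z)\<^sup>2) / (2 * k a a) \<le> info A {#z#}"
proof -
  let ?y = "obs f \<epsilon> (z, 0)"
  have aD: "a \<in> D" using a A by auto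
  have fH: "f a \<in> H" "f z \<in> H" "?y \<in> H" using aD z by (auto intro: f_in_H obs_in_H)
  show pos: "k a a > 0"
    using k_nonneg[OF aD] cov_zero_if_null[OF fH(2,1)] cov_f[OF aD aD] cov_f[OF aD z] k
      covariance_commute[of M "f z" "f a"]
    by (auto simp: order_less_le)
  have res: "residual V {} V" for V
    by (auto simp: residual_def intro!: bexI[OF _ lspan_zero])
  have "cov (f a) ?y = k a z"
    using cov_obs[of "(z, 0)" "f a"] fH aD z cov_f[OF aD z] cov_f_noise[OF aD, of "(z, 0)"]
      covariance_commute[of M "f a" ?y] covariance_commute[of M "f a" "f z"]
      covariance_commute[of M "f a" "\<epsilon> (z, 0)"]
    by simp
  moreover have "cvar ?y {} = k z z + (\<rho> z)\<^sup>2"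
    using cvar_obs[of z "{#}" "{}"] z cvar_residual[OF _ fH(2) res] cov_f[OF z z] by simp
  ultimately have "v a {#z#} = v a {#} - (k a z)\<^sup>2 / (k z z + (\<rho> z)\<^sup>2)"
    using cvar_insert[OF _ _ fH(1,3) res res] by (simp add: occs_add_mset)
  then have "(k a z)\<^sup>2 / (k z z + (\<rho> z)\<^sup>2) \<le> 2 * k a a * gain A {#} z"
    using reduction_le_gain[of "{#}" z a] a z by simp
  also have "gain A {#} z = info A {#z#}"
    using info_add(1)[of "{#}" z] z info_empty by simp
  finally show "(k a z)\<^sup>2 / (k z z + (\<rho> z)\<^sup>2) / (2 * k a a) \<le> info A {#z#}"
    using pos by (simp only: pos_divide_le_eq) (simp add: mult.commute)
qed

end

end

section \<open>Submodularity and greedy selection\<close>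

lemma sampled_0 [simp]: "sampled p 0 = {#}"
  by (simp add: sampled_def)

lemma sampled_Suc: "sampled p (Suc n) = add_mset (p (Suc n)) (sampled p n)"
proof -
  have "{1..Suc n} = insert (Suc n) {1..n}" by auto
  then show ?thesis by (simp add: sampled_def)
qed

lemma sampled_mono: "i \<le> n \<Longrightarrow> sampled p i \<subseteq># sampled p n"
  by (induction n) (auto simp: sampled_Suc le_Suc_eq intro: subset_mset.order_trans)

lemma size_sampled: "size (sampled p n) = n"
  by (simp add: sampled_def)

lemma set_sampled: "(\<And>i. i \<ge> 1 \<Longrightarrow> p i \<in> S) \<Longrightarrow> set_mset (sampled p n) \<subseteq> S"
  by (auto simp: sampled_def)

text \<open>The deterministic counterpart of \<open>submodular\<close>; both uncertainty reductions
  are almost surely constant.\<close>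

definition submod :: "'a set \<Rightarrow> ('a multiset \<Rightarrow> real) \<Rightarrow> bool" where
  "submod S \<phi> \<longleftrightarrow> (\<forall>x\<in>S. \<forall>X' X. X' \<subseteq># X \<longrightarrow> set_mset X \<subseteq> S \<longrightarrow>
     \<phi> (add_mset x X) - \<phi> X \<le> \<phi> (add_mset x X') - \<phi> X')"

text \<open>The batch is added point by point, and each increment is at most the increment of the
  same point directly after \<open>X\<close>.\<close>

lemma submod_batch:
  assumes sub: "submod S \<phi>" and X: "set_mset X \<subseteq> S" and B: "set_mset B \<subseteq> S"
    and G: "\<And>x. x \<in> S \<Longrightarrow> \<phi> (add_mset x X) - \<phi> X \<le> G"
  shows "\<phi> (X + B) - \<phi> X \<le> real (size B) * G"
  using B
proof (induction B)
  case (add b B)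
  have "\<phi> (add_mset b (X + B)) - \<phi> (X + B) \<le> \<phi> (add_mset b X) - \<phi> X"
    using sub X add.prems unfolding submod_def by auto
  also have "\<dots> \<le> G" using G add.prems by simp
  finally show ?case using add by (simp add: algebra_simps)
qed simp

text \<open>The increment of \<open>x\<close> after \<open>n\<close> rounds is at most its increment
  in every earlier round, which the greedy choice of that round matches or exceeds. The greedy
  increments telescope.\<close>

lemma submod_greedy:
  assumes sub: "submod S \<phi>" and p: "\<And>i. i \<ge> 1 \<Longrightarrow> p i \<in> S"
    and greedy: "\<And>i x. x \<in> S \<Longrightarrow> \<phi> (add_mset x (sampled p i)) \<le> \<phi> (sampled p (Suc i))"
    and x: "x \<in> S"
  shows "real n * (\<phi> (add_mset x (sampled p n)) - \<phi> (sampled p n)) \<le> \<phi> (sampled p n) - \<phi> {#}"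
proof -
  let ?d = "\<phi> (add_mset x (sampled p n)) - \<phi> (sampled p n)"
  have "?d \<le> \<phi> (sampled p (Suc i)) - \<phi> (sampled p i)" if "i < n" for i
  proof -
    have "?d \<le> \<phi> (add_mset x (sampled p i)) - \<phi> (sampled p i)"
      using sub x sampled_mono[of i n p] that set_sampled[OF p] unfolding submod_def by auto
    then show ?thesis using greedy[OF x, of i] by simp
  qed
  then have "(\<Sum>i<n. ?d) \<le> (\<Sum>i<n. \<phi> (sampled p (Suc i)) - \<phi> (sampled p i))"
    by (intro sum_mono) auto
  also have "\<dots> = \<phi> (sampled p n) - \<phi> {#}"
    by (subst sum_lessThan_telescope) simp
  finally show ?thesis by simp
qed

text \<open>A discrete form of the differential inequality \<open>e' \<le> - c e\<^sup>2\<close>, whose solutions decay like \<open>1 / (c t)\<close>.\<close>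

lemma quadratic_decay:
  fixes e :: "nat \<Rightarrow> real"
  assumes nn: "\<And>n. 0 \<le> e n" and c: "0 \<le> c" and dec: "\<And>n. c * (e n)\<^sup>2 \<le> e n - e (Suc n)"
  shows "c * real n * e n \<le> 1"
proof (induction n)
  case (Suc n)
  have mono: "e (Suc n) \<le> e n"
    using dec[of n] c by (smt (verit) mult_nonneg_nonneg zero_le_power2)
  show ?case
  proof (cases "e (Suc n) = 0")
    case False
    then have pos: "0 < e (Suc n)" "0 < e n" using nn[of "Suc n"] mono by auto
    have "c * e n * e (Suc n) \<le> c * e n * e n"
      using mono c pos by (intro mult_left_mono) auto
    also have "\<dots> \<le> e n - e (Suc n)" using dec[of n] by (simp add: power2_eq_square)
    finally have 1: "c * e n * e (Suc n) \<le> e n - e (Suc n)" .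
    have "c * real n * e n * e (Suc n) \<le> 1 * e (Suc n)"
      using Suc.IH pos by (intro mult_right_mono) auto
    \<comment> \<open>Adding the two inequalities cancels the terms \<open>e (Suc n)\<close>; one
      factor \<open>e n\<close> is then divided out.\<close>
    with 1 have "e n * (c * real (Suc n) * e (Suc n)) \<le> e n * 1"
      by (simp add: algebra_simps)
    then show ?thesis using pos by (simp only: mult_le_cancel_left_pos)
  qed simp
qed simp

lemma finite_multisets_upto:
  assumes "finite S"
  shows "finite (multisets_upto S n)"
proof (rule finite_subset)
  show "multisets_upto S n \<subseteq> mset ` {xs. set xs \<subseteq> S \<and> length xs \<le> n}"
  proof
    fix X assume X: "X \<in> multisets_upto S n"
    obtain xs where "mset xs = X" using ex_mset by blast
    then show "X \<in> mset ` {xs. set xs \<subseteq> S \<and> length xs \<le> n}"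
      using X by (auto simp: multisets_upto_def)
  qed
  show "finite (mset ` {xs. set xs \<subseteq> S \<and> length xs \<le> n})"
    using finite_lists_length_le[OF assms] by simp
qed

section \<open>Batches of repeated observations\<close>

definition copies :: "'a set \<Rightarrow> nat \<Rightarrow> 'a multiset" where
  "copies S m = (\<Sum>s\<in>S. replicate_mset m s)"

lemma count_copies: "finite S \<Longrightarrow> count (copies S m) x = (if x \<in> S then m else 0)"
  unfolding copies_def count_sum by (simp add: sum.delta' if_distrib cong: if_cong)

lemma size_copies: "size (copies S m) = card S * m"
  unfolding copies_def by (simp add: size_multiset_sum)

lemma set_copies: "finite S \<Longrightarrow> set_mset (copies S m) \<subseteq> S"
  by (auto simp: count_greater_zero_iff[symmetric] count_copies simp del: count_greater_zero_iff split: if_splits)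

lemma sum_fst_times: "(\<Sum>i\<in>S \<times> {..<m}. g (fst i)) = real m * (\<Sum>s\<in>S. g s)"
proof -
  have "(\<Sum>i\<in>S \<times> {..<m}. g (fst i)) = (\<Sum>(s, j)\<in>S \<times> {..<m}. g s)"
    by (simp add: split_beta)
  also have "\<dots> = (\<Sum>s\<in>S. \<Sum>j<m. g s)" by (rule sum.cartesian_product[symmetric])
  finally show ?thesis by (simp add: sum_distrib_left)
qed

text \<open>Turns almost sure relations between constants, such as the conditional variances of this
  model, into plain statements.\<close>

lemma AE_const_prob: "prob_space M \<Longrightarrow> (AE \<omega> in M. P) \<Longrightarrow> P"
  by (metis AE_E2 prob_space.AE_False eventually_mono)

context gp
begin

abbreviation (input) "\<eta> x S \<equiv> cvar (f x) (f ` S)"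

context
  fixes S :: "'a set"
  assumes S: "finite S" "S \<subseteq> D"
begin

lemma capacity_ge: "set_mset X \<subseteq> S \<Longrightarrow> size X \<le> n \<Longrightarrow> info A X \<le> capacity M f \<epsilon> A S n"
  unfolding capacity_def
  by (intro Max_ge finite_imageI finite_multisets_upto S(1)) (auto simp: multisets_upto_def)

text \<open>The best predictor of \<open>f a\<close> from \<open>f\<^sub>S\<close> supplies a
  solution even if the matrix is singular. The equations involve \<open>k\<close> only, so one
  solution can be fixed for all models with this kernel.\<close>

lemma normal_equations_solvable:
  assumes a: "a \<in> D"
  shows "\<exists>\<beta>. \<forall>s'\<in>S. (\<Sum>s\<in>S. \<beta> s * k s s') = k a s'"
proof -
  have fS: "finite (f ` S)" "f ` S \<subseteq> H" using S fA_in_H by auto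
  obtain R where R: "residual (f a) (f ` S) R" using residual_exists[OF fS f_in_H[OF a]] by auto
  obtain b where b: "R = (\<lambda>\<omega>. f a \<omega> - (\<Sum>w\<in>f ` S. b w * w \<omega>))"
    using R unfolding residual_def lspan_def by auto
  \<comment> \<open>The predictor has one coefficient per function in the image of \<open>S\<close>,
    while \<open>\<beta>\<close> has one per point. Where \<open>f\<close> takes the same function
    at several points, \<open>T\<close> selects one of them and the others get coefficient
    0.\<close>
  define T where "T = inv_into S f ` f ` S"
  have TS: "T \<subseteq> S" unfolding T_def by (auto intro: inv_into_into)
  define \<beta> where "\<beta> s = (if s \<in> T then b (f s) else 0)" for s
  have "(\<Sum>s\<in>S. \<beta> s * k s s') = k a s'" if s': "s' \<in> S" for s'
  proof -
    have s'D: "s' \<in> D" using s' S by auto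
    have "(\<Sum>s\<in>S. \<beta> s * k s s') = (\<Sum>s\<in>T. b (f s) * cov (f s) (f s'))"
      using TS S s'D by (intro sum.mono_neutral_cong_right) (auto simp: \<beta>_def cov_f)
    also have "\<dots> = (\<Sum>w\<in>f ` S. b w * cov w (f s'))"
      unfolding T_def by (subst sum.reindex) (auto simp: inj_on_inv_into f_inv_into_f intro!: sum.cong)
    also have "\<dots> = cov (\<lambda>\<omega>. \<Sum>w\<in>f ` S. b w * w \<omega>) (f s')"
      using fS f_in_H[OF s'D] by (subst cov_sum) (auto intro!: H_scale sum.cong cov_scale[symmetric])
    also have "\<dots> = cov (f a) (f s') - cov R (f s')"
      unfolding b using fS f_in_H[OF s'D] f_in_H[OF a] by (subst cov_diff) (auto intro!: H_sum H_scale)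
    also have "\<dots> = k a s'"
      using R s' cov_f[OF a s'D] by (simp add: residual_def)
    finally show ?thesis .
  qed
  then show ?thesis by blast
qed

context
  fixes a :: 'a and \<beta> :: "'a \<Rightarrow> real"
  assumes a: "a \<in> D" and \<beta>: "\<And>s'. s' \<in> S \<Longrightarrow> (\<Sum>s\<in>S. \<beta> s * k s s') = k a s'"
begin

definition "R0 = (\<lambda>\<omega>. f a \<omega> - (\<Sum>s\<in>S. \<beta> s * f s \<omega>))"

lemma R0_in_H: "R0 \<in> H"
  unfolding R0_def using S a by (auto intro!: H_diff H_sum H_scale f_in_H)

lemma cov_R0:
  assumes "U \<in> H"
  shows "cov R0 U = cov (f a) U - (\<Sum>s\<in>S. \<beta> s * cov (f s) U)"
proof -
  have fH: "f s \<in> H" if "s \<in> S" for s using that S by (auto intro: f_in_H)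
  have "cov (\<lambda>\<omega>. \<Sum>s\<in>S. \<beta> s * f s \<omega>) U = (\<Sum>s\<in>S. \<beta> s * cov (f s) U)"
    using fH assms by (subst cov_sum) (auto intro!: H_scale sum.cong cov_scale)
  then show ?thesis
    unfolding R0_def using fH assms f_in_H[OF a] by (subst cov_diff) (auto intro!: H_sum H_scale)
qed

lemma cov_R0_f: "s \<in> S \<Longrightarrow> cov R0 (f s) = 0"
  using S a \<beta>[of s] by (subst cov_R0) (auto simp: cov_f f_in_H subset_iff)

lemma cov_R0_noise: "i \<in> D \<times> UNIV \<Longrightarrow> cov R0 (\<epsilon> i) = 0"
  using S a by (subst cov_R0) (auto simp: cov_f_noise subset_iff intro!: noise_in_H sum.neutral)

text \<open>Once \<open>f\<^sub>S\<close> is known, observations in \<open>S\<close> add only noise,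
  which is uncorrelated with \<open>R0\<close>. Hence they do not improve the prediction, and no
  posterior variance falls below the irreducible one.\<close>

lemma residual_R0:
  assumes X: "set_mset X \<subseteq> S"
  shows "residual (f a) (f ` S \<union> Y X) R0"
  unfolding residual_def
proof (intro conjI ballI)
  have "f s \<in> lspan (f ` S \<union> Y X)" if "s \<in> S" for s
    using that S by (intro lspan_base) auto
  then have "(\<lambda>\<omega>. \<Sum>s\<in>S. \<beta> s * f s \<omega>) \<in> lspan (f ` S \<union> Y X)"
    by (intro lspan_sum lspan_scale)
  then show "\<exists>L\<in>lspan (f ` S \<union> Y X). R0 = (\<lambda>\<omega>. f a \<omega> - L \<omega>)"
    unfolding R0_def by (intro bexI[where x = "\<lambda>\<omega>. \<Sum>s\<in>S. \<beta> s * f s \<omega>"]) auto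
  fix w assume "w \<in> f ` S \<union> Y X"
  then show "cov R0 w = 0"
  proof
    assume "w \<in> f ` S"
    then show ?thesis using cov_R0_f by auto
  next
    assume "w \<in> Y X"
    then obtain i where i: "i \<in> occs X" "w = obs f \<epsilon> i" by auto
    have "fst i \<in> S" using occs_fst[OF i(1)] X by auto
    then show ?thesis
      unfolding i(2) using S cov_obs[of i R0] R0_in_H cov_R0_f[of "fst i"] cov_R0_noise[of i]
        covariance_commute[of M R0 "obs f \<epsilon> i"] covariance_commute[of M R0 "f (fst i)"]
        covariance_commute[of M R0 "\<epsilon> i"]
      by (cases i) auto
  qed
qed

lemma irreducible_eq: "set_mset X \<subseteq> S \<Longrightarrow> cvar (f a) (f ` S \<union> Y X) = cov R0 R0"
  using residual_R0 S Y_in_H[of X] fA_in_H[of S] f_in_H[OF a] by (intro cvar_residual) auto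

lemma irreducible_eq': "\<eta> a S = cov R0 R0"
  using irreducible_eq[of "{#}"] by simp

lemma irreducible_le: "set_mset X \<subseteq> S \<Longrightarrow> \<eta> a S \<le> v a X"
  unfolding irreducible_eq' irreducible_eq[symmetric] using S by (intro cvar_mono) auto

text \<open>
  The empirical mean of \<open>m\<close> observations at \<open>s\<close> is \<open>f s\<close> up to an error of variance
  \<open>(\<rho> s)\<^sup>2 / m\<close>, so that plugging it into the best predictor from \<open>f\<^sub>S\<close> gives a good predictor.
\<close>

lemma copies_variance_le:
  assumes m: "m \<ge> 1"
  shows "v a (copies S m) \<le> \<eta> a S + (\<Sum>s\<in>S. (\<beta> s)\<^sup>2 * (\<rho> s)\<^sup>2) / real m"
proof -
  let ?I = "S \<times> {..<m}"
  let ?B = "copies S m"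
  have occ: "occs ?B = ?I" using S(1) by (auto simp: occs_def count_copies split: if_splits)
  have ID: "i \<in> D \<times> UNIV" if "i \<in> ?I" for i using that S(2) by auto
  define b where "b i = \<beta> (fst i) / real m" for i :: "'a \<times> nat"
  define N where "N = (\<lambda>\<omega>. \<Sum>i\<in>?I. b i * \<epsilon> i \<omega>)"
  have NH: "N \<in> H" unfolding N_def using ID by (auto intro!: H_sum H_scale noise_in_H)
  have "obs f \<epsilon> i \<in> lspan (Y ?B)" if "i \<in> ?I" for i
    using that unfolding occ[symmetric] by (intro lspan_base finite_imageI occs_finite imageI)
  then have L: "(\<lambda>\<omega>. \<Sum>i\<in>?I. b i * obs f \<epsilon> i \<omega>) \<in> lspan (Y ?B)"
    by (intro lspan_sum lspan_scale)
  \<comment> \<open>The prediction error splits into \<open>R0\<close> and the averaged noise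
    \<open>N\<close>, which are uncorrelated. The \<open>m\<close> noises at \<open>s\<close> have
    weight \<open>\<beta> s / m\<close> each, which leaves a factor \<open>1 / m\<close> in the
    variance.\<close>
  have eq: "(\<lambda>\<omega>. f a \<omega> - (\<Sum>i\<in>?I. b i * obs f \<epsilon> i \<omega>)) = (\<lambda>\<omega>. R0 \<omega> - 1 * N \<omega>)"
  proof
    fix \<omega>
    have "(\<Sum>i\<in>?I. b i * f (fst i) \<omega>) = (\<Sum>s\<in>S. \<beta> s * f s \<omega>)"
      using m sum_fst_times[of "\<lambda>s. \<beta> s / real m * f s \<omega>" S m]
      by (simp add: b_def sum_distrib_left)
    then show "f a \<omega> - (\<Sum>i\<in>?I. b i * obs f \<epsilon> i \<omega>) = R0 \<omega> - 1 * N \<omega>"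
      by (simp add: R0_def N_def obs_def distrib_left sum.distrib)
  qed
  have "v a ?B \<le> cov (\<lambda>\<omega>. R0 \<omega> - 1 * N \<omega>) (\<lambda>\<omega>. R0 \<omega> - 1 * N \<omega>)"
    using cvar_le[OF L, of "f a"] unfolding eq .
  also have "\<dots> = cov R0 R0 - 2 * cov R0 N + cov N N"
    by (subst cov_quadratic[OF R0_in_H NH]) simp
  also have "cov R0 N = 0"
  proof -
    have "cov N R0 = (\<Sum>i\<in>?I. b i * cov (\<epsilon> i) R0)"
      unfolding N_def using ID R0_in_H
      by (subst cov_sum) (auto intro!: H_scale noise_in_H sum.cong cov_scale)
    also have "\<dots> = 0"
    proof (intro sum.neutral ballI)
      fix i assume "i \<in> ?I"
      then show "b i * cov (\<epsilon> i) R0 = 0"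
        using cov_R0_noise[OF ID] covariance_commute[of M R0 "\<epsilon> i"] by simp
    qed
    finally show ?thesis using covariance_commute[of M R0 N] by simp
  qed
  also have "cov N N = (\<Sum>i\<in>?I. (b i)\<^sup>2 * (\<rho> (fst i))\<^sup>2)"
  proof -
    have 1: "cov N U = (\<Sum>i\<in>?I. b i * cov (\<epsilon> i) U)" if "U \<in> H" for U
      unfolding N_def using ID that
      by (subst cov_sum) (auto intro!: H_scale noise_in_H sum.cong cov_scale)
    have "cov (\<epsilon> i) N = b i * (\<rho> (fst i))\<^sup>2" if i: "i \<in> ?I" for i
    proof -
      have "cov N (\<epsilon> i) = (\<Sum>j\<in>?I. if j = i then b i * (\<rho> (fst i))\<^sup>2 else 0)"
        unfolding 1[OF noise_in_H[OF ID[OF i]]]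
        using ID[OF i] ID cov_noise[of _ i] var_noise[of i] by (intro sum.cong) auto
      also have "\<dots> = b i * (\<rho> (fst i))\<^sup>2" using i S(1) by (subst sum.delta) auto
      finally show ?thesis using covariance_commute[of M "\<epsilon> i" N] by simp
    qed
    then show ?thesis unfolding 1[OF NH] by (intro sum.cong) (auto simp: power2_eq_square)
  qed
  also have "\<dots> = (\<Sum>s\<in>S. (\<beta> s)\<^sup>2 * (\<rho> s)\<^sup>2) / real m"
    using m sum_fst_times[of "\<lambda>s. (\<beta> s / real m)\<^sup>2 * (\<rho> s)\<^sup>2" S m]
    by (simp add: b_def power_divide sum_divide_distrib sum_distrib_left power2_eq_square)
  finally show ?thesis using irreducible_eq' by simp
qed

end

end

end

section \<open>Convergence of the two decision rules\<close>

context gp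
begin

lemma AE_cond_var_obs:
  assumes "x \<in> D" "set_mset X \<subseteq> D"
  shows "AE \<omega> in M. cond_var M (f x) (occs X) (obs f \<epsilon>) \<omega> = v x X"
  using assms by (intro cond_var_eq_cvar occs_finite Y_in_H f_in_H)

context
  fixes A S :: "'a set" and p :: "nat \<Rightarrow> 'a"
  assumes A: "finite A" "A \<subseteq> D" and S: "finite S" "S \<subseteq> D"
begin

abbreviation "X n \<equiv> sampled p n"

lemma v_mono: "set_mset X' \<subseteq> D \<Longrightarrow> X' \<subseteq># X'' \<Longrightarrow> v a X'' \<le> v a X'"
  by (intro cvar_mono finite_imageI occs_finite image_mono occs_mono)

text \<open>Without correlation between targets and samples the best predictor is 0, so the
  irreducible variance is already the prior one; at a point of both sets the hypothesis makes the
  prior variance vanish. Both bounds then hold with constant 0 and need no lower bound of the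
  capacity.\<close>

lemma uncorrelated_case:
  assumes k0: "\<And>a z. a \<in> A \<Longrightarrow> z \<in> S \<Longrightarrow> k a z = 0" and x: "x \<in> A"
  shows "v x B \<le> \<eta> x S" and "x \<in> S \<Longrightarrow> v x B \<le> 0"
proof -
  have xD: "x \<in> D" using x A by auto
  have "(\<lambda>_. 0) \<in> lspan (f ` S)" by (rule lspan_zero)
  then have "residual (f x) (f ` S) (f x)"
    unfolding residual_def using k0[OF x] cov_f[OF xD] S(2)
    by (intro conjI bexI[of _ "\<lambda>_. 0"]) auto
  then have "\<eta> x S = cov (f x) (f x)"
    by (intro cvar_residual fA_in_H S f_in_H xD)
  then show "v x B \<le> \<eta> x S" using cvar_le_cov by simp
  show "v x B \<le> 0" if "x \<in> S"
    using cvar_le_cov[of "f x" "Y B"] cov_f[OF xD xD] k0[OF x that] by simp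
qed

section \<open>The ITL rule\<close>

context
  assumes itl: "itl_rule M f \<epsilon> A S p" and sub: "submodular M S (itl_reduction M f \<epsilon> A)"
begin

lemma itl_in_S: "i \<ge> 1 \<Longrightarrow> p i \<in> S"
  using itl unfolding itl_rule_def Let_def is_arg_max_def by auto

lemma itl_set: "set_mset (X n) \<subseteq> S" "set_mset (X n) \<subseteq> D"
  using set_sampled[of p S n] itl_in_S S(2) by auto

lemma itl_submod: "submod S (info A)"
  unfolding submod_def
proof (intro ballI allI impI)
  fix x X' X'' assume "x \<in> S" "X' \<subseteq># X''" "set_mset X'' \<subseteq> S"
  then have "AE \<omega> in M. info A (add_mset x X'') - info A X'' \<le> info A (add_mset x X') - info A X'"
    using sub unfolding submodular_def itl_reduction_def by blast
  then show "info A (add_mset x X'') - info A X'' \<le> info A (add_mset x X') - info A X'"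
    by (rule AE_const_prob[OF prob_space_axioms])
qed

lemma itl_greedy:
  assumes x: "x \<in> S"
  shows "info A (add_mset x (X n)) \<le> info A (X (Suc n))"
proof -
  have "cond_minfo M A f (obs f \<epsilon> (x, count (X n) x)) (occs (X n)) (obs f \<epsilon>)
      \<le> cond_minfo M A f (obs f \<epsilon> (p (Suc n), count (X n) (p (Suc n)))) (occs (X n)) (obs f \<epsilon>)"
    using itl x unfolding itl_rule_def Let_def is_arg_max_def
    by (auto dest!: spec[of _ "Suc n"] simp: not_less)
  moreover have "x \<in> D" "p (Suc n) \<in> D" using x S(2) itl_in_S[of "Suc n"] by auto
  ultimately show ?thesis
    unfolding sampled_Suc by (simp only: info_add[OF A itl_set(2)] add_le_cancel_left)
qed

lemma itl_gain_le:
  assumes n: "n \<ge> 1" and x: "x \<in> S"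
  shows "info A (add_mset x (X n)) - info A (X n) \<le> capacity M f \<epsilon> A S n / real n"
proof -
  have "real n * (info A (add_mset x (X n)) - info A (X n)) \<le> info A (X n) - info A {#}"
    using submod_greedy[OF itl_submod itl_in_S itl_greedy x] .
  also have "\<dots> \<le> capacity M f \<epsilon> A S n"
    using capacity_ge[OF S itl_set(1), of n n] info_empty[OF A] by (simp add: size_sampled)
  finally show ?thesis using n by (simp add: field_simps)
qed

lemma itl_bound:
  assumes n: "n \<ge> 1" and m: "m \<ge> 1" and x: "x \<in> A"
    and \<beta>: "\<And>s'. s' \<in> S \<Longrightarrow> (\<Sum>s\<in>S. \<beta> s * k s s') = k x s'"
  shows "v x (X n) \<le> \<eta> x S + (\<Sum>s\<in>S. (\<beta> s)\<^sup>2 * (\<rho> s)\<^sup>2) / real m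
    + 2 * k x x * (real (card S * m) * (capacity M f \<epsilon> A S n / real n))"
proof -
  let ?B = "copies S m"
  have xD: "x \<in> D" using x A by auto
  \<comment> \<open>Summing \<open>reduction_le_gain\<close> along the batch: variance reductions
    and information gains both telescope.\<close>
  have red: "v x (X n) - v x (X n + B) \<le> 2 * k x x * (info A (X n + B) - info A (X n))"
    if "set_mset B \<subseteq> S" for B
    using that
  proof (induction B)
    case (add b B)
    have XB: "set_mset (X n + B) \<subseteq> D" "b \<in> D" using add.prems itl_set(2)[of n] S(2) by auto
    have "v x (X n + B) - v x (add_mset b (X n + B)) \<le> 2 * k x x * (info A (add_mset b (X n + B)) - info A (X n + B))"
      using reduction_le_gain[OF A XB x] info_add(1)[OF A XB] by simp
    then show ?case using add by (simp add: algebra_simps)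
  qed simp
  have B: "set_mset ?B \<subseteq> S" using S(1) by (rule set_copies)
  have "v x (X n) \<le> v x (X n + ?B) + 2 * k x x * (info A (X n + ?B) - info A (X n))"
    using red[OF B] by simp
  also have "\<dots> \<le> (\<eta> x S + (\<Sum>s\<in>S. (\<beta> s)\<^sup>2 * (\<rho> s)\<^sup>2) / real m)
      + 2 * k x x * (real (card S * m) * (capacity M f \<epsilon> A S n / real n))"
  proof (intro add_mono mult_left_mono)
    have "v x (X n + ?B) \<le> v x ?B" using B S(2) by (intro v_mono) auto
    also have "\<dots> \<le> \<eta> x S + (\<Sum>s\<in>S. (\<beta> s)\<^sup>2 * (\<rho> s)\<^sup>2) / real m"
      by (rule copies_variance_le[OF S xD \<beta> m])
    finally show "v x (X n + ?B) \<le> \<eta> x S + (\<Sum>s\<in>S. (\<beta> s)\<^sup>2 * (\<rho> s)\<^sup>2) / real m" .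
    show "info A (X n + ?B) - info A (X n) \<le> real (card S * m) * (capacity M f \<epsilon> A S n / real n)"
      using submod_batch[OF itl_submod itl_set(1) B itl_gain_le[OF n]] by (simp add: size_copies)
    show "0 \<le> 2 * k x x" using k_nonneg[OF xD] by simp
  qed
  finally show ?thesis .
qed

lemma itl_bound_sample:
  assumes n: "n \<ge> 1" and x: "x \<in> A" "x \<in> S"
  shows "v x (X n) \<le> 2 * (k x x + (\<rho> x)\<^sup>2) * (capacity M f \<epsilon> A S n / real n)"
proof -
  have xD: "x \<in> D" using x A by auto
  have "v x (X n) \<le> 2 * (k x x + (\<rho> x)\<^sup>2) * (info A (add_mset x (X n)) - info A (X n))"
    using variance_le_gain[OF A itl_set(2) x(1)] info_add(1)[OF A itl_set(2) xD] by simp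
  also have "\<dots> \<le> 2 * (k x x + (\<rho> x)\<^sup>2) * (capacity M f \<epsilon> A S n / real n)"
    using itl_gain_le[OF n x(2)] k_nonneg[OF xD] by (intro mult_left_mono) auto
  finally show ?thesis .
qed

end

section \<open>The VTL rule\<close>

context
  assumes vtl: "vtl_rule M f \<epsilon> A S p" and sub: "submodular M S (vtl_reduction M f \<epsilon> A)"
begin

abbreviation "totvar X' \<equiv> \<Sum>a\<in>A. v a X'"

lemma AE_total:
  assumes "set_mset X' \<subseteq> D"
  shows "AE \<omega> in M. (\<Sum>a\<in>A. cond_var M (f a) (occs X') (obs f \<epsilon>) \<omega>) = totvar X'"
proof -
  have "AE \<omega> in M. \<forall>a\<in>A. cond_var M (f a) (occs X') (obs f \<epsilon>) \<omega> = v a X'"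
    using A assms by (intro AE_finite_allI AE_cond_var_obs) auto
  then show ?thesis by eventually_elim simp
qed

lemma vtl_in_S:
  assumes "i \<ge> 1"
  shows "p i \<in> S"
proof -
  have "AE \<omega> in M. p i \<in> S"
    using vtl assms unfolding vtl_rule_def Let_def is_arg_min_def
    by (auto dest!: spec[of _ i] elim: eventually_mono)
  then show ?thesis by (rule AE_const_prob[OF prob_space_axioms])
qed

lemma vtl_set: "set_mset (X n) \<subseteq> S" "set_mset (X n) \<subseteq> D"
  using set_sampled[of p S n] vtl_in_S S(2) by auto

lemma vtl_greedy:
  assumes x: "x \<in> S"
  shows "totvar (X (Suc n)) \<le> totvar (add_mset x (X n))"
proof -
  have "AE \<omega> in M. is_arg_min (\<lambda>x. \<Sum>a\<in>A. cond_var M (f a) (occs (add_mset x (X n))) (obs f \<epsilon>) \<omega>)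
      (\<lambda>x. x \<in> S) (p (Suc n))"
    using vtl unfolding vtl_rule_def Let_def by (auto dest!: spec[of _ "Suc n"])
  moreover have "AE \<omega> in M. (\<Sum>a\<in>A. cond_var M (f a) (occs (add_mset x (X n))) (obs f \<epsilon>) \<omega>) = totvar (add_mset x (X n))"
    using vtl_set[of n] x S(2) by (intro AE_total) auto
  moreover have "AE \<omega> in M. (\<Sum>a\<in>A. cond_var M (f a) (occs (add_mset (p (Suc n)) (X n))) (obs f \<epsilon>) \<omega>) = totvar (X (Suc n))"
    unfolding sampled_Suc using vtl_set[of "Suc n"] by (intro AE_total) (simp add: sampled_Suc)
  ultimately have "AE \<omega> in M. totvar (X (Suc n)) \<le> totvar (add_mset x (X n))"
    by eventually_elim (use x in \<open>auto simp: is_arg_min_def not_less\<close>)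
  then show ?thesis by (rule AE_const_prob[OF prob_space_axioms])
qed

lemma vtl_submod: "submod S (\<lambda>X'. - totvar X')"
  unfolding submod_def
proof (intro ballI allI impI)
  fix x X' X'' assume x: "x \<in> S" "X' \<subseteq># X''" "set_mset X'' \<subseteq> S"
  then have "set_mset X' \<subseteq> S" by (meson order_trans set_mset_mono)
  then have D: "set_mset X' \<subseteq> D" "set_mset X'' \<subseteq> D" "set_mset (add_mset x X') \<subseteq> D" "set_mset (add_mset x X'') \<subseteq> D"
    using x S(2) by auto
  have "AE \<omega> in M. vtl_reduction M f \<epsilon> A (add_mset x X'') \<omega> - vtl_reduction M f \<epsilon> A X'' \<omega>
      \<le> vtl_reduction M f \<epsilon> A (add_mset x X') \<omega> - vtl_reduction M f \<epsilon> A X' \<omega>"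
    using sub x unfolding submodular_def by blast
  then have "AE \<omega> in M. - totvar (add_mset x X'') - - totvar X'' \<le> - totvar (add_mset x X') - - totvar X'"
    using AE_total[OF D(1)] AE_total[OF D(2)] AE_total[OF D(3)] AE_total[OF D(4)]
    by eventually_elim (simp add: vtl_reduction_def)
  then show "- totvar (add_mset x X'') - - totvar X'' \<le> - totvar (add_mset x X') - - totvar X'"
    by (rule AE_const_prob[OF prob_space_axioms])
qed

text \<open>
  The excess \<open>e n\<close> of the total variance satisfies \<open>e n \<le> C / m + m * card S * (e n - e (n + 1))\<close>
  for all \<open>m \<ge> 1\<close>; the choice \<open>m \<approx> 2 C / e n\<close> gives \<open>c * (e n)\<^sup>2 \<le> e n - e (n + 1)\<close>.
\<close>

lemma vtl_bound:
  assumes x: "x \<in> A"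
    and \<beta>: "\<And>a s'. a \<in> A \<Longrightarrow> s' \<in> S \<Longrightarrow> (\<Sum>s\<in>S. \<beta> a s * k s s') = k a s'"
  shows "real n * (v x (X n) - \<eta> x S)
    \<le> 2 * real (card S) * (2 * (\<Sum>a\<in>A. \<Sum>s\<in>S. (\<beta> a s)\<^sup>2 * (\<rho> s)\<^sup>2) + (\<Sum>a\<in>A. k a a) + 1)"
proof -
  define C K where "C = (\<Sum>a\<in>A. \<Sum>s\<in>S. (\<beta> a s)\<^sup>2 * (\<rho> s)\<^sup>2)" and "K = (\<Sum>a\<in>A. k a a)"
  \<comment> \<open>Obtained by multiplying
    \<open>e n / 2 \<le> m * card S * (e n - e (Suc n))\<close> by \<open>2 * e n\<close> and using
    \<open>m \<le> (2 * C + K + 1) / e n\<close>. The summand 1 keeps \<open>KV\<close>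
    positive.\<close>
  define KV where "KV = 2 * real (card S) * (2 * C + K + 1)"
  define e where "e n = (\<Sum>a\<in>A. v a (X n) - \<eta> a S)" for n
  have AD: "a \<in> D" if "a \<in> A" for a using that A by auto
  have C0: "0 \<le> C" unfolding C_def by (intro sum_nonneg) auto
  have K0: "0 \<le> K" unfolding K_def using k_nonneg AD by (intro sum_nonneg) auto
  have "S \<noteq> {}" using vtl_in_S[of 1] by auto
  then have "card S \<ge> 1" using S(1) by (simp add: Suc_leI card_gt_0_iff)
  then have KV: "KV > 0" unfolding KV_def using C0 K0 by (intro mult_pos_pos) auto
  have ge: "0 \<le> v a (X n) - \<eta> a S" if "a \<in> A" for a n
    using irreducible_le[OF S AD[OF that] \<beta>[OF that] vtl_set(1)] by simp
  have e0: "0 \<le> e n" for n unfolding e_def by (intro sum_nonneg ge)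
  have eK: "e n \<le> K" for n
    unfolding e_def K_def
  proof (intro sum_mono)
    fix a assume a: "a \<in> A"
    show "v a (X n) - \<eta> a S \<le> k a a"
      using cvar_le_cov[of "f a" "Y (X n)"] cvar_nonneg[of "f a" "f ` S"] cov_f[OF AD[OF a] AD[OF a]] by simp
  qed
  have mono: "e (Suc n) \<le> e n" for n
    unfolding e_def using vtl_set(2)[of n]
    by (intro sum_mono diff_right_mono v_mono) (auto simp: sampled_Suc)
  have step: "e n \<le> C / real m + real (card S * m) * (e n - e (Suc n))" if m: "m \<ge> 1" for n m
  proof -
    let ?B = "copies S m"
    have B: "set_mset ?B \<subseteq> S" using S(1) by (rule set_copies)
    have "- totvar (X n + ?B) - - totvar (X n) \<le> real (size ?B) * (e n - e (Suc n))"
    proof (rule submod_batch[OF vtl_submod vtl_set(1) B])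
      fix z assume "z \<in> S"
      then show "- totvar (add_mset z (X n)) - - totvar (X n) \<le> e n - e (Suc n)"
        using vtl_greedy[of z n] by (simp add: e_def sum_subtractf)
    qed
    then have "e n \<le> (\<Sum>a\<in>A. v a (X n + ?B) - \<eta> a S) + real (card S * m) * (e n - e (Suc n))"
      by (simp add: e_def sum_subtractf size_copies)
    also have "(\<Sum>a\<in>A. v a (X n + ?B) - \<eta> a S) \<le> (\<Sum>a\<in>A. (\<Sum>s\<in>S. (\<beta> a s)\<^sup>2 * (\<rho> s)\<^sup>2) / real m)"
    proof (intro sum_mono)
      fix a assume a: "a \<in> A"
      have "v a (X n + ?B) \<le> v a ?B" using B S(2) by (intro v_mono) auto
      also have "\<dots> \<le> \<eta> a S + (\<Sum>s\<in>S. (\<beta> a s)\<^sup>2 * (\<rho> s)\<^sup>2) / real m"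
        by (rule copies_variance_le[OF S AD[OF a] \<beta>[OF a] m])
      finally show "v a (X n + ?B) - \<eta> a S \<le> (\<Sum>s\<in>S. (\<beta> a s)\<^sup>2 * (\<rho> s)\<^sup>2) / real m" by simp
    qed
    also have "\<dots> = C / real m" by (simp add: C_def sum_divide_distrib)
    finally show ?thesis by simp
  qed
  have dec: "1 / KV * (e n)\<^sup>2 \<le> e n - e (Suc n)" for n
  proof (cases "e n = 0")
    case True
    then show ?thesis using mono[of n] by simp
  next
    case False
    then have pos: "e n > 0" using e0[of n] by simp
    \<comment> \<open>Large enough that the batch error \<open>C / m\<close> is at most half of
      \<open>e n\<close>; the other half must be paid by the decrease of \<open>e\<close>. Adding 1
      ensures \<open>m \<ge> 1\<close> even if \<open>C = 0\<close>.\<close>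
    define m where "m = nat \<lfloor>2 * C / e n\<rfloor> + 1"
    have q0: "0 \<le> 2 * C / e n" using C0 pos by simp
    have m1: "m \<ge> 1" by (simp add: m_def)
    have m_ge: "2 * C / e n \<le> real m" and m_le: "real m \<le> 2 * C / e n + 1"
      unfolding m_def using q0 by linarith+
    have "C / real m \<le> e n / 2"
      using m_ge pos m1 by (simp add: field_simps)
    then have "e n / 2 \<le> real m * (real (card S) * (e n - e (Suc n)))"
    proof -
      have "e n \<le> C / real m + real m * (real (card S) * (e n - e (Suc n)))"
        using step[OF m1, of n] by (simp only: of_nat_mult mult.commute mult.left_commute)
      with \<open>C / real m \<le> e n / 2\<close> show ?thesis by linarith
    qed
    also have "\<dots> \<le> ((2 * C + K + 1) / e n) * (real (card S) * (e n - e (Suc n)))"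
    proof (rule mult_right_mono)
      have "real m \<le> 2 * C / e n + K / e n"
        \<comment> \<open>The rounding term 1 is at most \<open>K / e n\<close>, because
          \<open>e n\<close> never exceeds the total prior variance \<open>K\<close>.\<close>
        using m_le eK[of n] pos by (smt (verit) divide_le_cancel divide_self)
      also have "\<dots> \<le> (2 * C + K + 1) / e n" using pos by (simp add: add_divide_distrib)
      finally show "real m \<le> (2 * C + K + 1) / e n" .
    qed (use mono[of n] in auto)
    finally have "(e n)\<^sup>2 \<le> KV * (e n - e (Suc n))"
      using pos by (simp add: KV_def field_simps power2_eq_square)
    then show ?thesis using KV by (simp add: field_simps)
  qed
  have "1 / KV * real n * e n \<le> 1"
    using KV by (intro quadratic_decay e0 dec) auto
  then have "real n * e n \<le> KV" using KV by (simp add: field_simps)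
  moreover have "v x (X n) - \<eta> x S \<le> e n"
    unfolding e_def using member_le_sum[OF x, of "\<lambda>a. v a (X n) - \<eta> a S"] ge A(1) by auto
  ultimately show ?thesis
    unfolding KV_def C_def K_def by (meson mult_left_mono of_nat_0_le_iff order_trans)
qed

end

end

end

section \<open>Constants that are uniform over all models and serve both rules\<close>

theorem theorem3p3:
  fixes D A S :: "'a set"
    and k :: "'a \<Rightarrow> 'a \<Rightarrow> real"
    and \<rho> :: "'a \<Rightarrow> real"
  assumes "finite A" and "A \<subseteq> D"
    and "finite S" and "S \<subseteq> D"
    and "\<And>x. x \<in> D \<Longrightarrow> \<rho> x > 0"
  shows "\<exists>C C' :: real.
    \<forall>(M :: 'w measure) (f :: 'a \<Rightarrow> 'w \<Rightarrow> real) (\<epsilon> :: 'a \<times> nat \<Rightarrow> 'w \<Rightarrow> real)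
      (\<mu> :: 'a \<Rightarrow> real) (p :: nat \<Rightarrow> 'a).
      gp_model M D f \<epsilon> \<mu> k \<rho> \<longrightarrow>
      sublinear (full_capacity M f \<epsilon> D) \<longrightarrow>
      (vtl_rule M f \<epsilon> A S p \<and> submodular M S (vtl_reduction M f \<epsilon> A)) \<or>
      (itl_rule M f \<epsilon> A S p \<and> submodular M S (itl_reduction M f \<epsilon> A)) \<longrightarrow>
      (\<forall>n\<ge>1. \<forall>x\<in>A. AE \<omega> in M.
         post_var M f \<epsilon> p n x \<omega>
           \<le> irred_var M f S x \<omega> + C * (capacity M f \<epsilon> A S n / sqrt (real n))) \<and>
      (\<forall>n\<ge>1. \<forall>x\<in>A \<inter> S. AE \<omega> in M.
         post_var M f \<epsilon> p n x \<omega> \<le> C' * (capacity M f \<epsilon> A S n / real n))"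
proof -
  note A = assms(1,2) and S = assms(3,4)
  \<comment> \<open>Chosen from \<open>k\<close> before any model is fixed; that a solution exists
    is known once a model with this kernel is given.\<close>
  define \<beta> where "\<beta> a = (SOME b. \<forall>s'\<in>S. (\<Sum>s\<in>S. b s * k s s') = k a s')" for a
  define K where "K = (\<Sum>a\<in>A. k a a)"
  define N where "N = (\<Sum>a\<in>A. \<Sum>s\<in>S. (\<beta> a s)\<^sup>2 * (\<rho> s)\<^sup>2)"
  define KV where "KV = 2 * real (card S) * (2 * N + K + 1)"
  have N_ge: "(\<Sum>s\<in>S. (\<beta> x s)\<^sup>2 * (\<rho> s)\<^sup>2) \<le> N" if "x \<in> A" for x
    unfolding N_def using A(1)
    by (intro member_le_sum[OF that, of "\<lambda>a. \<Sum>s\<in>S. (\<beta> a s)\<^sup>2 * (\<rho> s)\<^sup>2"]) (auto intro!: sum_nonneg)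
  have N0: "0 \<le> N" unfolding N_def by (intro sum_nonneg) auto
  \<comment> \<open>Stated outside the locale, with \<open>cvar\<close> taking \<open>M\<close> as
    an argument, so that the constants are quantified before the model. For the same reason the case
    distinction that follows concerns \<open>k\<close> only.\<close>
  have "\<exists>C C'. \<forall>(M :: 'w measure) f \<epsilon> \<mu> p n x. gp M D f \<epsilon> \<mu> k \<rho> \<longrightarrow>
      (vtl_rule M f \<epsilon> A S p \<and> submodular M S (vtl_reduction M f \<epsilon> A)) \<or>
      (itl_rule M f \<epsilon> A S p \<and> submodular M S (itl_reduction M f \<epsilon> A)) \<longrightarrow> n \<ge> 1 \<longrightarrow> x \<in> A \<longrightarrow>
      gaussian_space.cvar M (f x) (obs f \<epsilon> ` occs (sampled p n))
        \<le> gaussian_space.cvar M (f x) (f ` S) + C * (capacity M f \<epsilon> A S n / sqrt (real n)) \<and>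
      (x \<in> S \<longrightarrow> gaussian_space.cvar M (f x) (obs f \<epsilon> ` occs (sampled p n))
        \<le> C' * (capacity M f \<epsilon> A S n / real n))"
    (is "\<exists>C C'. \<forall>M f \<epsilon> \<mu> p n x. ?gp M f \<epsilon> \<mu> \<longrightarrow> ?rule M f \<epsilon> p \<longrightarrow> _ \<longrightarrow> _ \<longrightarrow> ?b1 C M f \<epsilon> p n x \<and> ?b2 C' M f \<epsilon> p n x")
  proof (cases "\<exists>a\<in>A. \<exists>z\<in>S. k a z \<noteq> 0")
    case False
    have "?b1 0 M f \<epsilon> p n x \<and> ?b2 0 M f \<epsilon> p n x" if gp: "?gp M f \<epsilon> \<mu>" and x: "x \<in> A"
      for M :: "'w measure" and f \<epsilon> \<mu> p n x
    proof -
      interpret gp M D f \<epsilon> \<mu> k \<rho> by (rule gp)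
      show ?thesis
        using uncorrelated_case[OF A S _ x, of "sampled p n"] False by auto
    qed
    then show ?thesis by blast
  next
    case True
    then obtain a z where az: "a \<in> A" "z \<in> S" "k a z \<noteq> 0" by blast
    define c where "c = (k a z)\<^sup>2 / (k z z + (\<rho> z)\<^sup>2) / (2 * k a a)"
    define R where "R = 2 * (\<Sum>x\<in>A. k x x + (\<rho> x)\<^sup>2)"
    \<comment> \<open>For ITL, \<open>N / c\<close> covers the batch error and
      \<open>4 * K * card S\<close> the information spent by the batch; \<open>R\<close> covers ITL
      at sampled targets. \<open>KV / c\<close> is the rate for VTL. Sums of nonnegative terms serve
      both rules at once.\<close>
    have "?b1 (N / c + 4 * K * real (card S) + KV / c) M f \<epsilon> p n x \<and> ?b2 (KV / c + R) M f \<epsilon> p n x"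
      if gp: "?gp M f \<epsilon> \<mu>" and rule: "?rule M f \<epsilon> p" and n: "n \<ge> 1" and x: "x \<in> A"
      for M :: "'w measure" and f \<epsilon> \<mu> p n x
    proof -
      interpret gp M D f \<epsilon> \<mu> k \<rho> by (rule gp)
      let ?cap = "capacity M f \<epsilon> A S n"
      have xD: "x \<in> D" and zD: "z \<in> D" using x az A S by auto
      have \<beta>: "(\<Sum>s\<in>S. \<beta> a s * k s s') = k a s'" if "a \<in> A" "s' \<in> S" for a s'
        using someI_ex[OF normal_equations_solvable[OF S, of a]] that A unfolding \<beta>_def by auto
      have K: "k x x \<le> K" "0 \<le> K"
        unfolding K_def using A k_nonneg by (auto intro!: member_le_sum[OF x, of "\<lambda>x. k x x"] sum_nonneg)
      have R: "2 * (k x x + (\<rho> x)\<^sup>2) \<le> R" "0 \<le> R"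
      proof -
        have "0 \<le> k y y + (\<rho> y)\<^sup>2" if "y \<in> A" for y using that A k_nonneg by auto
        then show "2 * (k x x + (\<rho> x)\<^sup>2) \<le> R" "0 \<le> R"
          unfolding R_def using A(1) by (auto intro!: mult_left_mono member_le_sum[OF x] sum_nonneg simp del: distrib_left_numeral)
      qed
      have KV: "0 \<le> KV" unfolding KV_def using K N0 by simp
      have c0: "0 < c"
        unfolding c_def using first_gain_ge(1)[OF A az(1) zD az(3)] k_nonneg[OF zD] assms(5)[OF zD] az(3)
        by (intro divide_pos_pos add_nonneg_pos) auto
      have "c \<le> info A {#z#}"
        unfolding c_def by (rule first_gain_ge(2)[OF A az(1) zD az(3)])
      also have "\<dots> \<le> ?cap" using az n by (intro capacity_ge[OF S]) auto
      finally have cap: "c \<le> ?cap" .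
      then have cap0: "0 \<le> ?cap" using c0 by simp
      have n0: "0 < real n" "0 < sqrt (real n)" "1 \<le> sqrt (real n)" using n by auto
      have sq: "sqrt (real n) * sqrt (real n) = real n" by simp
      \<comment> \<open>An error term without information is multiplied by \<open>?cap / c\<close>,
        which is at least 1.\<close>
      have scale: "B / t \<le> B / c * (?cap / t)" if "0 \<le> B" "0 < t" for B t :: real
      proof -
        have "B / t * 1 \<le> B / t * (?cap / c)"
          using that cap c0 by (intro mult_left_mono) auto
        then show ?thesis by (simp add: mult.commute)
      qed
      from rule show ?thesis
      proof
        assume vtl: "vtl_rule M f \<epsilon> A S p \<and> submodular M S (vtl_reduction M f \<epsilon> A)"
        have "real n * (v x (sampled p n) - \<eta> x S) \<le> KV"
          unfolding KV_def N_def K_def using vtl_bound[OF A S _ _ x, of p \<beta> n] vtl \<beta> by blast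
        then have V: "v x (sampled p n) - \<eta> x S \<le> KV / real n"
          using n0 by (simp add: pos_le_divide_eq mult.commute)
        \<comment> \<open>The VTL excess decays like 1 / n, which is faster than this bound asks
          for.\<close>
        also have "\<dots> \<le> KV / sqrt (real n)"
          using KV n0 mult_left_mono[OF n0(3), of "sqrt (real n)"] sq by (intro divide_left_mono) auto
        also have "\<dots> \<le> KV / c * (?cap / sqrt (real n))" using KV n0 by (intro scale)
        also have "\<dots> \<le> (N / c + 4 * K * real (card S) + KV / c) * (?cap / sqrt (real n))"
          using N0 c0 K n0 cap0 by (intro mult_right_mono) auto
        finally have "?b1 (N / c + 4 * K * real (card S) + KV / c) M f \<epsilon> p n x" by simp
        moreover have "?b2 (KV / c + R) M f \<epsilon> p n x"
        proof
          assume xS: "x \<in> S"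
          have "\<eta> x S = 0" using xS S(1) by (intro cvar_member) auto
          then have "v x (sampled p n) \<le> KV / real n" using V by simp
          also have "\<dots> \<le> KV / c * (?cap / real n)" using KV n0 by (intro scale)
          also have "\<dots> \<le> (KV / c + R) * (?cap / real n)"
            using R n0 cap0 by (intro mult_right_mono) auto
          finally show "v x (sampled p n) \<le> (KV / c + R) * (?cap / real n)" .
        qed
        ultimately show ?thesis ..
      next
        assume itl: "itl_rule M f \<epsilon> A S p \<and> submodular M S (itl_reduction M f \<epsilon> A)"
        \<comment> \<open>Balances the batch error of order \<open>1 / m\<close> against the
          information term of order \<open>m / n\<close>. Rounding up costs at most a factor 2 since
          \<open>sqrt n \<ge> 1\<close>, whence the 4 in the constant.\<close>
        define m where "m = nat \<lceil>sqrt (real n)\<rceil>"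
        have m_ge: "sqrt (real n) \<le> real m" and "real m \<le> sqrt (real n) + 1"
          unfolding m_def using n0 by linarith+
        then have m_le: "real m \<le> 2 * sqrt (real n)" using n0 by linarith
        have m: "m \<ge> 1" using m_ge n0 by linarith
        have "v x (sampled p n) \<le> \<eta> x S + (\<Sum>s\<in>S. (\<beta> x s)\<^sup>2 * (\<rho> s)\<^sup>2) / real m
            + 2 * k x x * (real (card S * m) * (?cap / real n))"
          using itl_bound[OF A S _ _ n m x, of p "\<beta> x"] itl \<beta>[OF x] by blast
        also have "\<dots> \<le> \<eta> x S + N / c * (?cap / sqrt (real n))
            + 4 * K * real (card S) * (?cap / sqrt (real n))"
        proof (intro add_mono order_refl)
          have "(\<Sum>s\<in>S. (\<beta> x s)\<^sup>2 * (\<rho> s)\<^sup>2) / real m \<le> N / sqrt (real n)"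
            using N_ge[OF x] N0 m_ge n0 by (intro frac_le) auto
          also have "\<dots> \<le> N / c * (?cap / sqrt (real n))" using N0 n0 by (intro scale)
          finally show "(\<Sum>s\<in>S. (\<beta> x s)\<^sup>2 * (\<rho> s)\<^sup>2) / real m \<le> N / c * (?cap / sqrt (real n))" .
          have "2 * k x x * (real (card S * m) * (?cap / real n))
              = (2 * real (card S) * (?cap / real n)) * (k x x * real m)"
            by simp
          also have "\<dots> \<le> (2 * real (card S) * (?cap / real n)) * (K * (2 * sqrt (real n)))"
            using K m_le k_nonneg[OF xD] cap0 n0 by (intro mult_left_mono mult_mono) auto
          also have "\<dots> = 4 * K * real (card S) * (?cap / sqrt (real n))"
            using n0 sq by (simp add: field_simps)
          finally show "2 * k x x * (real (card S * m) * (?cap / real n))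
              \<le> 4 * K * real (card S) * (?cap / sqrt (real n))" .
        qed
        also have "\<dots> = \<eta> x S + (N / c + 4 * K * real (card S)) * (?cap / sqrt (real n))"
          by (simp add: algebra_simps)
        also have "\<dots> \<le> \<eta> x S + (N / c + 4 * K * real (card S) + KV / c) * (?cap / sqrt (real n))"
          using KV c0 cap0 n0 by (intro add_left_mono mult_right_mono) auto
        finally have "?b1 (N / c + 4 * K * real (card S) + KV / c) M f \<epsilon> p n x" .
        moreover have "?b2 (KV / c + R) M f \<epsilon> p n x"
        proof
          assume xS: "x \<in> S"
          have "v x (sampled p n) \<le> 2 * (k x x + (\<rho> x)\<^sup>2) * (?cap / real n)"
            using itl_bound_sample[OF A S _ _ n x xS, of p] itl by blast
          also have "\<dots> \<le> (KV / c + R) * (?cap / real n)"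
            using R KV c0 n0 cap0 by (intro mult_right_mono) (auto intro: add_increasing)
          finally show "v x (sampled p n) \<le> (KV / c + R) * (?cap / real n)" .
        qed
        ultimately show ?thesis ..
      qed
    qed
    then show ?thesis by blast
  qed
  then obtain C C' where CC: "\<And>(M :: 'w measure) f \<epsilon> \<mu> p n x. ?gp M f \<epsilon> \<mu> \<Longrightarrow> ?rule M f \<epsilon> p \<Longrightarrow> n \<ge> 1 \<Longrightarrow>
      x \<in> A \<Longrightarrow> ?b1 C M f \<epsilon> p n x \<and> ?b2 C' M f \<epsilon> p n x"
    by blast
  show ?thesis
  proof (rule exI[of _ C], rule exI[of _ C'], intro allI impI)
    fix M :: "'w measure" and f \<epsilon> \<mu> p
    assume model: "gp_model M D f \<epsilon> \<mu> k \<rho>" and rule: "?rule M f \<epsilon> p"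
    have gp: "?gp M f \<epsilon> \<mu>" using model assms(5) by unfold_locales
    then interpret gp M D f \<epsilon> \<mu> k \<rho> .
    have "p i \<in> S" if "i \<ge> 1" for i
      using rule itl_in_S[OF A S _ _ that] vtl_in_S[OF A S _ _ that] by blast
    then have pS: "set_mset (sampled p n) \<subseteq> D" for n
      using set_sampled[of p S n] S(2) by auto
    have post: "AE \<omega> in M. post_var M f \<epsilon> p n x \<omega> = v x (sampled p n)" if "x \<in> A" for x n
      unfolding post_var_def using that A pS by (intro AE_cond_var_obs) auto
    have irred: "AE \<omega> in M. irred_var M f S x \<omega> = \<eta> x S" if "x \<in> A" for x
      unfolding irred_var_def using that A S by (intro cond_var_eq_cvar fA_in_H f_in_H) auto
    show "(\<forall>n\<ge>1. \<forall>x\<in>A. AE \<omega> in M. post_var M f \<epsilon> p n x \<omega>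
          \<le> irred_var M f S x \<omega> + C * (capacity M f \<epsilon> A S n / sqrt (real n))) \<and>
        (\<forall>n\<ge>1. \<forall>x\<in>A \<inter> S. AE \<omega> in M.
          post_var M f \<epsilon> p n x \<omega> \<le> C' * (capacity M f \<epsilon> A S n / real n))"
    proof (intro conjI allI impI ballI)
      fix n :: nat and x
      assume n: "1 \<le> n" and x: "x \<in> A"
      show "AE \<omega> in M. post_var M f \<epsilon> p n x \<omega>
          \<le> irred_var M f S x \<omega> + C * (capacity M f \<epsilon> A S n / sqrt (real n))"
        using post[OF x, of n] irred[OF x] by eventually_elim (use CC[OF gp rule n x] in simp)
    next
      fix n :: nat and x
      assume n: "1 \<le> n" and x: "x \<in> A \<inter> S"
      then have "AE \<omega> in M. post_var M f \<epsilon> p n x \<omega> = v x (sampled p n)" using post by simp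
      then show "AE \<omega> in M. post_var M f \<epsilon> p n x \<omega> \<le> C' * (capacity M f \<epsilon> A S n / real n)"
        by eventually_elim (use CC[OF gp rule n, of x] x in simp)
    qed
  qed
qed

end
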